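(* Let $(V,c,b)$ be a braided Lie algebra over a field $K$. Let $E(V,c)$ be the space spanned by the primitive elements of $T(V,c)$ of homogeneous degree at least two, and let $\beta:E(V,c)\to V$ be the restriction of $b^{[0]}:P(T(V,c))\to V$ to $E(V,c)$. Then $(V,c,\beta)$ is an $E$-braided Lie algebra, meaning that $$c(\beta\otimes V)=(V\otimes\beta)c_{E(V,c),V},\qquad c(V\otimes\beta)=(\beta\otimes V)c_{V,E(V,c)},$$ and the canonical map $i_{\mathbb U}:V\to\mathbb U(V,c,\beta)$ is injective, where $$\mathbb U(V,c,\beta)=\frac{T(V,c)}{\big((\mathrm{Id}-\beta)[E(V,c)]\big)},$$ and $\mathbb U(V,c,\beta)=U(V,c,b^{[0]})$. Moreover, if $(V,c)$ is in the class $\mathcal S$, then $U(V,c,b)=U(V,c,b^{[0]})$ (i.e. the canonical projection $U(V,c,b^{[0]})\to U(V,c,b)$ is an isomorphism).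
   Context: Fix a field $K$; all vector spaces, tensor products and maps are over $K$ ($K$-linear). An object also denotes its identity map. Braided vector space $(V,c)$: $c:V\otimes V\to V\otimes V$ linear with $(c\otimes V)(V\otimes c)(c\otimes V)=(V\otimes c)(c\otimes V)(V\otimes c)$; a morphism $f:(V,c_V)\to(W,c_W)$ is linear with $c_W(f\otimes f)=(f\otimes f)c_V$. Braided algebra $(A,m,u,c)$: an associative unital algebra and braided vector space with $c(m\otimes A)=(A\otimes m)(c\otimes A)(A\otimes c)$, $c(A\otimes m)=(m\otimes A)(A\otimes c)(c\otimes A)$, $c(u\otimes A)=A\otimes u$, $c(A\otimes u)=u\otimes A$. Braided coalgebra $(C,\Delta,\varepsilon,c)$: a coassociative counital coalgebra and braided vector space with $(\Delta\otimes C)c=(C\otimes c)(c\otimes C)(C\otimes\Delta)$, $(C\otimes\Delta)c=(c\otimes C)(C\otimes c)(\Delta\otimes C)$, $(\varepsilon\otimes C)c=C\otimes\varepsilon$, $(C\otimes\varepsilon)c=\varepsilon\otimes C$. Braided bialgebra $(B,m,u,\Delta,\varepsilon,c)$: a braided algebra and braided coalgebra with $\Delta m=(m\otimes m)(B\otimes c\otimes B)(\Delta\otimes\Delta)$, $\Delta(1)=1\otimes 1$, and $\varepsilon$ an algebra map. Morphisms of braided (bi)algebras are (bi)algebra maps that are morphisms of braided vector spaces. $P(B)=\{x\in B\mid \Delta(x)=x\otimes1+1\otimes x\}$. The braiding $c$ of $B$ satisfies $c(P(B)\otimes B)\subseteq B\otimes P(B)$ and $c(B\otimes P(B))\subseteq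 P(B)\otimes B$. A braided bialgebra map $f:B\to B'$ induces $P(f):P(B)\to P(B')$. Braided tensor algebra $T(V,c)$: the tensor algebra $T(V)$ with the unique braiding $c_T$ extending $c$ and making it a braided algebra, and with $\Delta_T$, $\varepsilon_T$ the algebra maps $\Delta_T:T(V)\to T(V)\otimes_c T(V)$, $\varepsilon_T:T(V)\to K$ such that $\Delta_T(v)=v\otimes1+1\otimes v$, $\varepsilon_T(v)=0$ for $v\in V$, where $T\otimes_cT$ has multiplication $(m_T\otimes m_T)(T\otimes c_T\otimes T)$. $c_{E(V,c),V}:E(V,c)\otimes V\to V\otimes E(V,c)$ and $c_{V,E(V,c)}:V\otimes E(V,c)\to E(V,c)\otimes V$ are the restrictions of $c_T$. $i_{\mathbb U}$ is the composite of $V\subseteq T(V,c)$ with the projection onto $\mathbb U(V,c,\beta)$. A bracket on a braided vector space $(V,c)$ is a family $b=(b^{[n]})_{n\in\mathbb N}$ of linear maps defined together with braided bialgebras $U^{[n]}$ and braided vector space morphisms $i^{[n]}:V\to P^{[n]}:=P(U^{[n]})$ as follows. $U^{[0]}=T(V,c)$ and $i^{[0]}$ is the inclusion. For each $n$, $b^{[n]}:P^{[n]}\to V$ is linear and, with $V^{[n]}:=i^{[n]}(V)$ and $c$ the braiding of $U^{[n]}$, one has on $P^{[n]}\otimes V^{[n]}$ and $V^{[n]}\otimes P^{[n]}$ respectively $c(i^{[n]}b^{[n]}\otimes V^{[n]})=(V^{[n]}\otimes i^{[n]}b^{[n]})c$ and $c(V^{[n]}\otimes i^{[n]}b^{[n]})=(i^{[n]}b^{[n]}\otimes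 V^{[n]})c$ (these make sense as $c$ maps $P^{[n]}\otimes V^{[n]}$ into $V^{[n]}\otimes P^{[n]}$ and conversely). Then $U^{[n+1]}=U^{[n]}/\big((\mathrm{Id}-i^{[n]}b^{[n]})[P^{[n]}]\big)$ (quotient by the two-sided ideal generated) with the unique braided bialgebra structure making the projection $\pi_n^{n+1}:U^{[n]}\to U^{[n+1]}$ a braided bialgebra map, and $i^{[n+1]}=P(\pi_n^{n+1})i^{[n]}$. The universal enveloping algebra is the direct limit $U(V,c,b)=\varinjlim U^{[n]}$ (a braided bialgebra), with canonical map $i_U:V\to U(V,c,b)$. $(V,c,b)$ is a braided Lie algebra if $i_U$ is injective. One writes $U(V,c,b^{[0]}):=U^{[1]}$. The Nichols algebra $\mathcal B(V,c)$ is the unique graded braided bialgebra quotient of $T(V,c)$, by a homogeneous ideal concentrated in degrees $\ge2$, whose space of primitive elements is exactly its degree one component $V$; $p_0^\infty:T(V,c)\to\mathcal B(V,c)$ is the projection. $\mathcal S$ is the class of braided vector spaces $(V,c)$ such that $\mathrm{Ker}(p_0^\infty)$ is the two-sided ideal of $T(V,c)$ generated by $E(V,c)$. *)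

theory Defs
  imports "HOL.Vector_Spaces" "HOL-Library.Function_Algebras"
begin

section \<open>Tensor algebras\<close>

text \<open>
  A vector space over the field \<open>'k\<close> is a subspace \<open>carr A\<close> of a type \<open>'a\<close>, where \<open>'a\<close> carries
  its own addition and the scalar multiplication \<open>scl A\<close>.
\<close>

record ('k, 'a) vsp =
  carr :: "'a set"
  scl :: "'k \<Rightarrow> 'a \<Rightarrow> 'a"

definition vspace :: "('k::field, 'a::ab_group_add, 'z) vsp_scheme \<Rightarrow> bool" where
  "vspace A \<longleftrightarrow> vector_space (scl A) \<and> module.subspace (scl A) (carr A)"

definition linear_map ::
  "'a::ab_group_add set \<Rightarrow> ('k::field \<Rightarrow> 'a \<Rightarrow> 'a) \<Rightarrow> 'b::ab_group_add set \<Rightarrow> ('k \<Rightarrow> 'b \<Rightarrow> 'b) \<Rightarrow> ('a \<Rightarrow> 'b) \<Rightarrow> bool"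
  where "linear_map X s Y s' f \<longleftrightarrow>
    (\<forall>x\<in>X. f x \<in> Y) \<and> (\<forall>x\<in>X. \<forall>y\<in>X. f (x + y) = f x + f y) \<and> (\<forall>a. \<forall>x\<in>X. f (s a x) = s' a (f x))"

text \<open>
  Tensors are realised inside the dual of the space of multilinear forms: \<open>v\<^sub>1 \<otimes> \<dots> \<otimes> v\<^sub>n\<close> is the
  evaluation of forms at \<open>[v\<^sub>1, \<dots>, v\<^sub>n]\<close>, and the \<open>n\<close>-th tensor power is the span of these
  evaluations. Over a field, multilinear forms separate the elements of a tensor power, so this is
  the tensor power (\<open>bij_betw_incl\<close>, \<open>tpow_add\<close>, \<open>linear_map_tmap\<close> and \<open>tmap_tmul\<close> below).
  A ``form'' here is a family consisting of one multilinear form for each number of arguments, so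
  that all tensor powers live in one type and form the tensor algebra, with strictly associative
  and strictly unital product; the scalars are the degree zero part. Tensor products of subspaces
  are subspaces of the ambient tensor product.
\<close>

type_synonym ('k, 'a) tens = "('a list \<Rightarrow> 'k) \<Rightarrow> 'k"

definition pscale :: "'k::field \<Rightarrow> ('i \<Rightarrow> 'k) \<Rightarrow> ('i \<Rightarrow> 'k)" where
  "pscale a f = (\<lambda>i. a * f i)"

global_interpretation tens: vector_space "pscale :: 'k::field \<Rightarrow> ('i \<Rightarrow> 'k) \<Rightarrow> ('i \<Rightarrow> 'k)"
  by standard (auto simp: pscale_def fun_eq_iff algebra_simps)

definition multilinear :: "('k::field, 'a::ab_group_add, 'z) vsp_scheme \<Rightarrow> ('a list \<Rightarrow> 'k) \<Rightarrow> bool" where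
  "multilinear A \<phi> \<longleftrightarrow> (\<forall>us vs. Vector_Spaces.linear (scl A) (*) (\<lambda>x. \<phi> (us @ x # vs)))"

definition pure :: "('k::field, 'a::ab_group_add, 'z) vsp_scheme \<Rightarrow> 'a list \<Rightarrow> ('k, 'a) tens" where
  "pure A w = (\<lambda>\<phi>. if multilinear A \<phi> then \<phi> w else 0)"

definition tpow :: "('k::field, 'a::ab_group_add, 'z) vsp_scheme \<Rightarrow> nat \<Rightarrow> ('k, 'a) tens set" where
  "tpow A n = tens.span {pure A w | w. length w = n \<and> set w \<subseteq> carr A}"

definition tensor_algebra :: "('k::field, 'a::ab_group_add, 'z) vsp_scheme \<Rightarrow> ('k, 'a) tens set" where
  "tensor_algebra A = tens.span {pure A w | w. set w \<subseteq> carr A}"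

text \<open>The product of the tensor algebra; on pure tensors it is concatenation (\<open>tmul_pure\<close>).\<close>

definition tmul ::
  "('k::field, 'a::ab_group_add, 'z) vsp_scheme \<Rightarrow> ('k, 'a) tens \<Rightarrow> ('k, 'a) tens \<Rightarrow> ('k, 'a) tens"
  (infixl "\<otimes>\<index>" 70) where
  "tmul A x y = (\<lambda>\<phi>. if multilinear A \<phi> then x (\<lambda>u. y (\<lambda>v. \<phi> (u @ v))) else 0)"

definition tprod ::
  "('k::field, 'a::ab_group_add, 'z) vsp_scheme \<Rightarrow> ('k, 'a) tens set \<Rightarrow> ('k, 'a) tens set \<Rightarrow> ('k, 'a) tens set" where
  "tprod A X Y = tens.span {x \<otimes>\<^bsub>A\<^esub> y | x y. x \<in> X \<and> y \<in> Y}"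

text \<open>
  \<open>tmap A B X Y f g\<close> is the tensor product of maps \<open>f \<otimes> g : X \<otimes> Y \<rightarrow> T(B)\<close>, for linear maps \<open>f\<close>, \<open>g\<close>
  from subspaces \<open>X \<subseteq> A\<^sup>\<otimes>\<^sup>m\<close> and \<open>Y \<subseteq> A\<^sup>\<otimes>\<^sup>n\<close> to the tensor algebra of \<open>B\<close>. Such a map exists
  (\<open>tmap_tmul\<close>) and is unique on \<open>X \<otimes> Y\<close>; its values elsewhere are irrelevant.
\<close>

definition tmap ::
  "('k::field, 'a::ab_group_add, 'z) vsp_scheme \<Rightarrow> ('k, 'b::ab_group_add, 'y) vsp_scheme \<Rightarrow>
   ('k, 'a) tens set \<Rightarrow> ('k, 'a) tens set \<Rightarrow>
   (('k, 'a) tens \<Rightarrow> ('k, 'b) tens) \<Rightarrow> (('k, 'a) tens \<Rightarrow> ('k, 'b) tens) \<Rightarrow> ('k, 'a) tens \<Rightarrow> ('k, 'b) tens" where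
  "tmap A B X Y f g = (SOME h. linear_map (tprod A X Y) pscale UNIV pscale h \<and>
     (\<forall>x\<in>X. \<forall>y\<in>Y. h (x \<otimes>\<^bsub>A\<^esub> y) = f x \<otimes>\<^bsub>B\<^esub> g y))"

text \<open>The identification of \<open>A\<close> with \<open>A\<^sup>\<otimes>\<^sup>1\<close>, and its inverse.\<close>

definition incl :: "('k::field, 'a::ab_group_add, 'z) vsp_scheme \<Rightarrow> 'a \<Rightarrow> ('k, 'a) tens" where
  "incl A x = pure A [x]"

definition proj :: "('k::field, 'a::ab_group_add, 'z) vsp_scheme \<Rightarrow> ('k, 'a) tens \<Rightarrow> 'a" where
  "proj A = inv_into (carr A) (incl A)"

text \<open>Tensor products of two subspaces of \<open>A\<close>, and of linear maps defined on such subspaces.\<close>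

definition tprod2 ::
  "('k::field, 'a::ab_group_add, 'z) vsp_scheme \<Rightarrow> 'a set \<Rightarrow> 'a set \<Rightarrow> ('k, 'a) tens set" where
  "tprod2 A X Y = tprod A (incl A ` X) (incl A ` Y)"

definition tmap2 ::
  "('k::field, 'a::ab_group_add, 'z) vsp_scheme \<Rightarrow> ('k, 'b::ab_group_add, 'y) vsp_scheme \<Rightarrow>
   'a set \<Rightarrow> 'a set \<Rightarrow> ('a \<Rightarrow> 'b) \<Rightarrow> ('a \<Rightarrow> 'b) \<Rightarrow> ('k, 'a) tens \<Rightarrow> ('k, 'b) tens" where
  "tmap2 A B X Y f g = tmap A B (incl A ` X) (incl A ` Y)
     (\<lambda>t. incl B (f (proj A t))) (\<lambda>t. incl B (g (proj A t)))"


subsection \<open>Universal property\<close>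

lemma vs_field: "vector_space ((*) :: 'k::field \<Rightarrow> 'k \<Rightarrow> 'k)"
  by standard (auto simp: algebra_simps)

lemma multilinear_iff:
  assumes "vector_space (scl A)"
  shows "multilinear A \<phi> \<longleftrightarrow> (\<forall>us vs. (\<forall>x y. \<phi> (us @ (x + y) # vs) = \<phi> (us @ x # vs) + \<phi> (us @ y # vs)) \<and>
     (\<forall>a x. \<phi> (us @ scl A a x # vs) = a * \<phi> (us @ x # vs)))"
  unfolding multilinear_def using assms vs_field by (auto simp: Vector_Spaces.linear_iff)

lemma multilinear_append:
  assumes "multilinear A \<phi>" shows "multilinear A (\<lambda>v. \<phi> (u @ v))"
  unfolding multilinear_def
proof (intro allI)
  fix us vs
  show "Vector_Spaces.linear (scl A) (*) (\<lambda>x. \<phi> (u @ us @ x # vs))"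
    using assms[unfolded multilinear_def, rule_format, of "u @ us" vs] by simp
qed

lemma multilinear_append': "multilinear A \<phi> \<Longrightarrow> multilinear A (\<lambda>u. \<phi> (u @ v))"
  unfolding multilinear_def by simp

lemma tmul_pure: "pure A u \<otimes>\<^bsub>A\<^esub> pure A v = pure A (u @ v)"
  by (auto simp: tmul_def pure_def multilinear_append multilinear_append' fun_eq_iff)

lemma tensor_algebra_induct [consumes 1, case_names zero add pure]:
  assumes "t \<in> tensor_algebra A" "P 0" "\<And>x y. P x \<Longrightarrow> P y \<Longrightarrow> P (x + y)"
    "\<And>a w. P (pscale a (pure A w))"
  shows "P t"
  using assms(1) unfolding tensor_algebra_def
proof (induction rule: tens.span_induct_alt)
  case base then show ?case using assms(2) .
next
  case (step c x y) then show ?case using assms(3,4) by blast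
qed

lemma multilinear_add:
  assumes "vector_space (scl A)" "multilinear A \<phi>" "multilinear A \<psi>"
  shows "multilinear A (\<lambda>w. \<phi> w + \<psi> w)"
  using assms by (simp add: multilinear_iff algebra_simps)

lemma multilinear_scale:
  assumes "vector_space (scl A)" "multilinear A \<phi>"
  shows "multilinear A (\<lambda>w. a * \<phi> w)"
  using assms by (simp add: multilinear_iff algebra_simps)

lemma tens_nonlin:
  assumes "t \<in> tensor_algebra A" "\<not> multilinear A \<phi>" shows "t \<phi> = 0"
  using assms by (induction rule: tensor_algebra_induct) (auto simp: pscale_def pure_def)

lemma tens_add:
  assumes "t \<in> tensor_algebra A" "vector_space (scl A)" "multilinear A \<phi>" "multilinear A \<psi>"
  shows "t (\<lambda>w. \<phi> w + \<psi> w) = t \<phi> + t \<psi>"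
  using assms(1) by (induction rule: tensor_algebra_induct)
    (auto simp: pscale_def pure_def assms multilinear_add algebra_simps)

lemma tens_scale:
  assumes "t \<in> tensor_algebra A" "vector_space (scl A)" "multilinear A \<phi>"
  shows "t (\<lambda>w. a * \<phi> w) = a * t \<phi>"
  using assms(1) by (induction rule: tensor_algebra_induct)
    (auto simp: pscale_def pure_def assms multilinear_scale algebra_simps)

lemma multilinear_curry:
  assumes A: "vector_space (scl A)" and y: "y \<in> tensor_algebra A" and \<phi>: "multilinear A \<phi>"
  shows "multilinear A (\<lambda>u. y (\<lambda>v. \<phi> (u @ v)))"
proof -
  have *: "multilinear A (\<lambda>v. \<phi> (w @ v))" for w by (rule multilinear_append[OF \<phi>])
  have "\<phi> (us @ (x + z) # vs) = \<phi> (us @ x # vs) + \<phi> (us @ z # vs)"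
    "\<phi> (us @ scl A a x # vs) = a * \<phi> (us @ x # vs)" for us vs x z a
    using \<phi> by (auto simp: multilinear_iff[OF A])
  then show ?thesis
    unfolding multilinear_iff[OF A]
    using tens_add[OF y A *[of "us @ x # vs" for us x vs] *[of "us @ x # vs" for us x vs]]
      tens_scale[OF y A *[of "us @ x # vs" for us x vs]] by simp
qed

lemma tmul_add_left: "(x + x') \<otimes>\<^bsub>A\<^esub> y = x \<otimes>\<^bsub>A\<^esub> y + x' \<otimes>\<^bsub>A\<^esub> y"
  by (auto simp: tmul_def)

lemma tmul_scale_left: "pscale a x \<otimes>\<^bsub>A\<^esub> y = pscale a (x \<otimes>\<^bsub>A\<^esub> y)"
  by (auto simp: tmul_def pscale_def)

lemma tmul_add_right:
  assumes "vector_space (scl A)" "x \<in> tensor_algebra A" "y \<in> tensor_algebra A" "y' \<in> tensor_algebra A"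
  shows "x \<otimes>\<^bsub>A\<^esub> (y + y') = x \<otimes>\<^bsub>A\<^esub> y + x \<otimes>\<^bsub>A\<^esub> y'"
proof
  fix \<phi>
  show "(x \<otimes>\<^bsub>A\<^esub> (y + y')) \<phi> = (x \<otimes>\<^bsub>A\<^esub> y + x \<otimes>\<^bsub>A\<^esub> y') \<phi>"
    using tens_add[OF assms(2,1) multilinear_curry[OF assms(1,3)] multilinear_curry[OF assms(1,4)], of \<phi> \<phi>]
    by (simp add: tmul_def)
qed

lemma tmul_scale_right:
  assumes "vector_space (scl A)" "x \<in> tensor_algebra A" "y \<in> tensor_algebra A"
  shows "x \<otimes>\<^bsub>A\<^esub> pscale a y = pscale a (x \<otimes>\<^bsub>A\<^esub> y)"
proof
  fix \<phi>
  show "(x \<otimes>\<^bsub>A\<^esub> pscale a y) \<phi> = pscale a (x \<otimes>\<^bsub>A\<^esub> y) \<phi>"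
    using tens_scale[OF assms(2,1) multilinear_curry[OF assms(1,3)], of \<phi> a]
    by (simp add: tmul_def pscale_def)
qed

lemma tpow_subset: "tpow A n \<subseteq> tensor_algebra A"
  unfolding tpow_def tensor_algebra_def by (rule tens.span_mono) auto

lemma tpow_cong:
  assumes "t \<in> tpow A n" and A: "vector_space (scl A)" and \<phi>: "multilinear A \<phi>" and \<psi>: "multilinear A \<psi>"
    and eq: "\<And>w. length w = n \<Longrightarrow> \<phi> w = \<psi> w"
  shows "t \<phi> = t \<psi>"
  using assms(1) unfolding tpow_def
proof (induction rule: tens.span_induct_alt)
  case base then show ?case by simp
next
  case (step c x y) then show ?case using \<phi> \<psi> by (auto simp: pscale_def pure_def eq)
qed

lemma multilinear_product:
  assumes A: "vector_space (scl A)" and \<alpha>: "multilinear A \<alpha>" and \<beta>: "multilinear A \<beta>"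
  shows "multilinear A (\<lambda>w. if length w = m + n then \<alpha> (take m w) * \<beta> (drop m w) else 0)"
proof -
  note \<alpha>' = \<alpha>[unfolded multilinear_iff[OF A], rule_format] and \<beta>' = \<beta>[unfolded multilinear_iff[OF A], rule_format]
  have 1: "\<alpha> (take m (us @ z # vs)) * \<beta> (drop m (us @ z # vs)) =
      \<alpha> (us @ z # take (m - Suc (length us)) vs) * \<beta> (drop (m - Suc (length us)) vs)"
    if "length us < m" for us z vs using that by (auto simp: take_Cons' drop_Cons')
  have 2: "\<alpha> (take m (us @ z # vs)) * \<beta> (drop m (us @ z # vs)) = \<alpha> (take m us) * \<beta> (drop m us @ z # vs)"
    if "\<not> length us < m" for us z vs using that by auto
  show ?thesis unfolding multilinear_iff[OF A]
  proof (intro allI)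
    fix us vs
    show "(\<forall>x y. (if length (us @ (x + y) # vs) = m + n
                 then \<alpha> (take m (us @ (x + y) # vs)) * \<beta> (drop m (us @ (x + y) # vs)) else 0) =
                (if length (us @ x # vs) = m + n then \<alpha> (take m (us @ x # vs)) * \<beta> (drop m (us @ x # vs)) else 0) +
                (if length (us @ y # vs) = m + n then \<alpha> (take m (us @ y # vs)) * \<beta> (drop m (us @ y # vs)) else 0)) \<and>
         (\<forall>a x. (if length (us @ scl A a x # vs) = m + n
                 then \<alpha> (take m (us @ scl A a x # vs)) * \<beta> (drop m (us @ scl A a x # vs)) else 0) =
                a * (if length (us @ x # vs) = m + n then \<alpha> (take m (us @ x # vs)) * \<beta> (drop m (us @ x # vs)) else 0))"
    proof (cases "length us < m")
      case True
      show ?thesis unfolding 1[OF True] using \<alpha>' by (simp add: algebra_simps)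
    next
      case False
      show ?thesis unfolding 2[OF False] using \<beta>' by (simp add: algebra_simps)
    qed
  qed
qed

lemma tmul_eval:
  assumes A: "vector_space (scl A)" and \<alpha>: "multilinear A \<alpha>" and \<beta>: "multilinear A \<beta>"
    and x: "x \<in> tpow A m" and y: "y \<in> tpow A n"
  shows "(x \<otimes>\<^bsub>A\<^esub> y) (\<lambda>w. if length w = m + n then \<alpha> (take m w) * \<beta> (drop m w) else 0) = x \<alpha> * y \<beta>"
proof -
  let ?F = "\<lambda>w. if length w = m + n then \<alpha> (take m w) * \<beta> (drop m w) else 0"
  have F: "multilinear A ?F" by (rule multilinear_product[OF A \<alpha> \<beta>])
  have yT: "y \<in> tensor_algebra A" and xT: "x \<in> tensor_algebra A" using x y tpow_subset by auto
  have inner: "y (\<lambda>v. ?F (u @ v)) = y \<beta> * \<alpha> u" if "length u = m" for u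
  proof -
    have "y (\<lambda>v. ?F (u @ v)) = y (\<lambda>v. \<alpha> u * \<beta> v)"
      by (rule tpow_cong[OF y A multilinear_append[OF F] multilinear_scale[OF A \<beta>]]) (use that in auto)
    then show ?thesis using tens_scale[OF yT A \<beta>] by simp
  qed
  have "(x \<otimes>\<^bsub>A\<^esub> y) ?F = x (\<lambda>u. y (\<lambda>v. ?F (u @ v)))" using F by (simp add: tmul_def)
  also have "\<dots> = x (\<lambda>u. y \<beta> * \<alpha> u)"
    by (rule tpow_cong[OF x A multilinear_curry[OF A yT F] multilinear_scale[OF A \<alpha>]]) (rule inner)
  finally show ?thesis using tens_scale[OF xT A \<alpha>] by simp
qed

lemma tmul_independent_sum:
  assumes A: "vector_space (scl A)" and BX: "BX \<subseteq> tpow A m" and BY: "BY \<subseteq> tpow A n"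
    and iX: "tens.independent BX" and iY: "tens.independent BY" and fin: "finite BX" "finite BY"
    and 0: "(\<Sum>x\<in>BX. \<Sum>y\<in>BY. pscale (a x y) (x \<otimes>\<^bsub>A\<^esub> y)) = 0" and xy: "x \<in> BX" "y \<in> BY"
  shows "a x y = 0"
proof -
  have sum_app: "(sum f S) \<phi> = (\<Sum>s\<in>S. f s \<phi>)" for f :: "'z \<Rightarrow> ('i \<Rightarrow> 'j::ab_group_add)" and S \<phi>
    by (induction S rule: infinite_finite_induct) auto
  have nl: "t \<phi> = 0" if "t \<in> tpow A k" "\<not> multilinear A \<phi>" for t k \<phi>
    using tens_nonlin that tpow_subset by blast
  have *: "(\<Sum>x\<in>BX. \<Sum>y\<in>BY. a x y * (x \<alpha> * y \<beta>)) = 0" for \<alpha> \<beta>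
  proof (cases "multilinear A \<alpha> \<and> multilinear A \<beta>")
    case True
    let ?F = "\<lambda>w. if length w = m + n then \<alpha> (take m w) * \<beta> (drop m w) else 0"
    have "(\<Sum>x\<in>BX. \<Sum>y\<in>BY. a x y * (x \<alpha> * y \<beta>)) = (\<Sum>x\<in>BX. \<Sum>y\<in>BY. pscale (a x y) (x \<otimes>\<^bsub>A\<^esub> y)) ?F"
      unfolding sum_app pscale_def
      using True BX BY by (intro sum.cong refl) (subst tmul_eval[OF A], auto)
    then show ?thesis using 0 by simp
  next
    case False
    then show ?thesis using nl BX BY by (intro sum.neutral ballI) (metis mult_zero_left mult_zero_right subsetD)
  qed
  have "(\<Sum>y\<in>BY. a x y * y \<beta>) = 0" for \<beta>
  proof -
    have "(\<Sum>x\<in>BX. pscale (\<Sum>y\<in>BY. a x y * y \<beta>) x) = 0"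
    proof
      fix \<alpha>
      show "(\<Sum>x\<in>BX. pscale (\<Sum>y\<in>BY. a x y * y \<beta>) x) \<alpha> = 0 \<alpha>"
        using *[of \<alpha> \<beta>] by (simp add: sum_app pscale_def sum_distrib_right sum_distrib_left algebra_simps)
    qed
    then show ?thesis
      using tens.independentD[OF iX fin(1) order_refl, of "\<lambda>x. \<Sum>y\<in>BY. a x y * y \<beta>"] xy by blast
  qed
  then have "(\<Sum>y\<in>BY. pscale (a x y) y) = 0"
    by (intro ext) (simp add: sum_app pscale_def)
  then show ?thesis
    using tens.independentD[OF iY fin(2) order_refl, of "a x"] xy by blast
qed


lemma tens_independentI:
  "(\<And>S u v. S \<subseteq> B \<Longrightarrow> finite S \<Longrightarrow> (\<Sum>v\<in>S. pscale (u v) v) = 0 \<Longrightarrow> v \<in> S \<Longrightarrow> u v = 0) \<Longrightarrow>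
    tens.independent (B :: ('k::field, 'a) tens set)"
  using tens.independent_explicit_module[of B] by blast

lemma tmul_independent:
  fixes A :: "('k::field, 'a::ab_group_add, 'z) vsp_scheme"
  assumes A: "vector_space (scl A)" and BX: "BX \<subseteq> tpow A m" and BY: "BY \<subseteq> tpow A n"
    and iX: "tens.independent BX" and iY: "tens.independent BY"
  defines "\<tau> \<equiv> \<lambda>(x, y). x \<otimes>\<^bsub>A\<^esub> y"
  shows "inj_on \<tau> (BX \<times> BY)" and "tens.independent (\<tau> ` (BX \<times> BY))"
proof -
  have key: "u = (\<lambda>_. 0)" if "finite F" "F \<subseteq> BX \<times> BY" "(\<Sum>z\<in>F. pscale (u z) (\<tau> z)) = 0" "\<And>z. z \<notin> F \<Longrightarrow> u z = 0"
    for F u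
  proof
    fix z
    let ?FX = "fst ` F" and ?FY = "snd ` F"
    have F: "F \<subseteq> ?FX \<times> ?FY" by (rule subset_fst_snd)
    have fin: "finite (?FX \<times> ?FY)" using that(1) by blast
    have "(\<Sum>z\<in>?FX \<times> ?FY. pscale (u z) (\<tau> z)) = (\<Sum>z\<in>F. pscale (u z) (\<tau> z))"
    proof (rule sum.mono_neutral_right[OF fin F], rule ballI)
      fix z assume "z \<in> ?FX \<times> ?FY - F"
      then have "u z = 0" using that(4) by blast
      then show "pscale (u z) (\<tau> z) = 0" using tens.scale_zero_left by metis
    qed
    then have 0: "(\<Sum>x\<in>?FX. \<Sum>y\<in>?FY. pscale (u (x, y)) (x \<otimes>\<^bsub>A\<^esub> y)) = 0"
      using that(3) unfolding sum.cartesian_product \<tau>_def by (simp only: case_prod_unfold prod.collapse)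
    have sub: "?FX \<subseteq> BX" "?FY \<subseteq> BY" using that(2) by auto
    have "u z = 0" if "z \<in> F"
      using tmul_independent_sum[OF A subset_trans[OF sub(1) BX] subset_trans[OF sub(2) BY]
          tens.independent_mono[OF iX sub(1)] tens.independent_mono[OF iY sub(2)] _ _ 0, of "fst z" "snd z"]
        that \<open>finite F\<close> by simp
    then show "u z = 0" using that(4) by blast
  qed
  show inj: "inj_on \<tau> (BX \<times> BY)"
  proof (rule inj_onI, rule ccontr)
    fix z z' assume z: "z \<in> BX \<times> BY" "z' \<in> BX \<times> BY" "\<tau> z = \<tau> z'" "z \<noteq> z'"
    let ?u = "\<lambda>s. if s = z then 1 else if s = z' then -1 else 0 :: 'k"
    have "(\<Sum>s\<in>{z, z'}. pscale (?u s) (\<tau> s)) = pscale 1 (\<tau> z) + pscale (- 1) (\<tau> z')"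
      using z(4) by (subst sum.insert) auto
    also have "\<dots> = 0" unfolding z(3) tens.scale_minus_left by (rule right_minus)
    finally have s0: "(\<Sum>s\<in>{z, z'}. pscale (?u s) (\<tau> s)) = 0" .
    have "?u = (\<lambda>_. 0)" by (rule key[OF _ _ s0]) (use z(1,2) in simp_all)
    from fun_cong[OF this, of z] show False by simp
  qed
  have ind: "u v = 0"
    if S: "S \<subseteq> \<tau> ` (BX \<times> BY)" "finite S" "(\<Sum>v\<in>S. pscale (u v) v) = 0" "v \<in> S" for S u v
  proof -
    obtain F where F: "F \<subseteq> BX \<times> BY" "S = \<tau> ` F" using S(1) by (auto simp: subset_image_iff)
    have injF: "inj_on \<tau> F" using inj F(1) by (rule inj_on_subset)
    have finF: "finite F" using S(2) F(2) injF finite_imageD by blast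
    let ?u = "\<lambda>z. if z \<in> F then u (\<tau> z) else 0"
    have "(\<Sum>z\<in>F. pscale (?u z) (\<tau> z)) = (\<Sum>z\<in>F. pscale (u (\<tau> z)) (\<tau> z))"
      by (rule sum.cong) simp_all
    also have "\<dots> = 0" using S(3) unfolding F(2) sum.reindex[OF injF] comp_def .
    finally have s0: "(\<Sum>z\<in>F. pscale (?u z) (\<tau> z)) = 0" .
    have u: "?u = (\<lambda>_. 0)" by (rule key[OF finF F(1) s0]) simp
    obtain z where "z \<in> F" "v = \<tau> z" using S(4) F(2) by auto
    then show "u v = 0" using fun_cong[OF u, of z] by simp
  qed
  show "tens.independent (\<tau> ` (BX \<times> BY))"
    using ind tens_independentI[of "\<tau> ` (BX \<times> BY)"] by presburger
qed

lemma tmap_exists: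
  fixes A :: "('k::field, 'a::ab_group_add, 'z) vsp_scheme" and B :: "('k, 'b::ab_group_add, 'y) vsp_scheme"
  assumes A: "vector_space (scl A)" and B: "vector_space (scl B)"
    and X: "tens.subspace X" "X \<subseteq> tpow A m" and Y: "tens.subspace Y" "Y \<subseteq> tpow A n"
    and f: "linear_map X pscale (tensor_algebra B) pscale f"
    and g: "linear_map Y pscale (tensor_algebra B) pscale g"
  shows "\<exists>h. linear_map (tprod A X Y) pscale UNIV pscale h \<and>
     (\<forall>x\<in>X. \<forall>y\<in>Y. h (x \<otimes>\<^bsub>A\<^esub> y) = f x \<otimes>\<^bsub>B\<^esub> g y)"
proof -
  obtain BX where BX: "BX \<subseteq> X" "tens.independent BX" "X \<subseteq> tens.span BX"
    using tens.maximal_independent_subset by blast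
  obtain BY where BY: "BY \<subseteq> Y" "tens.independent BY" "Y \<subseteq> tens.span BY"
    using tens.maximal_independent_subset by blast
  let ?\<tau> = "\<lambda>(x, y). x \<otimes>\<^bsub>A\<^esub> y"
  have inj: "inj_on ?\<tau> (BX \<times> BY)" and ind: "tens.independent (?\<tau> ` (BX \<times> BY))"
    using tmul_independent[OF A _ _ BX(2) BY(2), of m n] X Y BX(1) BY(1) by auto
  interpret pr: vector_space_pair "pscale :: 'k \<Rightarrow> ('k, 'a) tens \<Rightarrow> ('k, 'a) tens"
    "pscale :: 'k \<Rightarrow> ('k, 'b) tens \<Rightarrow> ('k, 'b) tens"
    by unfold_locales
  obtain h where h: "Vector_Spaces.linear pscale pscale h"
    and hB: "\<forall>z\<in>?\<tau> ` (BX \<times> BY). h z = (case inv_into (BX \<times> BY) ?\<tau> z of (x, y) \<Rightarrow> f x \<otimes>\<^bsub>B\<^esub> g y)"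
    using pr.linear_independent_extend[OF ind,
        of "\<lambda>z. case inv_into (BX \<times> BY) ?\<tau> z of (x, y) \<Rightarrow> f x \<otimes>\<^bsub>B\<^esub> g y"] by blast
  note hl = h[unfolded Vector_Spaces.linear_iff]
  have 0: "h (x \<otimes>\<^bsub>A\<^esub> y) = f x \<otimes>\<^bsub>B\<^esub> g y" if "x \<in> BX" "y \<in> BY" for x y
  proof -
    have "inv_into (BX \<times> BY) ?\<tau> (x \<otimes>\<^bsub>A\<^esub> y) = (x, y)"
      using inv_into_f_f[OF inj, of "(x, y)"] that by simp
    then show ?thesis using hB that by (metis (no_types, lifting) SigmaI case_prod_conv image_eqI)
  qed
  note f' = f[unfolded linear_map_def] and g' = g[unfolded linear_map_def]
  have TX: "x \<in> tensor_algebra A" if "x \<in> X" for x using that X tpow_subset by blast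
  have TY: "x \<in> tensor_algebra A" if "x \<in> Y" for x using that Y tpow_subset by blast
  have f0: "f 0 = 0" using f' tens.subspace_0[OF X(1)] by (metis tens.scale_zero_left)
  have g0: "g 0 = 0" using g' tens.subspace_0[OF Y(1)] by (metis tens.scale_zero_left)
  have h0: "h 0 = 0" using hl by (metis tens.scale_zero_left)
  have l0: "0 \<otimes>\<^bsub>C\<^esub> y = 0" for C :: "('x::field, 'w::ab_group_add, 'zz) vsp_scheme" and y
    by (auto simp: tmul_def)
  have r0: "x \<otimes>\<^bsub>C\<^esub> 0 = 0" if "vector_space (scl C)" "x \<in> tensor_algebra C"
    for C :: "('x::field, 'w::ab_group_add, 'zz) vsp_scheme" and x
  proof -
    have "0 \<in> tensor_algebra C" unfolding tensor_algebra_def by (rule tens.span_zero)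
    from tmul_scale_right[OF that this, of 0] show ?thesis by (simp add: tens.scale_zero_left)
  qed
  have 1: "y \<in> Y \<and> h (x \<otimes>\<^bsub>A\<^esub> y) = f x \<otimes>\<^bsub>B\<^esub> g y" if x: "x \<in> BX" and y: "y \<in> tens.span BY" for x y
    using y
  proof (induction rule: tens.span_induct_alt)
    case base
    have xX: "x \<in> X" using x BX(1) by blast
    then have "f x \<in> tensor_algebra B" using f' by blast
    then show ?case
      unfolding g0 r0[OF A TX[OF xX]] r0[OF B \<open>f x \<in> tensor_algebra B\<close>] using h0 tens.subspace_0[OF Y(1)] by blast
  next
    case (step a y z)
    have xX: "x \<in> X" and yY: "y \<in> Y" using x BX(1) step(1) BY(1) by auto
    have ay: "pscale a y \<in> Y" using yY Y(1) tens.subspace_scale by blast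
    have z: "z \<in> Y" "h (x \<otimes>\<^bsub>A\<^esub> z) = f x \<otimes>\<^bsub>B\<^esub> g z" using step(2) by auto
    have TB: "f x \<in> tensor_algebra B" "g y \<in> tensor_algebra B" "g (pscale a y) \<in> tensor_algebra B" "g z \<in> tensor_algebra B"
      using f' g' xX yY ay z(1) by auto
    have "h (x \<otimes>\<^bsub>A\<^esub> (pscale a y + z)) = h (pscale a (x \<otimes>\<^bsub>A\<^esub> y) + x \<otimes>\<^bsub>A\<^esub> z)"
      using tmul_add_right[OF A TX[OF xX] TY[OF ay] TY[OF z(1)]] tmul_scale_right[OF A TX[OF xX] TY[OF yY]] by simp
    also have "\<dots> = pscale a (f x \<otimes>\<^bsub>B\<^esub> g y) + f x \<otimes>\<^bsub>B\<^esub> g z"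
      using hl 0[OF x step(1)] z(2) by simp
    also have "\<dots> = f x \<otimes>\<^bsub>B\<^esub> (g (pscale a y) + g z)"
      using tmul_add_right[OF B TB(1,3,4)] tmul_scale_right[OF B TB(1,2)] g' yY by simp
    also have "\<dots> = f x \<otimes>\<^bsub>B\<^esub> g (pscale a y + z)" using g' ay z(1) by simp
    finally show ?case using step(2) ay tens.subspace_add[OF Y(1)] by blast
  qed
  have 2: "x \<in> X \<and> h (x \<otimes>\<^bsub>A\<^esub> y) = f x \<otimes>\<^bsub>B\<^esub> g y" if y: "y \<in> Y" and x: "x \<in> tens.span BX" for x y
    using x
  proof (induction rule: tens.span_induct_alt)
    case base
    then show ?case unfolding f0 l0 using h0 tens.subspace_0[OF X(1)] by blast
  next
    case (step a x z)
    have xX: "x \<in> X" using BX(1) step(1) by auto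
    have ax: "pscale a x \<in> X" using xX X(1) tens.subspace_scale by blast
    have e: "h (x \<otimes>\<^bsub>A\<^esub> y) = f x \<otimes>\<^bsub>B\<^esub> g y" using 1[OF step(1)] y BY(3) by blast
    have "h ((pscale a x + z) \<otimes>\<^bsub>A\<^esub> y) = pscale a (h (x \<otimes>\<^bsub>A\<^esub> y)) + h (z \<otimes>\<^bsub>A\<^esub> y)"
      using hl by (simp add: tmul_add_left tmul_scale_left)
    also have "\<dots> = f (pscale a x + z) \<otimes>\<^bsub>B\<^esub> g y"
      using step(2) e xX ax f' by (simp add: tmul_add_left tmul_scale_left)
    finally show ?case using step(2) ax tens.subspace_add[OF X(1)] by blast
  qed
  have "linear_map (tprod A X Y) pscale UNIV pscale h" using hl by (simp add: linear_map_def)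
  then show ?thesis using 2 BX(3) by blast
qed

lemma
  assumes "vector_space (scl A)" "vector_space (scl B)"
    "tens.subspace X" "X \<subseteq> tpow A m" "tens.subspace Y" "Y \<subseteq> tpow A n"
    "linear_map X pscale (tensor_algebra B) pscale f" "linear_map Y pscale (tensor_algebra B) pscale g"
  shows linear_map_tmap: "linear_map (tprod A X Y) pscale UNIV pscale (tmap A B X Y f g)"
    and tmap_tmul: "x \<in> X \<Longrightarrow> y \<in> Y \<Longrightarrow> tmap A B X Y f g (x \<otimes>\<^bsub>A\<^esub> y) = f x \<otimes>\<^bsub>B\<^esub> g y"
  using someI_ex[OF tmap_exists[OF assms]] unfolding tmap_def by blast+

lemma
  fixes A :: "('k::field, 'a::ab_group_add, 'z) vsp_scheme"
  assumes A: "vspace A"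
  shows linear_map_incl: "linear_map (carr A) (scl A) (tpow A 1) pscale (incl A)"
    and bij_betw_incl: "bij_betw (incl A) (carr A) (tpow A 1)"
proof -
  have vs: "vector_space (scl A)" and sub: "module.subspace (scl A) (carr A)"
    using A by (auto simp: vspace_def)
  interpret V: vector_space "scl A" by (rule vs)
  have add: "incl A (x + y) = incl A x + incl A y" for x y
    using multilinear_iff[OF vs] by (auto simp: incl_def pure_def fun_eq_iff) (metis append_Nil)
  have scale: "incl A (scl A a x) = pscale a (incl A x)" for a x
    using multilinear_iff[OF vs] by (auto simp: incl_def pure_def pscale_def fun_eq_iff) (metis append_Nil)
  show lin: "linear_map (carr A) (scl A) (tpow A 1) pscale (incl A)"
    unfolding linear_map_def using add scale by (auto simp: tpow_def incl_def intro!: tens.span_base)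
  have eq: "{pure A w | w. length w = 1 \<and> set w \<subseteq> carr A} = incl A ` carr A"
    by (fastforce simp: incl_def length_Suc_conv)
  have "tens.subspace (incl A ` carr A)"
  proof (rule tens.subspaceI)
    have "incl A 0 = 0" using scale[of 0 0] by simp
    then show "0 \<in> incl A ` carr A" using V.subspace_0[OF sub] by force
    show "x + y \<in> incl A ` carr A" if "x \<in> incl A ` carr A" "y \<in> incl A ` carr A" for x y
      using that V.subspace_add[OF sub] by (auto simp: add[symmetric])
    show "pscale a x \<in> incl A ` carr A" if "x \<in> incl A ` carr A" for a x
      using that V.subspace_scale[OF sub] by (auto simp: scale[symmetric])
  qed
  then have "incl A ` carr A = tpow A 1" unfolding tpow_def eq by (metis tens.span_eq_iff)
  moreover have "inj (incl A)"
  proof (rule injI, rule ccontr)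
    fix x y assume "incl A x = incl A y" "x \<noteq> y"
    interpret pr: vector_space_pair "scl A" "(*) :: 'k \<Rightarrow> 'k \<Rightarrow> 'k"
      using vs vs_field by (simp add: vector_space_pair_def)
    have "V.independent {x - y}" using \<open>x \<noteq> y\<close> by simp
    from pr.linear_independent_extend[OF this, of "\<lambda>_. 1"]
    obtain l where l: "Vector_Spaces.linear (scl A) (*) l" "l (x - y) = 1" by auto
    let ?F = "\<lambda>w. if length w = 1 then l (hd w) else 0"
    have F: "multilinear A ?F"
      using l(1) by (auto simp: multilinear_iff[OF vs] Vector_Spaces.linear_iff)
    have "l x = l y" using fun_cong[OF \<open>incl A x = incl A y\<close>, of ?F] F by (simp add: incl_def pure_def)
    moreover have "l (x - y) = l x - l y" using pr.linear_diff[OF l(1)] .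
    ultimately show False using l(2) by simp
  qed
  ultimately show "bij_betw (incl A) (carr A) (tpow A 1)" by (auto simp: bij_betw_def inj_on_def inj_def)
qed

lemma tpow_add:
  assumes "vector_space (scl A)"
  shows "tprod A (tpow A m) (tpow A n) = tpow A (m + n)"
proof
  have 1: "x \<otimes>\<^bsub>A\<^esub> y \<in> tpow A (m + n)" if x: "x \<in> tpow A m" and y: "y \<in> tpow A n" for x y
  proof -
    have sub: "tens.subspace (tpow A (m + n))" by (simp add: tpow_def)
    have pure: "pure A u \<otimes>\<^bsub>A\<^esub> pure A v \<in> tpow A (m + n)"
      if "length u = m" "set u \<subseteq> carr A" "length v = n" "set v \<subseteq> carr A" for u v
      unfolding tmul_pure tpow_def using that by (intro tens.span_base) force
    have zero: "x \<otimes>\<^bsub>A\<^esub> 0 = 0" if "x \<in> tensor_algebra A" for x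
      using tmul_scale_right[OF assms that, of 0 0] by (simp add: tensor_algebra_def tens.span_zero)
    have *: "y \<in> tpow A n \<and> pure A u \<otimes>\<^bsub>A\<^esub> y \<in> tpow A (m + n)" if u: "length u = m" "set u \<subseteq> carr A" for u
      using y[unfolded tpow_def]
    proof (induction rule: tens.span_induct_alt)
      case base
      have "pure A u \<in> tensor_algebra A" using u by (auto simp: tensor_algebra_def intro: tens.span_base)
      then show ?case
        unfolding zero[OF \<open>pure A u \<in> tensor_algebra A\<close>] tpow_def by (intro conjI tens.span_zero)
    next
      case (step a y z)
      have uT: "pure A u \<in> tensor_algebra A" using u by (auto simp: tensor_algebra_def intro: tens.span_base)
      have y: "y \<in> tpow A n" using step(1) by (auto simp: tpow_def intro: tens.span_base)
      then have ay: "pscale a y \<in> tpow A n" by (simp add: tpow_def tens.span_scale)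
      have T: "y \<in> tensor_algebra A" "pscale a y \<in> tensor_algebra A" "z \<in> tensor_algebra A"
        using y ay step(2) tpow_subset by auto
      have "pure A u \<otimes>\<^bsub>A\<^esub> (pscale a y + z) = pscale a (pure A u \<otimes>\<^bsub>A\<^esub> y) + pure A u \<otimes>\<^bsub>A\<^esub> z"
        using tmul_add_right[OF assms uT T(2,3)] tmul_scale_right[OF assms uT T(1)] by simp
      moreover have "pure A u \<otimes>\<^bsub>A\<^esub> y \<in> tpow A (m + n)" using pure[OF u] step(1) by auto
      moreover have "pscale a y + z \<in> tpow A n" using ay step(2) by (simp add: tpow_def tens.span_add)
      ultimately show ?case
        by (metis step(2) tens.subspace_add[OF sub] tens.subspace_scale[OF sub])
    qed
    show ?thesis using x[unfolded tpow_def]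
    proof (induction rule: tens.span_induct_alt)
      case base
      have "0 \<otimes>\<^bsub>A\<^esub> y = 0" using tmul_scale_left[of A 0 0 y] by (simp only: tens.scale_zero_left)
      then show ?case using tens.subspace_0[OF sub] by metis
    next
      case (step a x z)
      then obtain u where "x = pure A u" "length u = m" "set u \<subseteq> carr A" by blast
      then have "x \<otimes>\<^bsub>A\<^esub> y \<in> tpow A (m + n)" using * by blast
      then show ?case
        unfolding tmul_add_left tmul_scale_left using step(2) sub
        by (intro tens.subspace_add tens.subspace_scale)
    qed
  qed
  show "tprod A (tpow A m) (tpow A n) \<subseteq> tpow A (m + n)"
    unfolding tprod_def
  proof (rule tens.span_minimal)
    show "{x \<otimes>\<^bsub>A\<^esub> y | x y. x \<in> tpow A m \<and> y \<in> tpow A n} \<subseteq> tpow A (m + n)" using 1 by blast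
    show "tens.subspace (tpow A (m + n))" unfolding tpow_def by (rule tens.subspace_span)
  qed
  have "pure A w \<in> tprod A (tpow A m) (tpow A n)" if "length w = m + n" "set w \<subseteq> carr A" for w
  proof -
    have "pure A (take m w) \<in> tpow A m" "pure A (drop m w) \<in> tpow A n"
      unfolding tpow_def using that set_take_subset[of m w] set_drop_subset[of m w]
      by (intro tens.span_base; force)+
    then have "pure A (take m w) \<otimes>\<^bsub>A\<^esub> pure A (drop m w) \<in> tprod A (tpow A m) (tpow A n)"
      unfolding tprod_def by (intro tens.span_base) blast
    then show ?thesis by (simp add: tmul_pure)
  qed
  then show "tpow A (m + n) \<subseteq> tprod A (tpow A m) (tpow A n)"
    unfolding tpow_def[of A "m + n"] by (intro tens.span_minimal) (auto simp: tprod_def)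
qed


section \<open>Braided structures\<close>

text \<open>\<open>f \<otimes> Id\<close> and \<open>Id \<otimes> f\<close> on \<open>A\<^sup>\<otimes>\<^sup>m \<otimes> A\<^sup>\<otimes>\<^sup>n\<close>.\<close>

definition on_left ::
  "('k::field, 'a::ab_group_add, 'z) vsp_scheme \<Rightarrow> nat \<Rightarrow> nat \<Rightarrow>
   (('k, 'a) tens \<Rightarrow> ('k, 'a) tens) \<Rightarrow> ('k, 'a) tens \<Rightarrow> ('k, 'a) tens" where
  "on_left A m n f = tmap A A (tpow A m) (tpow A n) f id"

definition on_right ::
  "('k::field, 'a::ab_group_add, 'z) vsp_scheme \<Rightarrow> nat \<Rightarrow> nat \<Rightarrow>
   (('k, 'a) tens \<Rightarrow> ('k, 'a) tens) \<Rightarrow> ('k, 'a) tens \<Rightarrow> ('k, 'a) tens" where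
  "on_right A m n f = tmap A A (tpow A m) (tpow A n) id f"

definition braided_space ::
  "('k::field, 'a::ab_group_add, 'z) vsp_scheme \<Rightarrow> (('k, 'a) tens \<Rightarrow> ('k, 'a) tens) \<Rightarrow> bool" where
  "braided_space A c \<longleftrightarrow> vspace A \<and> linear_map (tpow A 2) pscale (tpow A 2) pscale c \<and>
    (\<forall>z\<in>tpow A 3. on_left A 2 1 c (on_right A 1 2 c (on_left A 2 1 c z)) =
                  on_right A 1 2 c (on_left A 2 1 c (on_right A 1 2 c z)))"

definition braided_hom ::
  "('k::field, 'a::ab_group_add, 'z) vsp_scheme \<Rightarrow> (('k, 'a) tens \<Rightarrow> ('k, 'a) tens) \<Rightarrow>
   ('k, 'b::ab_group_add, 'y) vsp_scheme \<Rightarrow> (('k, 'b) tens \<Rightarrow> ('k, 'b) tens) \<Rightarrow> ('a \<Rightarrow> 'b) \<Rightarrow> bool" where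
  "braided_hom A c B d f \<longleftrightarrow> linear_map (carr A) (scl A) (carr B) (scl B) f \<and>
    (\<forall>z\<in>tpow A 2. d (tmap2 A B (carr A) (carr A) f f z) = tmap2 A B (carr A) (carr A) f f (c z))"

record ('k, 'a) alg = "('k, 'a) vsp" +
  mul :: "('k, 'a) tens \<Rightarrow> 'a"
  un :: 'a

record ('k, 'a) bialg = "('k, 'a) alg" +
  comul :: "'a \<Rightarrow> ('k, 'a) tens"
  counit :: "'a \<Rightarrow> 'k"
  brd :: "('k, 'a) tens \<Rightarrow> ('k, 'a) tens"

definition mult :: "('k::field, 'a::ab_group_add, 'z) alg_scheme \<Rightarrow> 'a \<Rightarrow> 'a \<Rightarrow> 'a"
  (infixl "\<cdot>\<index>" 70) where
  "mult A x y = mul A (pure A [x, y])"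

text \<open>
  The structure maps as maps between the tensor powers \<open>A\<^sup>\<otimes>\<^sup>2 \<rightarrow> A\<^sup>\<otimes>\<^sup>1\<close>, \<open>A\<^sup>\<otimes>\<^sup>1 \<rightarrow> A\<^sup>\<otimes>\<^sup>2\<close> and
  \<open>A\<^sup>\<otimes>\<^sup>1 \<rightarrow> A\<^sup>\<otimes>\<^sup>0 = K\<close>.
\<close>

definition mulT :: "('k::field, 'a::ab_group_add, 'z) alg_scheme \<Rightarrow> ('k, 'a) tens \<Rightarrow> ('k, 'a) tens" where
  "mulT A z = incl A (mul A z)"

definition comulT :: "('k::field, 'a::ab_group_add, 'z) bialg_scheme \<Rightarrow> ('k, 'a) tens \<Rightarrow> ('k, 'a) tens" where
  "comulT A t = comul A (proj A t)"

definition counitT :: "('k::field, 'a::ab_group_add, 'z) bialg_scheme \<Rightarrow> ('k, 'a) tens \<Rightarrow> ('k, 'a) tens" where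
  "counitT A t = pscale (counit A (proj A t)) (pure A [])"

definition algebra :: "('k::field, 'a::ab_group_add, 'z) alg_scheme \<Rightarrow> bool" where
  "algebra A \<longleftrightarrow> vspace A \<and> linear_map (tpow A 2) pscale (carr A) (scl A) (mul A) \<and> un A \<in> carr A \<and>
    (\<forall>x\<in>carr A. \<forall>y\<in>carr A. \<forall>z\<in>carr A. (x \<cdot>\<^bsub>A\<^esub> y) \<cdot>\<^bsub>A\<^esub> z = x \<cdot>\<^bsub>A\<^esub> (y \<cdot>\<^bsub>A\<^esub> z)) \<and>
    (\<forall>x\<in>carr A. un A \<cdot>\<^bsub>A\<^esub> x = x \<and> x \<cdot>\<^bsub>A\<^esub> un A = x)"

definition algebra_hom ::
  "('k::field, 'a::ab_group_add, 'z) alg_scheme \<Rightarrow> ('k, 'b::ab_group_add, 'y) alg_scheme \<Rightarrow> ('a \<Rightarrow> 'b) \<Rightarrow> bool" where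
  "algebra_hom A B f \<longleftrightarrow> linear_map (carr A) (scl A) (carr B) (scl B) f \<and> f (un A) = un B \<and>
    (\<forall>x\<in>carr A. \<forall>y\<in>carr A. f (x \<cdot>\<^bsub>A\<^esub> y) = f x \<cdot>\<^bsub>B\<^esub> f y)"

definition braided_algebra :: "('k::field, 'a::ab_group_add, 'z) bialg_scheme \<Rightarrow> bool" where
  "braided_algebra A \<longleftrightarrow> algebra A \<and> braided_space A (brd A) \<and>
    (\<forall>z\<in>tpow A 3. brd A (on_left A 2 1 (mulT A) z) =
        on_right A 1 2 (mulT A) (on_left A 2 1 (brd A) (on_right A 1 2 (brd A) z))) \<and>
    (\<forall>z\<in>tpow A 3. brd A (on_right A 1 2 (mulT A) z) =
        on_left A 2 1 (mulT A) (on_right A 1 2 (brd A) (on_left A 2 1 (brd A) z))) \<and>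
    (\<forall>x\<in>carr A. brd A (pure A [un A, x]) = pure A [x, un A] \<and>
                brd A (pure A [x, un A]) = pure A [un A, x])"

definition coalgebra :: "('k::field, 'a::ab_group_add, 'z) bialg_scheme \<Rightarrow> bool" where
  "coalgebra C \<longleftrightarrow> vspace C \<and> linear_map (carr C) (scl C) (tpow C 2) pscale (comul C) \<and>
    linear_map (carr C) (scl C) UNIV (*) (counit C) \<and>
    (\<forall>x\<in>carr C. on_left C 1 1 (comulT C) (comul C x) = on_right C 1 1 (comulT C) (comul C x) \<and>
       on_left C 1 1 (counitT C) (comul C x) = incl C x \<and>
       on_right C 1 1 (counitT C) (comul C x) = incl C x)"

definition braided_coalgebra :: "('k::field, 'a::ab_group_add, 'z) bialg_scheme \<Rightarrow> bool" where
  "braided_coalgebra C \<longleftrightarrow> coalgebra C \<and> braided_space C (brd C) \<and>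
    (\<forall>z\<in>tpow C 2. on_left C 1 1 (comulT C) (brd C z) =
        on_right C 1 2 (brd C) (on_left C 2 1 (brd C) (on_right C 1 1 (comulT C) z))) \<and>
    (\<forall>z\<in>tpow C 2. on_right C 1 1 (comulT C) (brd C z) =
        on_left C 2 1 (brd C) (on_right C 1 2 (brd C) (on_left C 1 1 (comulT C) z))) \<and>
    (\<forall>z\<in>tpow C 2. on_left C 1 1 (counitT C) (brd C z) = on_right C 1 1 (counitT C) z) \<and>
    (\<forall>z\<in>tpow C 2. on_right C 1 1 (counitT C) (brd C z) = on_left C 1 1 (counitT C) z)"

text \<open>The multiplication \<open>(m \<otimes> m)(B \<otimes> c \<otimes> B)\<close> of \<open>B \<otimes>\<^sub>c B\<close>.\<close>

definition braided_mul2 :: "('k::field, 'a::ab_group_add, 'z) bialg_scheme \<Rightarrow> ('k, 'a) tens \<Rightarrow> ('k, 'a) tens" where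
  "braided_mul2 B z = tmap B B (tpow B 2) (tpow B 2) (mulT B) (mulT B)
     (on_left B 3 1 (on_right B 1 2 (brd B)) z)"

text \<open>\<open>\<Delta> : B \<rightarrow> B \<otimes>\<^sub>c B\<close> and \<open>\<epsilon> : B \<rightarrow> K\<close> are algebra maps.\<close>

definition comul_algebra_map :: "('k::field, 'a::ab_group_add, 'z) bialg_scheme \<Rightarrow> bool" where
  "comul_algebra_map B \<longleftrightarrow> linear_map (carr B) (scl B) (tpow B 2) pscale (comul B) \<and>
    comul B (un B) = pure B [un B, un B] \<and>
    (\<forall>z\<in>tpow B 2. comul B (mul B z) =
       braided_mul2 B (tmap B B (tpow B 1) (tpow B 1) (comulT B) (comulT B) z))"

definition counit_algebra_map :: "('k::field, 'a::ab_group_add, 'z) bialg_scheme \<Rightarrow> bool" where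
  "counit_algebra_map B \<longleftrightarrow> linear_map (carr B) (scl B) UNIV (*) (counit B) \<and> counit B (un B) = 1 \<and>
    (\<forall>x\<in>carr B. \<forall>y\<in>carr B. counit B (x \<cdot>\<^bsub>B\<^esub> y) = counit B x * counit B y)"

definition braided_bialgebra :: "('k::field, 'a::ab_group_add, 'z) bialg_scheme \<Rightarrow> bool" where
  "braided_bialgebra B \<longleftrightarrow> braided_algebra B \<and> braided_coalgebra B \<and>
    comul_algebra_map B \<and> counit_algebra_map B"

definition bialgebra_hom ::
  "('k::field, 'a::ab_group_add, 'z) bialg_scheme \<Rightarrow> ('k, 'b::ab_group_add, 'y) bialg_scheme \<Rightarrow> ('a \<Rightarrow> 'b) \<Rightarrow> bool" where
  "bialgebra_hom A B f \<longleftrightarrow> algebra_hom A B f \<and> braided_hom A (brd A) B (brd B) f \<and>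
    (\<forall>x\<in>carr A. comul B (f x) = tmap2 A B (carr A) (carr A) f f (comul A x) \<and>
                counit B (f x) = counit A x)"

definition bialgebra_iso ::
  "('k::field, 'a::ab_group_add, 'z) bialg_scheme \<Rightarrow> ('k, 'b::ab_group_add, 'y) bialg_scheme \<Rightarrow> ('a \<Rightarrow> 'b) \<Rightarrow> bool" where
  "bialgebra_iso A B f \<longleftrightarrow> bialgebra_hom A B f \<and> bij_betw f (carr A) (carr B)"

definition algebra_iso ::
  "('k::field, 'a::ab_group_add, 'z) alg_scheme \<Rightarrow> ('k, 'b::ab_group_add, 'y) alg_scheme \<Rightarrow> ('a \<Rightarrow> 'b) \<Rightarrow> bool" where
  "algebra_iso A B f \<longleftrightarrow> algebra_hom A B f \<and> bij_betw f (carr A) (carr B)"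

definition primitives :: "('k::field, 'a::ab_group_add, 'z) bialg_scheme \<Rightarrow> 'a set" where
  "primitives B = {x \<in> carr B. comul B x = pure B [x, un B] + pure B [un B, x]}"


section \<open>Quotients and direct limits\<close>

definition ideal :: "('k::field, 'a::ab_group_add, 'z) alg_scheme \<Rightarrow> 'a set \<Rightarrow> bool" where
  "ideal A J \<longleftrightarrow> module.subspace (scl A) J \<and> J \<subseteq> carr A \<and>
    (\<forall>a\<in>carr A. \<forall>x\<in>J. a \<cdot>\<^bsub>A\<^esub> x \<in> J \<and> x \<cdot>\<^bsub>A\<^esub> a \<in> J)"

definition ideal_generated :: "('k::field, 'a::ab_group_add, 'z) alg_scheme \<Rightarrow> 'a set \<Rightarrow> 'a set" where
  "ideal_generated A S = \<Inter>{J. ideal A J \<and> S \<subseteq> J}"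

definition kern :: "('k::field, 'a::ab_group_add, 'z) vsp_scheme \<Rightarrow> ('a \<Rightarrow> 'b::ab_group_add) \<Rightarrow> 'a set" where
  "kern A p = {x \<in> carr A. p x = 0}"

text \<open>
  \<open>Q\<close> together with the projection \<open>p\<close> is the quotient of \<open>A\<close> by \<open>J\<close>. All structure of \<open>Q\<close> is
  determined by the requirement that \<open>p\<close> be a morphism.
\<close>

definition algebra_quotient ::
  "('k::field, 'a::ab_group_add, 'z) alg_scheme \<Rightarrow> 'a set \<Rightarrow> ('k, 'b::ab_group_add, 'y) alg_scheme \<Rightarrow> ('a \<Rightarrow> 'b) \<Rightarrow> bool" where
  "algebra_quotient A J Q p \<longleftrightarrow> algebra Q \<and> algebra_hom A Q p \<and> p ` carr A = carr Q \<and> kern A p = J"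

definition bialgebra_quotient ::
  "('k::field, 'a::ab_group_add, 'z) bialg_scheme \<Rightarrow> 'a set \<Rightarrow> ('k, 'b::ab_group_add, 'y) bialg_scheme \<Rightarrow> ('a \<Rightarrow> 'b) \<Rightarrow> bool" where
  "bialgebra_quotient A J Q p \<longleftrightarrow>
    braided_bialgebra Q \<and> bialgebra_hom A Q p \<and> p ` carr A = carr Q \<and> kern A p = J"

text \<open>
  The direct limit of \<open>U\<^sup>[\<^sup>0\<^sup>] \<rightarrow> U\<^sup>[\<^sup>1\<^sup>] \<rightarrow> \<dots>\<close>: the canonical maps \<open>q n\<close> induce a bijection from the
  disjoint union of the \<open>U\<^sup>[\<^sup>n\<^sup>]\<close>, modulo eventual equality, to \<open>L\<close>. Here
  \<open>fold p [m..<k] : U\<^sup>[\<^sup>m\<^sup>] \<rightarrow> U\<^sup>[\<^sup>k\<^sup>]\<close> is the composite transition map.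
\<close>

definition direct_limit ::
  "(nat \<Rightarrow> ('k::field, 'a::ab_group_add) bialg) \<Rightarrow> (nat \<Rightarrow> 'a \<Rightarrow> 'a) \<Rightarrow>
   ('k, 'b::ab_group_add) bialg \<Rightarrow> (nat \<Rightarrow> 'a \<Rightarrow> 'b) \<Rightarrow> bool" where
  "direct_limit U p L q \<longleftrightarrow> braided_bialgebra L \<and> (\<forall>n. bialgebra_hom (U n) L (q n)) \<and>
    carr L = (\<Union>n. q n ` carr (U n)) \<and>
    (\<forall>m n. \<forall>x\<in>carr (U m). \<forall>y\<in>carr (U n).
       q m x = q n y \<longleftrightarrow> (\<exists>k\<ge>max m n. fold p [m..<k] x = fold p [n..<k] y))"


section \<open>Braided Lie algebras\<close>

definition braided_tensor_algebra ::
  "('k::field, 'v::ab_group_add) vsp \<Rightarrow> (('k, 'v) tens \<Rightarrow> ('k, 'v) tens) \<Rightarrow> ('k, ('k, 'v) tens) bialg \<Rightarrow> bool" where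
  "braided_tensor_algebra V c T \<longleftrightarrow>
    carr T = tensor_algebra V \<and> scl T = pscale \<and> un T = pure V [] \<and>
    (\<forall>x\<in>carr T. \<forall>y\<in>carr T. x \<cdot>\<^bsub>T\<^esub> y = x \<otimes>\<^bsub>V\<^esub> y) \<and>
    braided_algebra T \<and>
    (\<forall>z\<in>tpow V 2. brd T (tmap2 V T (carr V) (carr V) (incl V) (incl V) z) =
                  tmap2 V T (carr V) (carr V) (incl V) (incl V) (c z)) \<and>
    comul_algebra_map T \<and> counit_algebra_map T \<and>
    (\<forall>v\<in>carr V. comul T (incl V v) = pure T [incl V v, un T] + pure T [un T, incl V v] \<and>
                counit T (incl V v) = 0)"

text \<open>
  The data of a bracket \<open>b\<close> on \<open>(V, c)\<close>: the braided bialgebras \<open>U n\<close> (realised in the type of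
  \<open>T(V, c)\<close>, which is possible since they are quotients of it), the projections
  \<open>p n : U n \<rightarrow> U (n + 1)\<close> and the maps \<open>i n : V \<rightarrow> P (U n)\<close>.
\<close>

definition bracket ::
  "('k::field, 'v::ab_group_add) vsp \<Rightarrow> (('k, 'v) tens \<Rightarrow> ('k, 'v) tens) \<Rightarrow> ('k, ('k, 'v) tens) bialg \<Rightarrow>
   (nat \<Rightarrow> ('k, ('k, 'v) tens) bialg) \<Rightarrow> (nat \<Rightarrow> ('k, 'v) tens \<Rightarrow> ('k, 'v) tens) \<Rightarrow>
   (nat \<Rightarrow> 'v \<Rightarrow> ('k, 'v) tens) \<Rightarrow> (nat \<Rightarrow> ('k, 'v) tens \<Rightarrow> 'v) \<Rightarrow> bool" where
  "bracket V c T U p i b \<longleftrightarrow>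
    U 0 = T \<and> (\<forall>v\<in>carr V. i 0 v = incl V v) \<and>
    (\<forall>n. let P = primitives (U n); W = i n ` carr V; ib = (\<lambda>x. i n (b n x)) in
      braided_bialgebra (U n) \<and>
      braided_hom V c (U n) (brd (U n)) (i n) \<and> W \<subseteq> P \<and>
      linear_map P (scl (U n)) (carr V) (scl V) (b n) \<and>
      (\<forall>z\<in>tprod2 (U n) P W.
         brd (U n) (tmap2 (U n) (U n) P W ib id z) = tmap2 (U n) (U n) W P id ib (brd (U n) z)) \<and>
      (\<forall>z\<in>tprod2 (U n) W P.
         brd (U n) (tmap2 (U n) (U n) W P id ib z) = tmap2 (U n) (U n) P W ib id (brd (U n) z)) \<and>
      bialgebra_quotient (U n) (ideal_generated (U n) ((\<lambda>x. x - ib x) ` P)) (U (Suc n)) (p n) \<and>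
      (\<forall>v\<in>carr V. i (Suc n) v = p n (i n v)))"

text \<open>\<open>L\<close> is the universal enveloping algebra \<open>U(V, c, b)\<close>, with canonical map \<open>q 0 \<circ> i 0\<close>.\<close>

definition braided_Lie_algebra ::
  "('k::field, 'v::ab_group_add) vsp \<Rightarrow> (('k, 'v) tens \<Rightarrow> ('k, 'v) tens) \<Rightarrow> ('k, ('k, 'v) tens) bialg \<Rightarrow>
   (nat \<Rightarrow> ('k, ('k, 'v) tens) bialg) \<Rightarrow> (nat \<Rightarrow> ('k, 'v) tens \<Rightarrow> ('k, 'v) tens) \<Rightarrow>
   (nat \<Rightarrow> 'v \<Rightarrow> ('k, 'v) tens) \<Rightarrow> (nat \<Rightarrow> ('k, 'v) tens \<Rightarrow> 'v) \<Rightarrow>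
   ('k, 'l::ab_group_add) bialg \<Rightarrow> (nat \<Rightarrow> ('k, 'v) tens \<Rightarrow> 'l) \<Rightarrow> bool" where
  "braided_Lie_algebra V c T U p i b L q \<longleftrightarrow>
    braided_space V c \<and> braided_tensor_algebra V c T \<and> bracket V c T U p i b \<and>
    direct_limit U p L q \<and> inj_on (q 0 \<circ> i 0) (carr V)"

definition E_space ::
  "('k::field, 'v::ab_group_add) vsp \<Rightarrow> ('k, ('k, 'v) tens) bialg \<Rightarrow> ('k, 'v) tens set" where
  "E_space V T = tens.span {x \<in> primitives T. \<exists>n\<ge>2. x \<in> tpow V n}"

text \<open>The ideal \<open>((Id - \<beta>)[E(V, c)])\<close> of \<open>T(V, c)\<close>.\<close>

definition E_ideal ::
  "('k::field, 'v::ab_group_add) vsp \<Rightarrow> ('k, ('k, 'v) tens) bialg \<Rightarrow> (('k, 'v) tens \<Rightarrow> 'v) \<Rightarrow> ('k, 'v) tens set" where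
  "E_ideal V T \<beta> = ideal_generated T ((\<lambda>x. x - incl V (\<beta> x)) ` E_space V T)"

text \<open>
  \<open>UU\<close> with projection \<open>r\<close> is \<open>T(V, c) / ((Id - \<beta>)[E(V, c)])\<close>. In \<open>E(V, c) \<otimes> V\<close> the space \<open>V\<close> is
  the degree one component \<open>tpow V 1\<close> of \<open>T(V, c)\<close>, with \<open>proj V\<close> its identification with \<open>V\<close>.
  The two inclusions say that \<open>c\<^sub>T\<close> restricts to \<open>E \<otimes> V \<rightarrow> V \<otimes> E\<close> and \<open>V \<otimes> E \<rightarrow> E \<otimes> V\<close>.
\<close>

definition E_braided_Lie_algebra ::
  "('k::field, 'v::ab_group_add) vsp \<Rightarrow> (('k, 'v) tens \<Rightarrow> ('k, 'v) tens) \<Rightarrow> ('k, ('k, 'v) tens) bialg \<Rightarrow>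
   (('k, 'v) tens \<Rightarrow> 'v) \<Rightarrow> ('k, 'w::ab_group_add) alg \<Rightarrow> (('k, 'v) tens \<Rightarrow> 'w) \<Rightarrow> bool" where
  "E_braided_Lie_algebra V c T \<beta> UU r \<longleftrightarrow>
    (let E = E_space V T; V1 = tpow V 1 in
      braided_space V c \<and> braided_tensor_algebra V c T \<and>
      linear_map E pscale (carr V) (scl V) \<beta> \<and>
      brd T ` tprod2 T E V1 \<subseteq> tprod2 T V1 E \<and>
      brd T ` tprod2 T V1 E \<subseteq> tprod2 T E V1 \<and>
      (\<forall>z\<in>tprod2 T E V1. c (tmap2 T V E V1 \<beta> (proj V) z) = tmap2 T V V1 E (proj V) \<beta> (brd T z)) \<and>
      (\<forall>z\<in>tprod2 T V1 E. c (tmap2 T V V1 E (proj V) \<beta> z) = tmap2 T V E V1 \<beta> (proj V) (brd T z)) \<and>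
      algebra_quotient T (E_ideal V T \<beta>) UU r \<and>
      inj_on (\<lambda>v. r (incl V v)) (carr V))"

text \<open>
  \<open>N\<close> with projection \<open>p\<close> is the Nichols algebra: the quotient by a homogeneous ideal concentrated in
  degrees at least two (so that \<open>N\<close> is graded by the images of the \<open>V\<^sup>\<otimes>\<^sup>n\<close>) whose primitive elements
  are the degree one component.
\<close>

definition Nichols_algebra ::
  "('k::field, 'v::ab_group_add) vsp \<Rightarrow> ('k, ('k, 'v) tens) bialg \<Rightarrow>
   ('k, 'n::ab_group_add) bialg \<Rightarrow> (('k, 'v) tens \<Rightarrow> 'n) \<Rightarrow> bool" where
  "Nichols_algebra V T N p \<longleftrightarrow>
    (\<exists>J. ideal T J \<and> J = tens.span (\<Union>n\<in>{2..}. J \<inter> tpow V n) \<and> bialgebra_quotient T J N p) \<and>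
    primitives N = p ` tpow V 1"

definition class_S ::
  "('k::field, 'v::ab_group_add) vsp \<Rightarrow> ('k, ('k, 'v) tens) bialg \<Rightarrow> bool" where
  "class_S V T \<longleftrightarrow> (\<exists>(N :: ('k, ('k, 'v) tens) bialg) p.
     Nichols_algebra V T N p \<and> kern T p = ideal_generated T (E_space V T))"

end

theory Submission
  imports Defs
begin

text \<open>
  Primitive elements of \<open>T(V, c)\<close> are homogeneous componentwise, so \<open>P(T) = V \<oplus> E(V, c)\<close>. Injectivity of
  \<open>i\<^sub>U\<close> forces \<open>b\<^sup>[\<^sup>n\<^sup>] i\<^sup>[\<^sup>n\<^sup>] = Id\<close>, hence \<open>Id - i\<^sup>[\<^sup>0\<^sup>] b\<^sup>[\<^sup>0\<^sup>]\<close> vanishes on \<open>V\<close> and the ideals defining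
  \<open>U\<^sup>[\<^sup>1\<^sup>]\<close> and \<open>\<U>(V, c, \<beta>)\<close> coincide.

  For \<open>(V, c)\<close> in the class \<open>\<S>\<close>, the leading term of an element with primitive image in \<open>U\<^sup>[\<^sup>1\<^sup>]\<close> has
  primitive image in the Nichols algebra. In degree \<open>n \<ge> 2\<close> it therefore lies in the ideal generated by
  \<open>E(V, c)\<close>, and can be lowered modulo the relations \<open>e = \<beta> e\<close>. By descent \<open>P(U\<^sup>[\<^sup>1\<^sup>]) = V\<close>, and from
  there on the tower \<open>U\<^sup>[\<^sup>1\<^sup>] \<rightarrow> U\<^sup>[\<^sup>2\<^sup>] \<rightarrow> \<dots>\<close> consists of isomorphisms.
\<close>

section \<open>Linear maps between subspaces\<close>

text \<open>The last claim rests on a statement of Poincare-Birkhoff-Witt type: for the degree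
  filtration, the graded algebra of \<open>U 1\<close> is the Nichols algebra.
  \<open>leading_terms\<close> shows that elements of the Nichols ideal are leading terms of
  relations of \<open>U 1\<close>. The converse cannot be read off from the generators
  \<open>e - \<beta> e\<close>: leading terms may cancel in combinations of them and leave new
  relations of lower degree, as Jacobi identities could. \<open>primitive_leading_term\<close> gets
  it from the coproduct instead. Once relations of leading degree below n are controlled, taking
  components of degree below n is well defined on the filtration pieces of \<open>U 1\<close>, and
  these components detect that the leading term in degree n is primitive in the Nichols algebra.
  Injectivity of V into \<open>U 1\<close> starts this induction in degree one. The other obstacle
  is that c_T must exchange E(V, c) with V. Compatibility of c_T with the coproduct gives this only
  for P(T), which contains V as well, so it is proved for homogeneous primitive elements, with
  degree and primitivity tracked in the same tensor slot.\<close>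

lemma
  assumes "linear_map X s Y s' f"
  shows linear_map_add: "x \<in> X \<Longrightarrow> y \<in> X \<Longrightarrow> f (x + y) = f x + f y"
    and linear_map_scale: "x \<in> X \<Longrightarrow> f (s a x) = s' a (f x)"
    and linear_map_in: "x \<in> X \<Longrightarrow> f x \<in> Y"
  using assms by (auto simp: linear_map_def)

lemma linear_map_0:
  assumes "linear_map X s Y s' f" "0 \<in> X" shows "f 0 = 0"
  using linear_map_add[OF assms(1,2,2)] by simp

lemma linear_map_diff:
  assumes "linear_map X s Y s' f" "x - y \<in> X" "y \<in> X" shows "f (x - y) = f x - f y"
  using linear_map_add[OF assms] by simp

lemma linear_map_mono:
  "linear_map X s Y s' f \<Longrightarrow> X' \<subseteq> X \<Longrightarrow> Y \<subseteq> Y' \<Longrightarrow> linear_map X' s Y' s' f"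
  unfolding linear_map_def by blast

lemma linear_map_comp:
  "linear_map X s Y s' f \<Longrightarrow> linear_map Y s' Z s'' g \<Longrightarrow> linear_map X s Z s'' (\<lambda>x. g (f x))"
  by (simp add: linear_map_def)

lemma linear_map_id: "linear_map X s X s (\<lambda>x. x)" "linear_map X s X s id"
  by (simp_all add: linear_map_def)

lemma linear_map_plus:
  assumes "vector_space s'" "linear_map X s UNIV s' f" "linear_map X s UNIV s' g"
  shows "linear_map X s UNIV s' (\<lambda>x. f x + g x)"
  using assms by (simp add: linear_map_def vector_space.vector_space_assms algebra_simps)

lemma linear_map_minus:
  assumes "vector_space s'" "linear_map X s UNIV s' f" "linear_map X s UNIV s' g"
  shows "linear_map X s UNIV s' (\<lambda>x. f x - g x)"
proof -
  interpret vector_space s' by fact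
  show ?thesis using assms(2,3) by (simp add: linear_map_def scale_right_diff_distrib)
qed

lemma linear_map_sum:
  assumes "vector_space s'" "\<And>j. j \<in> J \<Longrightarrow> linear_map X s UNIV s' (f j)"
  shows "linear_map X s UNIV s' (\<lambda>x. \<Sum>j\<in>J. f j x)"
proof -
  interpret vector_space s' by fact
  show ?thesis using assms(2) by (simp add: linear_map_def sum.distrib scale_sum_right)
qed

lemma tens_vector_space: "vector_space (pscale :: 'k::field \<Rightarrow> ('i \<Rightarrow> 'k) \<Rightarrow> ('i \<Rightarrow> 'k))"
  by unfold_locales

lemma linear_map_eq_on_span:
  assumes f: "linear_map (tens.span S) pscale Y s f" and g: "linear_map (tens.span S) pscale Z s g"
    and eq: "\<And>x. x \<in> S \<Longrightarrow> f x = g x" and x: "x \<in> tens.span S"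
  shows "f x = g x"
proof -
  \<comment> \<open>Membership in the span is part of the induction claim because \<open>f\<close>
    and \<open>g\<close> are known to be additive on the span only.\<close>
  have "x \<in> tens.span S \<and> f x = g x" using x
  proof (induction rule: tens.span_induct_alt)
    case base
    note tens.span_zero[of S]
    then show ?case using linear_map_0[OF f] linear_map_0[OF g] by metis
  next
    case (step a x y)
    have x: "x \<in> tens.span S" using step(1) by (rule tens.span_base)
    then have ax: "pscale a x \<in> tens.span S" by (rule tens.span_scale)
    then show ?case
      using step(2) eq[OF step(1)] linear_map_add[OF f ax] linear_map_add[OF g ax]
        linear_map_scale[OF f x] linear_map_scale[OF g x] tens.span_add[OF ax] by metis
  qed
  then show ?thesis ..
qed

lemma linear_map_span_into:
  assumes f: "linear_map (tens.span S) pscale Y s f" and Z: "module.subspace s Z" "vector_space s"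
    and S: "\<And>x. x \<in> S \<Longrightarrow> f x \<in> Z" and x: "x \<in> tens.span S"
  shows "f x \<in> Z"
proof -
  interpret vector_space s by (rule Z)
  have "x \<in> tens.span S \<and> f x \<in> Z" using x
  proof (induction rule: tens.span_induct_alt)
    case base
    note tens.span_zero[of S]
    then show ?case using linear_map_0[OF f] subspace_0[OF Z(1)] by metis
  next
    case (step a x y)
    have x: "x \<in> tens.span S" using step(1) by (rule tens.span_base)
    then have ax: "pscale a x \<in> tens.span S" by (rule tens.span_scale)
    then show ?case
      using step(2) S[OF step(1)] linear_map_add[OF f ax] linear_map_scale[OF f x]
        tens.span_add[OF ax] subspace_add[OF Z(1)] subspace_scale[OF Z(1)] by metis
  qed
  then show ?thesis ..
qed

lemma linear_map_image_subspace:
  assumes f: "linear_map X s Y s' f" and "vector_space s" "vector_space s'" "module.subspace s X"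
  shows "module.subspace s' (f ` X)"
proof -
  interpret A: vector_space s by fact
  interpret B: vector_space s' by fact
  show ?thesis
  proof (rule B.subspaceI)
    show "0 \<in> f ` X" using linear_map_0[OF f] A.subspace_0[OF assms(4)] by (metis imageI)
    show "x + y \<in> f ` X" if "x \<in> f ` X" "y \<in> f ` X" for x y
      using that A.subspace_add[OF assms(4)] by (auto simp: linear_map_add[OF f, symmetric])
    show "s' a x \<in> f ` X" if "x \<in> f ` X" for a x
      using that A.subspace_scale[OF assms(4)] by (auto simp: linear_map_scale[OF f, symmetric])
  qed
qed

text \<open>The section is defined on the whole target and takes values in \<open>X\<close>. It
  stands in for choices of bases: it yields kernels of \<open>Id \<otimes> f\<close>, left inverses
  of injective maps, and linear representatives in a filtration piece.\<close>

lemma linear_section_exists: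
  fixes s :: "'k::field \<Rightarrow> 'a::ab_group_add \<Rightarrow> 'a" and s' :: "'k \<Rightarrow> 'b::ab_group_add \<Rightarrow> 'b"
  assumes s: "vector_space s" and s': "vector_space s'" and X: "module.subspace s X"
    and f: "linear_map X s Y s' f"
  obtains g where "linear_map UNIV s' X s g" "\<And>y. y \<in> f ` X \<Longrightarrow> f (g y) = y"
proof -
  interpret A: vector_space s by fact
  interpret B: vector_space s' by fact
  interpret pr: vector_space_pair s' s by unfold_locales
  obtain C where C: "C \<subseteq> f ` X" "B.independent C" "f ` X \<subseteq> B.span C"
    using B.maximal_independent_subset by blast
  define h where "h = (\<lambda>y. SOME x. x \<in> X \<and> f x = y)"
  have h: "h y \<in> X \<and> f (h y) = y" if "y \<in> C" for y
    unfolding h_def by (rule someI_ex) (use that C(1) in blast)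
  \<comment> \<open>This extension also determines the range of \<open>g\<close>, as the span of the
    chosen preimages, so no value leaves \<open>X\<close>.\<close>
  obtain g where g: "Vector_Spaces.linear s' s g" "\<forall>y\<in>C. g y = h y" "range g = A.span (h ` C)"
    using pr.linear_independent_extend_subspace[OF C(2), of h] by blast
  have "range g \<subseteq> X" unfolding g(3) using h by (intro A.span_minimal X) auto
  then have gl: "linear_map UNIV s' X s g"
    using g(1) by (auto simp: linear_map_def Vector_Spaces.linear_iff)
  have "f (g y) = y" if "y \<in> f ` X" for y
  proof -
    have "y \<in> B.span C" using that C(3) by blast
    then show ?thesis
    proof (induction rule: B.span_induct_alt)
      case base
      show ?case using linear_map_0[OF gl] linear_map_0[OF f A.subspace_0[OF X]] by simp
    next
      case (step a y z)
      have "g (s' a y + z) = s a (g y) + g z" using g(1) by (simp add: Vector_Spaces.linear_iff)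
      moreover have gX: "g u \<in> X" for u using \<open>range g \<subseteq> X\<close> by blast
      ultimately have "f (g (s' a y + z)) = s' a (f (g y)) + f (g z)"
        using linear_map_add[OF f A.subspace_scale[OF X gX] gX] linear_map_scale[OF f gX] by simp
      also have "f (g y) = y" using h[OF step(1)] g(2) step(1) by simp
      finally show ?case using step(2) by simp
    qed
  qed
  then show ?thesis using that gl by blast
qed

section \<open>Tensor products of families of subspaces\<close>

lemma vspaceD:
  assumes "vspace A"
  shows "vector_space (scl A)" "module.subspace (scl A) (carr A)"
  using assms by (auto simp: vspace_def)

lemma pure_add:
  assumes "vector_space (scl A)"
  shows "pure A (us @ (x + y) # vs) = pure A (us @ x # vs) + pure A (us @ y # vs)"
  using multilinear_iff[OF assms] by (auto simp: pure_def fun_eq_iff)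

lemma pure_scale:
  assumes "vector_space (scl A)"
  shows "pure A (us @ scl A a x # vs) = pscale a (pure A (us @ x # vs))"
  using multilinear_iff[OF assms] by (auto simp: pure_def pscale_def fun_eq_iff)

lemma tpow_subspace: "tens.subspace (tpow A n)"
  unfolding tpow_def by (rule tens.subspace_span)

lemma tensor_algebra_subspace: "tens.subspace (tensor_algebra A)"
  unfolding tensor_algebra_def by (rule tens.subspace_span)

lemma pure_in_tpow: "set w \<subseteq> carr A \<Longrightarrow> length w = n \<Longrightarrow> pure A w \<in> tpow A n"
  unfolding tpow_def by (rule tens.span_base) blast

lemma pure_in_tensor_algebra: "set w \<subseteq> carr A \<Longrightarrow> pure A w \<in> tensor_algebra A"
  unfolding tensor_algebra_def by (rule tens.span_base) blast

lemma tmul_linear_right: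
  assumes "vector_space (scl A)" "x \<in> tensor_algebra A"
  shows "linear_map (tensor_algebra A) pscale UNIV pscale (\<lambda>y. x \<otimes>\<^bsub>A\<^esub> y)"
  using tmul_add_right[OF assms] tmul_scale_right[OF assms] by (simp add: linear_map_def)

lemma tmul_linear_left: "linear_map X pscale UNIV pscale (\<lambda>x. x \<otimes>\<^bsub>A\<^esub> y)"
  by (simp add: linear_map_def tmul_add_left tmul_scale_left)

lemma tmul_span:
  assumes A: "vector_space (scl A)" and S: "S \<subseteq> tensor_algebra A" "S' \<subseteq> tensor_algebra A"
    and x: "x \<in> tens.span S" and y: "y \<in> tens.span S'"
    and R: "\<And>s s'. s \<in> S \<Longrightarrow> s' \<in> S' \<Longrightarrow> s \<otimes>\<^bsub>A\<^esub> s' \<in> R" and "tens.subspace R"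
  shows "x \<otimes>\<^bsub>A\<^esub> y \<in> R"
proof -
  have 1: "s \<otimes>\<^bsub>A\<^esub> y \<in> R" if "s \<in> S" for s
  proof (rule linear_map_span_into[OF _ \<open>tens.subspace R\<close> tens_vector_space _ y])
    show "linear_map (tens.span S') pscale UNIV pscale (\<lambda>y. s \<otimes>\<^bsub>A\<^esub> y)"
      by (rule linear_map_mono[OF tmul_linear_right[OF A] _ order_refl])
        (use that S in \<open>auto intro: tens.span_minimal[OF _ tensor_algebra_subspace, THEN subsetD]\<close>)
  qed (use R that in blast)
  show ?thesis
    by (rule linear_map_span_into[OF tmul_linear_left \<open>tens.subspace R\<close> tens_vector_space _ x]) (rule 1)
qed

text \<open>The product of tensors is strictly associative, so a pure tensor can be regrouped as
  needed before \<open>on_left\<close> or \<open>on_right\<close> is evaluated on it.\<close>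

lemma tmul_assoc_pure:
  "pure A [x, y] = pure A [x] \<otimes>\<^bsub>A\<^esub> pure A [y]"
  "pure A [x, y, z] = pure A [x, y] \<otimes>\<^bsub>A\<^esub> pure A [z]"
  "pure A [x, y, z] = pure A [x] \<otimes>\<^bsub>A\<^esub> pure A [y, z]"
  "pure A [x, y, z, w] = pure A [x, y] \<otimes>\<^bsub>A\<^esub> pure A [z, w]"
  "pure A [x, y, z, w] = pure A [x, y, z] \<otimes>\<^bsub>A\<^esub> pure A [w]"
  by (simp_all add: tmul_pure)

text \<open>One set per tensor slot: a composite of braidings, products and coproducts can then be
  followed slot by slot. Containments such as c_T(E \<otimes> V) \<subseteq> V \<otimes> E are
  checked in this form.\<close>

definition tprods ::
  "('k::field, 'a::ab_group_add, 'z) vsp_scheme \<Rightarrow> 'a set list \<Rightarrow> ('k, 'a) tens set" where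
  "tprods A Xs = tens.span {pure A w | w. list_all2 (\<in>) w Xs}"

lemma tprods_subspace: "tens.subspace (tprods A Xs)"
  unfolding tprods_def by (rule tens.subspace_span)

lemma pure_in_tprods: "list_all2 (\<in>) w Xs \<Longrightarrow> pure A w \<in> tprods A Xs"
  unfolding tprods_def by (rule tens.span_base) blast

lemma tprods_induct [consumes 1, case_names linear subspace vector_space pure]:
  assumes "z \<in> tprods A Xs" "linear_map (tprods A Xs) pscale Y s f" "module.subspace s Z" "vector_space s"
    "\<And>w. list_all2 (\<in>) w Xs \<Longrightarrow> f (pure A w) \<in> Z"
  shows "f z \<in> Z"
  by (rule linear_map_span_into[OF assms(2)[unfolded tprods_def] assms(3,4) _ assms(1)[unfolded tprods_def]])
    (use assms(5) in blast)

lemma tprods_eqI: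
  assumes "z \<in> tprods A Xs" "linear_map (tprods A Xs) pscale Y s f" "linear_map (tprods A Xs) pscale Z s g"
    "\<And>w. list_all2 (\<in>) w Xs \<Longrightarrow> f (pure A w) = g (pure A w)"
  shows "f z = g z"
  by (rule linear_map_eq_on_span[OF assms(2)[unfolded tprods_def] assms(3)[unfolded tprods_def] _
      assms(1)[unfolded tprods_def]]) (use assms(4) in blast)

lemma tprods_mono: "list_all2 (\<subseteq>) Xs Ys \<Longrightarrow> tprods A Xs \<subseteq> tprods A Ys"
  unfolding tprods_def
  by (rule tens.span_mono) (auto simp: list_all2_conv_all_nth subset_iff)

lemma list_all2_mem_subset:
  assumes "list_all2 (\<in>) w Xs" "list_all (\<lambda>X. X \<subseteq> C) Xs"
  shows "set w \<subseteq> C" "length w = length Xs"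
  using assms by (induction rule: list_all2_induct) auto

lemma tprods_subset_tpow: "list_all (\<lambda>X. X \<subseteq> carr A) Xs \<Longrightarrow> tprods A Xs \<subseteq> tpow A (length Xs)"
  unfolding tprods_def tpow_def
  by (rule tens.span_mono) (use list_all2_mem_subset in blast)

lemma tpow_eq_tprods: "tpow A n = tprods A (replicate n (carr A))"
proof -
  have "list_all2 (\<in>) w (replicate n (carr A)) \<longleftrightarrow> length w = n \<and> set w \<subseteq> carr A" for w
    by (auto simp: list_all2_conv_all_nth subset_iff in_set_conv_nth)
  then show ?thesis by (simp add: tprods_def tpow_def)
qed

lemma tprod2_eq_tprods: "tprod2 A X Y = tprods A [X, Y]"
proof -
  have "list_all2 (\<in>) w [X, Y] \<longleftrightarrow> (\<exists>x\<in>X. \<exists>y\<in>Y. w = [x, y])" for w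
    by (auto simp: list_all2_Cons2)
  then have "{pure A w | w. list_all2 (\<in>) w [X, Y]} = {s \<otimes>\<^bsub>A\<^esub> t | s t. s \<in> incl A ` X \<and> t \<in> incl A ` Y}"
    unfolding incl_def by (auto simp: tmul_pure) (metis append_Cons append_Nil imageI tmul_pure)
  then show ?thesis by (simp add: tprods_def tprod2_def tprod_def)
qed

lemma tmul_tprods:
  assumes A: "vector_space (scl A)" and "list_all (\<lambda>X. X \<subseteq> carr A) (Xs @ Ys)"
    and x: "x \<in> tprods A Xs" and y: "y \<in> tprods A Ys"
  shows "x \<otimes>\<^bsub>A\<^esub> y \<in> tprods A (Xs @ Ys)"
proof (rule tmul_span[OF A _ _ x[unfolded tprods_def] y[unfolded tprods_def] _ tprods_subspace])
  have *: "{pure A w |w. list_all2 (\<in>) w Zs} \<subseteq> tensor_algebra A" if "list_all (\<lambda>X. X \<subseteq> carr A) Zs" for Zs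
    using list_all2_mem_subset(1)[OF _ that] pure_in_tensor_algebra by blast
  show "{pure A w |w. list_all2 (\<in>) w Xs} \<subseteq> tensor_algebra A"
    "{pure A w |w. list_all2 (\<in>) w Ys} \<subseteq> tensor_algebra A"
    using * assms(2) by auto
qed (auto simp: tmul_pure intro!: pure_in_tprods list_all2_appendI)

lemma
  assumes "vector_space (scl A)" "linear_map (tpow A m) pscale (tpow A k) pscale f"
    "linear_map (tpow A n) pscale (tpow A l) pscale g"
  shows tmap_tpow_tmul: "x \<in> tpow A m \<Longrightarrow> y \<in> tpow A n \<Longrightarrow>
      tmap A A (tpow A m) (tpow A n) f g (x \<otimes>\<^bsub>A\<^esub> y) = f x \<otimes>\<^bsub>A\<^esub> g y"
    and linear_map_tmap_tpow: "m' = m + n \<Longrightarrow> linear_map (tpow A m') pscale UNIV pscale (tmap A A (tpow A m) (tpow A n) f g)"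
  using tmap_tmul[OF assms(1) assms(1) tpow_subspace order_refl tpow_subspace order_refl
      linear_map_mono[OF assms(2) order_refl tpow_subset] linear_map_mono[OF assms(3) order_refl tpow_subset]]
    linear_map_tmap[OF assms(1) assms(1) tpow_subspace order_refl tpow_subspace order_refl
      linear_map_mono[OF assms(2) order_refl tpow_subset] linear_map_mono[OF assms(3) order_refl tpow_subset]]
    tpow_add[OF assms(1), of m n]
  by auto

text \<open>It suffices to look at pure tensors, which split at the border between \<open>Xs\<close>
  and \<open>Ys\<close>, where the tensor product of maps is given by its formula.\<close>

lemma tmap_tprods:
  assumes A: "vector_space (scl A)" and f: "linear_map (tpow A m) pscale (tpow A k) pscale f"
    and g: "linear_map (tpow A n) pscale (tpow A l) pscale g"
    and sub: "list_all (\<lambda>X. X \<subseteq> carr A) (Xs @ Ys @ Xs' @ Ys')" and len: "length Xs = m" "length Ys = n"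
    and fX: "f ` tprods A Xs \<subseteq> tprods A Xs'" and gY: "g ` tprods A Ys \<subseteq> tprods A Ys'"
    and z: "z \<in> tprods A (Xs @ Ys)"
  shows "tmap A A (tpow A m) (tpow A n) f g z \<in> tprods A (Xs' @ Ys')"
  using z
proof (induction rule: tprods_induct[where s = pscale and Y = UNIV])
  case linear
  show ?case
    by (rule linear_map_mono[OF linear_map_tmap_tpow[OF A f g refl] _ order_refl])
      (use tprods_subset_tpow[of A "Xs @ Ys"] sub len in auto)
next
  case subspace show ?case by (rule tprods_subspace)
next
  case vector_space show ?case by (rule tens_vector_space)
next
  case (pure w)
  then obtain u v where w: "w = u @ v" "list_all2 (\<in>) u Xs" "list_all2 (\<in>) v Ys"
    by (auto simp: list_all2_append2)
  have u: "pure A u \<in> tprods A Xs" "pure A u \<in> tpow A m"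
    using pure_in_tprods[OF w(2)] tprods_subset_tpow[of A Xs] sub len by auto
  have v: "pure A v \<in> tprods A Ys" "pure A v \<in> tpow A n"
    using pure_in_tprods[OF w(3)] tprods_subset_tpow[of A Ys] sub len by auto
  have "tmap A A (tpow A m) (tpow A n) f g (pure A w) = f (pure A u) \<otimes>\<^bsub>A\<^esub> g (pure A v)"
    unfolding w tmul_pure[symmetric] by (rule tmap_tpow_tmul[OF A f g u(2) v(2)])
  then show ?case
    using tmul_tprods[OF A, of Xs' Ys'] sub u(1) v(1) fX gY by (auto simp: image_subset_iff)
qed

lemma
  assumes "vector_space (scl A)" "linear_map (tpow A m) pscale (tpow A k) pscale f"
  shows on_left_tmul: "x \<in> tpow A m \<Longrightarrow> y \<in> tpow A n \<Longrightarrow> on_left A m n f (x \<otimes>\<^bsub>A\<^esub> y) = f x \<otimes>\<^bsub>A\<^esub> y"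
    and on_right_tmul: "x \<in> tpow A n \<Longrightarrow> y \<in> tpow A m \<Longrightarrow> on_right A n m f (x \<otimes>\<^bsub>A\<^esub> y) = x \<otimes>\<^bsub>A\<^esub> f y"
    and linear_map_on_left: "m' = m + n \<Longrightarrow> l = k + n \<Longrightarrow> linear_map (tpow A m') pscale (tpow A l) pscale (on_left A m n f)"
    and linear_map_on_right: "m' = n + m \<Longrightarrow> l = n + k \<Longrightarrow> linear_map (tpow A m') pscale (tpow A l) pscale (on_right A n m f)"
proof -
  note 1 = assms linear_map_id(2)[of "tpow A n" pscale] and 2 = assms(1) linear_map_id(2)[of "tpow A n" pscale] assms(2)
  show "x \<in> tpow A m \<Longrightarrow> y \<in> tpow A n \<Longrightarrow> on_left A m n f (x \<otimes>\<^bsub>A\<^esub> y) = f x \<otimes>\<^bsub>A\<^esub> y"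
    unfolding on_left_def using tmap_tpow_tmul[OF 1] by simp
  show "x \<in> tpow A n \<Longrightarrow> y \<in> tpow A m \<Longrightarrow> on_right A n m f (x \<otimes>\<^bsub>A\<^esub> y) = x \<otimes>\<^bsub>A\<^esub> f y"
    unfolding on_right_def using tmap_tpow_tmul[OF 2] by simp
  \<comment> \<open>\<open>linear_map_tmap\<close> only promises values in \<open>UNIV\<close>; the
    actual range comes from slot tracking with every slot equal to \<open>carr A\<close>.\<close>
  have "tmap A A (tpow A m) (tpow A n) f id z \<in> tpow A (k + n)" if "z \<in> tpow A (m + n)" for z
    unfolding tpow_eq_tprods[of A "k + n"] replicate_add
    by (rule tmap_tprods[OF 1, of "replicate m (carr A)" "replicate n (carr A)"])
      (use that assms(2) in \<open>auto simp: tpow_eq_tprods replicate_add list_all_iff linear_map_def\<close>)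
  then show "m' = m + n \<Longrightarrow> l = k + n \<Longrightarrow> linear_map (tpow A m') pscale (tpow A l) pscale (on_left A m n f)"
    using linear_map_tmap_tpow[OF 1 refl] by (simp add: on_left_def linear_map_def)
  have "tmap A A (tpow A n) (tpow A m) id f z \<in> tpow A (n + k)" if "z \<in> tpow A (n + m)" for z
    unfolding tpow_eq_tprods[of A "n + k"] replicate_add
    by (rule tmap_tprods[OF 2, of "replicate n (carr A)" "replicate m (carr A)"])
      (use that assms(2) in \<open>auto simp: tpow_eq_tprods replicate_add list_all_iff linear_map_def\<close>)
  then show "m' = n + m \<Longrightarrow> l = n + k \<Longrightarrow> linear_map (tpow A m') pscale (tpow A l) pscale (on_right A n m f)"
    using linear_map_tmap_tpow[OF 2 refl] by (simp add: on_right_def linear_map_def)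
qed

lemma on_left_tprods:
  assumes "vector_space (scl A)" "linear_map (tpow A m) pscale (tpow A k) pscale f"
    "list_all (\<lambda>X. X \<subseteq> carr A) (Xs @ Ys @ Xs')" "length Xs = m" "length Ys = n"
    "f ` tprods A Xs \<subseteq> tprods A Xs'" "z \<in> tprods A (Xs @ Ys)"
  shows "on_left A m n f z \<in> tprods A (Xs' @ Ys)"
  unfolding on_left_def
  by (rule tmap_tprods[OF assms(1,2) linear_map_id(2) _ assms(4,5,6) _ assms(7)]) (use assms(3) in auto)

lemma on_right_tprods:
  assumes "vector_space (scl A)" "linear_map (tpow A m) pscale (tpow A k) pscale f"
    "list_all (\<lambda>X. X \<subseteq> carr A) (Xs @ Ys @ Xs')" "length Xs = m" "length Ys = n"
    "f ` tprods A Xs \<subseteq> tprods A Xs'" "z \<in> tprods A (Ys @ Xs)"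
  shows "on_right A n m f z \<in> tprods A (Ys @ Xs')"
  unfolding on_right_def
  by (rule tmap_tprods[OF assms(1) linear_map_id(2) assms(2) _ assms(5,4) _ assms(6,7)]) (use assms(3) in auto)

section \<open>Braided bialgebras\<close>

lemma proj_incl: "vspace A \<Longrightarrow> x \<in> carr A \<Longrightarrow> proj A (pure A [x]) = x"
  using bij_betw_incl[of A] by (simp add: proj_def incl_def[symmetric] bij_betw_def inv_into_f_f)

lemma tpow_1: "vspace A \<Longrightarrow> tpow A 1 = incl A ` carr A"
  using bij_betw_incl[of A] by (simp add: bij_betw_def)

lemma linear_map_proj:
  assumes "vspace A" shows "linear_map (tpow A 1) pscale (carr A) (scl A) (proj A)"
proof -
  interpret vector_space "scl A" using vspaceD(1)[OF assms] .
  note lin = linear_map_incl[OF assms] and c = subspace_add[OF vspaceD(2)[OF assms]] subspace_scale[OF vspaceD(2)[OF assms]]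
  show ?thesis
    unfolding linear_map_def tpow_1[OF assms]
    using proj_incl[OF assms] linear_map_add[OF lin, symmetric] linear_map_scale[OF lin, symmetric] c
    by (auto simp: incl_def simp del: plus_fun_apply)
qed

text \<open>This bundles the conditions under which \<open>tmap2\<close> is given by its formula on
  pure tensors.\<close>

definition linear_on ::
  "('k::field, 'a::ab_group_add, 'z) vsp_scheme \<Rightarrow> 'a set \<Rightarrow> ('k, 'b::ab_group_add, 'y) vsp_scheme \<Rightarrow> ('a \<Rightarrow> 'b) \<Rightarrow> bool" where
  "linear_on A X B f \<longleftrightarrow> vspace A \<and> vspace B \<and> module.subspace (scl A) X \<and> X \<subseteq> carr A \<and>
    linear_map X (scl A) (carr B) (scl B) f"

lemma linear_onI:
  "vspace A \<Longrightarrow> vspace B \<Longrightarrow> module.subspace (scl A) X \<Longrightarrow> X \<subseteq> carr A \<Longrightarrow>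
    linear_map X (scl A) (carr B) (scl B) f \<Longrightarrow> linear_on A X B f"
  by (simp add: linear_on_def)

lemma
  assumes f: "linear_on A X B f" and g: "linear_on A Y B g"
  shows linear_map_tmap2: "linear_map (tprods A [X, Y]) pscale UNIV pscale (tmap2 A B X Y f g)"
    and tmap2_pure: "x \<in> X \<Longrightarrow> y \<in> Y \<Longrightarrow> tmap2 A B X Y f g (pure A [x, y]) = pure B [f x, g y]"
proof -
  have A: "vspace A" and B: "vspace B" using f by (auto simp: linear_on_def)
  note iA = linear_map_incl[OF A] and iB = linear_map_incl[OF B]
  have sub: "tens.subspace (incl A ` Z)" "incl A ` Z \<subseteq> tpow A 1"
    and lin: "linear_map (incl A ` Z) pscale (tensor_algebra B) pscale (\<lambda>t. incl B (h (proj A t)))"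
    if "linear_on A Z B h" for Z h
  proof -
    have Z: "module.subspace (scl A) Z" "Z \<subseteq> carr A" "linear_map Z (scl A) (carr B) (scl B) h"
      using that by (auto simp: linear_on_def)
    show "tens.subspace (incl A ` Z)"
      using linear_map_image_subspace[OF linear_map_mono[OF iA Z(2) order_refl] vspaceD(1)[OF A] tens_vector_space Z(1)] .
    show *: "incl A ` Z \<subseteq> tpow A 1" using linear_map_in[OF iA] Z(2) by blast
    have "linear_map (incl A ` Z) pscale Z (scl A) (proj A)"
      using linear_map_mono[OF linear_map_proj[OF A] * order_refl] Z(2) proj_incl[OF A]
      by (auto simp: linear_map_def incl_def)
    from linear_map_comp[OF linear_map_comp[OF this Z(3)] iB]
    show "linear_map (incl A ` Z) pscale (tensor_algebra B) pscale (\<lambda>t. incl B (h (proj A t)))"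
      by (rule linear_map_mono[OF _ order_refl tpow_subset])
  qed
  note t = vspaceD(1)[OF A] vspaceD(1)[OF B] sub[OF f] sub[OF g] lin[OF f] lin[OF g]
  show "linear_map (tprods A [X, Y]) pscale UNIV pscale (tmap2 A B X Y f g)"
    using linear_map_tmap[OF t] by (simp add: tmap2_def tprod2_eq_tprods[symmetric] tprod2_def)
  have XY: "X \<subseteq> carr A" "Y \<subseteq> carr A" using f g by (auto simp: linear_on_def)
  show "tmap2 A B X Y f g (pure A [x, y]) = pure B [f x, g y]" if "x \<in> X" "y \<in> Y"
  proof -
    have p: "proj A (pure A [x]) = x" "proj A (pure A [y]) = y" using that XY proj_incl[OF A] by auto
    have "pure A [x] \<in> incl A ` X" "pure A [y] \<in> incl A ` Y" using that by (auto simp: incl_def)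
    from tmap_tmul[OF t this] show ?thesis
      by (simp add: tmap2_def tmul_pure incl_def p)
  qed
qed

lemma tmap2_in:
  assumes f: "linear_on A X B f" and g: "linear_on A Y B g" and im: "f ` X \<subseteq> X'" "g ` Y \<subseteq> Y'"
    and z: "z \<in> tprods A [X, Y]"
  shows "tmap2 A B X Y f g z \<in> tprods B [X', Y']"
proof (rule tprods_induct[OF z linear_map_tmap2[OF f g] tprods_subspace tens_vector_space])
  fix w assume "list_all2 (\<in>) w [X, Y]"
  then show "tmap2 A B X Y f g (pure A w) \<in> tprods B [X', Y']" using im by (auto simp: list_all2_Cons2 tmap2_pure[OF f g] image_subset_iff intro!: pure_in_tprods)
qed

text \<open>\<open>tmap2\<close> is a choice that is pinned down only on the tensor product. This
  uniqueness is what its calculus rests on: congruence, composition and identity.\<close>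

lemma tmap2_eqI:
  assumes f: "linear_on A X B f" and g: "linear_on A Y B g"
    and h: "linear_map (tprods A [X, Y]) pscale Z pscale h"
    and eq: "\<And>x y. x \<in> X \<Longrightarrow> y \<in> Y \<Longrightarrow> h (pure A [x, y]) = pure B [f x, g y]"
    and z: "z \<in> tprods A [X, Y]"
  shows "h z = tmap2 A B X Y f g z"
proof (rule tprods_eqI[OF z h linear_map_tmap2[OF f g]])
  fix w assume "list_all2 (\<in>) w [X, Y]"
  then show "h (pure A w) = tmap2 A B X Y f g (pure A w)" using eq by (auto simp: list_all2_Cons2 tmap2_pure[OF f g])
qed

lemma tmap2_cong:
  assumes f: "linear_on A X B f" and g: "linear_on A Y B g"
    and f': "linear_on A X' B f'" and g': "linear_on A Y' B g'" and sub: "X' \<subseteq> X" "Y' \<subseteq> Y"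
    and eq: "\<And>x. x \<in> X' \<Longrightarrow> f x = f' x" "\<And>y. y \<in> Y' \<Longrightarrow> g y = g' y" and z: "z \<in> tprods A [X', Y']"
  shows "tmap2 A B X Y f g z = tmap2 A B X' Y' f' g' z"
proof (rule tmap2_eqI[OF f' g' _ _ z])
  show "linear_map (tprods A [X', Y']) pscale UNIV pscale (tmap2 A B X Y f g)"
    by (rule linear_map_mono[OF linear_map_tmap2[OF f g] _ order_refl]) (use sub in \<open>auto intro!: tprods_mono\<close>)
qed (use sub eq in \<open>simp add: tmap2_pure[OF f g] subset_iff\<close>)

lemma linear_on_comp:
  "linear_on A X B f \<Longrightarrow> linear_on B Y C g \<Longrightarrow> f ` X \<subseteq> Y \<Longrightarrow> linear_on A X C (\<lambda>x. g (f x))"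
  by (simp add: linear_on_def linear_map_def image_subset_iff)

lemma tmap2_comp:
  assumes f: "linear_on A X B f" and g: "linear_on A Y B g"
    and f': "linear_on B X' C f'" and g': "linear_on B Y' C g'" and im: "f ` X \<subseteq> X'" "g ` Y \<subseteq> Y'"
    and z: "z \<in> tprods A [X, Y]"
  shows "tmap2 B C X' Y' f' g' (tmap2 A B X Y f g z) = tmap2 A C X Y (\<lambda>x. f' (f x)) (\<lambda>y. g' (g y)) z"
proof (rule tmap2_eqI[OF linear_on_comp[OF f f' im(1)] linear_on_comp[OF g g' im(2)] _ _ z])
  show "linear_map (tprods A [X, Y]) pscale UNIV pscale (\<lambda>z. tmap2 B C X' Y' f' g' (tmap2 A B X Y f g z))"
    by (rule linear_map_comp[OF _ linear_map_tmap2[OF f' g']])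
      (use linear_map_tmap2[OF f g] tmap2_in[OF f g im] in \<open>auto simp: linear_map_def\<close>)
  fix x y assume xy: "x \<in> X" "y \<in> Y"
  then have "f x \<in> X'" "g y \<in> Y'" using im by auto
  then show "tmap2 B C X' Y' f' g' (tmap2 A B X Y f g (pure A [x, y])) = pure C [f' (f x), g' (g y)]"
    by (simp add: tmap2_pure[OF f g xy] tmap2_pure[OF f' g'])
qed

lemma tmap2_id:
  assumes "linear_on A X A f" "linear_on A Y A g"
    "\<And>x. x \<in> X \<Longrightarrow> f x = x" "\<And>y. y \<in> Y \<Longrightarrow> g y = y" "z \<in> tprods A [X, Y]"
  shows "tmap2 A A X Y f g z = z"
  by (rule tmap2_eqI[OF assms(1,2) linear_map_id(1) _ assms(5), symmetric]) (simp add: assms(3,4))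

lemma linear_on_UNIV:
  "vspace A \<Longrightarrow> vspace B \<Longrightarrow> linear_map (carr A) (scl A) (carr B) (scl B) f \<Longrightarrow> linear_on A (carr A) B f"
  by (simp add: linear_on_def vspaceD)

lemma tpow_2: "tpow A 2 = tprods A [carr A, carr A]"
  by (simp add: tpow_eq_tprods numeral_2_eq_2)

section \<open>Products, and braidings of products\<close>

lemma linear_map_mulT:
  "algebra A \<Longrightarrow> linear_map (tpow A 2) pscale (tpow A 1) pscale (mulT A)"
  unfolding mulT_def[abs_def] by (rule linear_map_comp[OF _ linear_map_incl]) (auto simp: algebra_def)

lemma mulT_pure: "mulT A (pure A [x, y]) = pure A [x \<cdot>\<^bsub>A\<^esub> y]"
  by (simp add: mulT_def mult_def incl_def)

lemma
  assumes "algebra A"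
  shows algebra_vspace: "vspace A"
    and mult_closed: "x \<in> carr A \<Longrightarrow> y \<in> carr A \<Longrightarrow> x \<cdot>\<^bsub>A\<^esub> y \<in> carr A"
    and unit_closed: "un A \<in> carr A"
  using assms linear_map_in[of "tpow A 2" pscale "carr A" "scl A" "mul A"] pure_in_tpow[of "[x, y]" A 2]
  by (auto simp: algebra_def mult_def)

lemma
  assumes "algebra A"
  shows linear_map_mult_left: "x \<in> carr A \<Longrightarrow> linear_map (carr A) (scl A) (carr A) (scl A) (\<lambda>y. x \<cdot>\<^bsub>A\<^esub> y)"
    and linear_map_mult_right: "y \<in> carr A \<Longrightarrow> linear_map (carr A) (scl A) (carr A) (scl A) (\<lambda>x. x \<cdot>\<^bsub>A\<^esub> y)"
proof -
  have V: "vector_space (scl A)" and m: "linear_map (tpow A 2) pscale (carr A) (scl A) (mul A)"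
    using assms by (auto simp: algebra_def vspace_def)
  have 1: "pure A [x, y] \<in> tpow A 2" if "x \<in> carr A" "y \<in> carr A" for x y
    by (rule pure_in_tpow) (use that in auto)
  show "linear_map (carr A) (scl A) (carr A) (scl A) (\<lambda>y. x \<cdot>\<^bsub>A\<^esub> y)" if "x \<in> carr A"
    using that mult_closed[OF assms] linear_map_add[OF m 1 1] linear_map_scale[OF m 1] pure_add[OF V, of "[x]" _ _ "[]"]
      pure_scale[OF V, of "[x]" _ _ "[]"]
    by (simp add: linear_map_def mult_def del: plus_fun_apply)
  show "linear_map (carr A) (scl A) (carr A) (scl A) (\<lambda>x. x \<cdot>\<^bsub>A\<^esub> y)" if "y \<in> carr A"
    using that mult_closed[OF assms] linear_map_add[OF m 1 1] linear_map_scale[OF m 1] pure_add[OF V, of "[]" _ _ "[y]"]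
      pure_scale[OF V, of "[]" _ _ "[y]"]
    by (simp add: linear_map_def mult_def del: plus_fun_apply)
qed

lemma mulT_tprods:
  assumes A: "algebra A" and sub: "X \<subseteq> carr A" "Y \<subseteq> carr A"
    and W: "\<And>x y. x \<in> X \<Longrightarrow> y \<in> Y \<Longrightarrow> x \<cdot>\<^bsub>A\<^esub> y \<in> W"
  shows "mulT A ` tprods A [X, Y] \<subseteq> tprods A [W]"
proof
  fix t assume "t \<in> mulT A ` tprods A [X, Y]"
  then obtain z where z: "z \<in> tprods A [X, Y]" and t: "t = mulT A z" by blast
  show "t \<in> tprods A [W]" unfolding t
  proof (rule tprods_induct[OF z linear_map_mono[OF linear_map_mulT[OF A] _ order_refl] tprods_subspace tens_vector_space])
    show "tprods A [X, Y] \<subseteq> tpow A 2" using tprods_subset_tpow[of A "[X, Y]"] sub by (simp add: numeral_2_eq_2)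
  next
    fix w assume "list_all2 (\<in>) w [X, Y]"
    then show "mulT A (pure A w) \<in> tprods A [W]"
      by (auto simp: list_all2_Cons2 mulT_pure intro!: pure_in_tprods W)
  qed
qed

text \<open>The braided algebra axioms move \<open>z\<close> past \<open>x\<close> and
  \<open>y\<close> one at a time, so slot containments for the two factors pass to their product.
  This is the inductive step for containments in higher degree.\<close>

lemma
  assumes A: "braided_algebra A"
    and sub: "X \<subseteq> carr A" "Y \<subseteq> carr A" "Z \<subseteq> carr A" "W \<subseteq> carr A"
    and W: "\<And>x y. x \<in> X \<Longrightarrow> y \<in> Y \<Longrightarrow> x \<cdot>\<^bsub>A\<^esub> y \<in> W"
    and xyz: "x \<in> X" "y \<in> Y" "z \<in> Z"
  shows brd_mult_left: "brd A ` tprods A [X, Z] \<subseteq> tprods A [Z, X] \<Longrightarrow> brd A ` tprods A [Y, Z] \<subseteq> tprods A [Z, Y] \<Longrightarrow>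
      brd A (pure A [x \<cdot>\<^bsub>A\<^esub> y, z]) \<in> tprods A [Z, W]"
    and brd_mult_right: "brd A ` tprods A [Z, X] \<subseteq> tprods A [X, Z] \<Longrightarrow> brd A ` tprods A [Z, Y] \<subseteq> tprods A [Y, Z] \<Longrightarrow>
      brd A (pure A [z, x \<cdot>\<^bsub>A\<^esub> y]) \<in> tprods A [W, Z]"
proof -
  have al: "algebra A" and c: "linear_map (tpow A 2) pscale (tpow A 2) pscale (brd A)"
    using A by (auto simp: braided_algebra_def braided_space_def)
  have V: "vector_space (scl A)" using algebra_vspace[OF al] by (rule vspaceD)
  note m = linear_map_mulT[OF al]
  have in3: "pure A [x, y, z] \<in> tpow A 3" "pure A [z, x, y] \<in> tpow A 3"
    by (rule pure_in_tpow; use sub xyz in auto)+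
  note mW = mulT_tprods[OF al sub(1,2) W]
  {
    assume c1: "brd A ` tprods A [X, Z] \<subseteq> tprods A [Z, X]" and c2: "brd A ` tprods A [Y, Z] \<subseteq> tprods A [Z, Y]"
    have "on_left A 2 1 (mulT A) (pure A [x, y, z]) = pure A [x \<cdot>\<^bsub>A\<^esub> y, z]"
      unfolding tmul_assoc_pure(2) using on_left_tmul[OF V m, of "pure A [x, y]" "pure A [z]" 1]
        pure_in_tpow[of "[x, y]" A 2] pure_in_tpow[of "[z]" A 1] xyz sub
      by (auto simp: mulT_pure tmul_pure)
    moreover have "brd A (on_left A 2 1 (mulT A) (pure A [x, y, z])) =
        on_right A 1 2 (mulT A) (on_left A 2 1 (brd A) (on_right A 1 2 (brd A) (pure A [x, y, z])))"
      using A in3 by (simp add: braided_algebra_def)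
    moreover have "on_right A 1 2 (brd A) (pure A [x, y, z]) \<in> tprods A ([X] @ [Z, Y])"
      by (rule on_right_tprods[OF V c _ _ _ c2]) (use sub xyz in \<open>auto intro!: pure_in_tprods\<close>)
    then have "on_left A 2 1 (brd A) (on_right A 1 2 (brd A) (pure A [x, y, z])) \<in> tprods A ([Z, X] @ [Y])"
      by (intro on_left_tprods[OF V c _ _ _ c1]) (use sub in auto)
    then have "on_right A 1 2 (mulT A) (on_left A 2 1 (brd A) (on_right A 1 2 (brd A) (pure A [x, y, z]))) \<in> tprods A ([Z] @ [W])"
      by (intro on_right_tprods[OF V m _ _ _ mW]) (use sub in auto)
    ultimately show "brd A (pure A [x \<cdot>\<^bsub>A\<^esub> y, z]) \<in> tprods A [Z, W]" by simp
  next
    assume c1: "brd A ` tprods A [Z, X] \<subseteq> tprods A [X, Z]" and c2: "brd A ` tprods A [Z, Y] \<subseteq> tprods A [Y, Z]"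
    have "on_right A 1 2 (mulT A) (pure A [z, x, y]) = pure A [z, x \<cdot>\<^bsub>A\<^esub> y]"
      unfolding tmul_assoc_pure(3) using on_right_tmul[OF V m, of "pure A [z]" 1 "pure A [x, y]"]
        pure_in_tpow[of "[x, y]" A 2] pure_in_tpow[of "[z]" A 1] xyz sub
      by (auto simp: mulT_pure tmul_pure)
    moreover have "brd A (on_right A 1 2 (mulT A) (pure A [z, x, y])) =
        on_left A 2 1 (mulT A) (on_right A 1 2 (brd A) (on_left A 2 1 (brd A) (pure A [z, x, y])))"
      using A in3 by (simp add: braided_algebra_def)
    moreover have "on_left A 2 1 (brd A) (pure A [z, x, y]) \<in> tprods A ([X, Z] @ [Y])"
      by (rule on_left_tprods[OF V c _ _ _ c1]) (use sub xyz in \<open>auto intro!: pure_in_tprods\<close>)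
    then have "on_right A 1 2 (brd A) (on_left A 2 1 (brd A) (pure A [z, x, y])) \<in> tprods A ([X] @ [Y, Z])"
      by (intro on_right_tprods[OF V c _ _ _ c2]) (use sub in auto)
    then have "on_left A 2 1 (mulT A) (on_right A 1 2 (brd A) (on_left A 2 1 (brd A) (pure A [z, x, y]))) \<in> tprods A ([W] @ [Z])"
      by (intro on_left_tprods[OF V m _ _ _ mW]) (use sub in auto)
    ultimately show "brd A (pure A [z, x \<cdot>\<^bsub>A\<^esub> y]) \<in> tprods A [W, Z]" by simp
  }
qed

section \<open>Kernels in tensor products, and the braiding on primitive elements\<close>

text \<open>
  A linear section \<open>g\<close> of \<open>D\<close> gives \<open>t - (Id \<otimes> g) ((Id \<otimes> D) t) \<in> X \<otimes> ker D\<close>, so no bases of the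
  tensor factors are needed.
\<close>

lemma
  assumes A: "vspace A" and D: "linear_map (tpow A 1) pscale (tpow A m) pscale D"
    and sub: "X \<subseteq> carr A" and Y: "module.subspace (scl A) Y" "Y \<subseteq> carr A"
  shows kernel_on_right: "t \<in> tprods A [X, Y] \<Longrightarrow> on_right A 1 1 D t = 0 \<Longrightarrow> t \<in> tprods A [X, {y \<in> Y. D (pure A [y]) = 0}]"
    and kernel_on_left: "t \<in> tprods A [Y, X] \<Longrightarrow> on_left A 1 1 D t = 0 \<Longrightarrow> t \<in> tprods A [{y \<in> Y. D (pure A [y]) = 0}, X]"
proof -
  note V = vspaceD(1)[OF A] and iA = linear_map_incl[OF A]
  have S: "tens.subspace (incl A ` Y)"
    by (rule linear_map_image_subspace[OF linear_map_mono[OF iA Y(2) order_refl] V tens_vector_space Y(1)])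
  have S1: "incl A ` Y \<subseteq> tpow A 1" using linear_map_in[OF iA] Y(2) by blast
  obtain g where g: "linear_map UNIV pscale (incl A ` Y) pscale g"
    and gD: "\<And>y. y \<in> D ` incl A ` Y \<Longrightarrow> D (g y) = y"
    using linear_section_exists[OF tens_vector_space tens_vector_space S linear_map_mono[OF D S1 order_refl]] by metis
  have g1: "linear_map (tpow A m) pscale (tpow A 1) pscale g"
    by (rule linear_map_mono[OF linear_map_mono[OF g order_refl S1]]) auto
  let ?K = "{y \<in> Y. D (pure A [y]) = 0}"
  have ker: "\<exists>k\<in>?K. pure A [y] - g (D (pure A [y])) = pure A [k]" if y: "y \<in> Y" for y
  proof -
    have iy: "pure A [y] \<in> incl A ` Y" using y by (auto simp: incl_def)
    have gy: "g (D (pure A [y])) \<in> incl A ` Y" by (rule linear_map_in[OF g UNIV_I])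
    have d: "pure A [y] - g (D (pure A [y])) \<in> incl A ` Y" using tens.subspace_diff[OF S iy gy] .
    have "D (g (D (pure A [y]))) = D (pure A [y])" using gD iy by blast
    moreover have "D (pure A [y] - g (D (pure A [y]))) = D (pure A [y]) - D (g (D (pure A [y])))"
      by (rule linear_map_diff[OF D]) (use d gy S1 in blast)+
    ultimately have "D (pure A [y] - g (D (pure A [y]))) = 0" by (simp only: cancel_comm_monoid_add_class.diff_cancel)
    with d show ?thesis by (auto simp: incl_def)
  qed
  have p1: "pure A [x] \<in> tpow A 1" if "x \<in> X \<or> x \<in> Y" for x by (rule pure_in_tpow) (use that sub Y in auto)
  note dT = linear_map_in[OF D] linear_map_in[OF linear_map_comp[OF D g1]]
  have Ts: "t \<in> tpow A n \<Longrightarrow> t \<in> tensor_algebra A" for t n using tpow_subset by blast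
  have tm: "x \<otimes>\<^bsub>A\<^esub> (y - y') = x \<otimes>\<^bsub>A\<^esub> y - x \<otimes>\<^bsub>A\<^esub> y'"
    if "x \<in> tensor_algebra A" "y \<in> tensor_algebra A" "y' \<in> tensor_algebra A" for x y y'
    by (rule linear_map_diff[OF tmul_linear_right[OF V that(1)]])
      (use that tens.subspace_diff[OF tensor_algebra_subspace] in auto)
  have tm': "(y - y') \<otimes>\<^bsub>A\<^esub> x = y \<otimes>\<^bsub>A\<^esub> x - y' \<otimes>\<^bsub>A\<^esub> x" for x y y'
    by (rule linear_map_diff[OF tmul_linear_left[of UNIV]]) auto
  have t2: "tprods A [X, Y] \<subseteq> tpow A 2" "tprods A [Y, X] \<subseteq> tpow A 2"
    using tprods_subset_tpow[of A "[X, Y]"] tprods_subset_tpow[of A "[Y, X]"] sub Y(2) by (auto simp: numeral_2_eq_2)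
  {
    assume t: "t \<in> tprods A [X, Y]" "on_right A 1 1 D t = 0"
    have D1: "linear_map (tpow A 2) pscale (tpow A (1 + m)) pscale (on_right A 1 1 D)"
      by (rule linear_map_on_right[OF V D]) auto
    have G1: "linear_map (tpow A (1 + m)) pscale (tpow A 2) pscale (on_right A 1 m g)"
      by (rule linear_map_on_right[OF V g1]) auto
    have L: "linear_map (tprods A [X, Y]) pscale UNIV pscale (\<lambda>t. t - on_right A 1 m g (on_right A 1 1 D t))"
      by (rule linear_map_minus[OF tens_vector_space linear_map_mono[OF linear_map_id(1) order_refl subset_UNIV]
            linear_map_mono[OF linear_map_comp[OF D1 G1] t2(1) subset_UNIV]])
    have "t - on_right A 1 m g (on_right A 1 1 D t) \<in> tprods A [X, ?K]"
    proof (rule tprods_induct[OF t(1) L tprods_subspace tens_vector_space])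
      fix w assume "list_all2 (\<in>) w [X, Y]"
      then obtain x y where w: "w = [x, y]" and xy: "x \<in> X" "y \<in> Y" by (auto simp: list_all2_Cons2)
      have "on_right A 1 m g (on_right A 1 1 D (pure A w)) = pure A [x] \<otimes>\<^bsub>A\<^esub> g (D (pure A [y]))"
        unfolding w tmul_assoc_pure(1) using on_right_tmul[OF V D p1 p1, of x y] on_right_tmul[OF V g1 p1 dT(1)[OF p1], of x y] xy by simp
      then have "pure A w - on_right A 1 m g (on_right A 1 1 D (pure A w)) = pure A [x] \<otimes>\<^bsub>A\<^esub> (pure A [y] - g (D (pure A [y])))"
        using tm[OF Ts[OF p1] Ts[OF p1] Ts[OF dT(2)[OF p1]], of x y y] xy by (simp add: w tmul_assoc_pure(1))
      then show "pure A w - on_right A 1 m g (on_right A 1 1 D (pure A w)) \<in> tprods A [X, ?K]"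
        using ker[OF xy(2)] xy(1) by (auto simp: tmul_pure intro!: pure_in_tprods)
    qed
    moreover have "on_right A 1 m g 0 = 0" by (rule linear_map_0[OF G1 tens.subspace_0[OF tpow_subspace]])
    ultimately show "t \<in> tprods A [X, ?K]" using t(2) by simp
  next
    assume t: "t \<in> tprods A [Y, X]" "on_left A 1 1 D t = 0"
    have D1: "linear_map (tpow A 2) pscale (tpow A (m + 1)) pscale (on_left A 1 1 D)"
      by (rule linear_map_on_left[OF V D]) auto
    have G1: "linear_map (tpow A (m + 1)) pscale (tpow A 2) pscale (on_left A m 1 g)"
      by (rule linear_map_on_left[OF V g1]) auto
    have L: "linear_map (tprods A [Y, X]) pscale UNIV pscale (\<lambda>t. t - on_left A m 1 g (on_left A 1 1 D t))"
      by (rule linear_map_minus[OF tens_vector_space linear_map_mono[OF linear_map_id(1) order_refl subset_UNIV]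
            linear_map_mono[OF linear_map_comp[OF D1 G1] t2(2) subset_UNIV]])
    have "t - on_left A m 1 g (on_left A 1 1 D t) \<in> tprods A [?K, X]"
    proof (rule tprods_induct[OF t(1) L tprods_subspace tens_vector_space])
      fix w assume "list_all2 (\<in>) w [Y, X]"
      then obtain x y where w: "w = [y, x]" and xy: "x \<in> X" "y \<in> Y" by (auto simp: list_all2_Cons2)
      have "on_left A m 1 g (on_left A 1 1 D (pure A w)) = g (D (pure A [y])) \<otimes>\<^bsub>A\<^esub> pure A [x]"
        unfolding w tmul_assoc_pure(1) using on_left_tmul[OF V D p1 p1, of y x] on_left_tmul[OF V g1 dT(1)[OF p1] p1, of y x] xy by simp
      then have "pure A w - on_left A m 1 g (on_left A 1 1 D (pure A w)) = (pure A [y] - g (D (pure A [y]))) \<otimes>\<^bsub>A\<^esub> pure A [x]"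
        using xy by (simp add: tm' w tmul_assoc_pure(1))
      then show "pure A w - on_left A m 1 g (on_left A 1 1 D (pure A w)) \<in> tprods A [?K, X]"
        using ker[OF xy(2)] xy(1) by (auto simp: tmul_pure intro!: pure_in_tprods)
    qed
    moreover have "on_left A m 1 g 0 = 0" by (rule linear_map_0[OF G1 tens.subspace_0[OF tpow_subspace]])
    ultimately show "t \<in> tprods A [?K, X]" using t(2) by simp
  }
qed


lemma linear_map_braided_mul2:
  assumes A: "braided_algebra A"
  shows "linear_map (tpow A 4) pscale UNIV pscale (braided_mul2 A)"
proof -
  have al: "algebra A" and c: "linear_map (tpow A 2) pscale (tpow A 2) pscale (brd A)"
    using A by (auto simp: braided_algebra_def braided_space_def)
  have V: "vector_space (scl A)" using algebra_vspace[OF al] by (rule vspaceD)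
  note m = linear_map_mulT[OF al]
  have 1: "linear_map (tpow A 3) pscale (tpow A 3) pscale (on_right A 1 2 (brd A))"
    by (rule linear_map_on_right[OF V c]) auto
  have 2: "linear_map (tpow A 4) pscale (tpow A 4) pscale (on_left A 3 1 (on_right A 1 2 (brd A)))"
    by (rule linear_map_on_left[OF V 1]) auto
  have 3: "linear_map (tpow A 4) pscale UNIV pscale (tmap A A (tpow A 2) (tpow A 2) (mulT A) (mulT A))"
    by (rule linear_map_tmap_tpow[OF V m m]) auto
  show ?thesis unfolding braided_mul2_def[abs_def] by (rule linear_map_comp[OF 2 3])
qed

text \<open>Once the two inner slots are exchanged, \<open>X\<close> stands next to
  \<open>X'\<close> and \<open>Y\<close> next to \<open>Y'\<close>, so the only braiding that has to
  be controlled is the one on \<open>Y \<otimes> X'\<close>.\<close>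

lemma braided_mul2_tprods:
  assumes A: "braided_algebra A"
    and sub: "X \<subseteq> carr A" "Y \<subseteq> carr A" "X' \<subseteq> carr A" "Y' \<subseteq> carr A" "W \<subseteq> carr A" "W' \<subseteq> carr A"
    and W: "\<And>x x'. x \<in> X \<Longrightarrow> x' \<in> X' \<Longrightarrow> x \<cdot>\<^bsub>A\<^esub> x' \<in> W" "\<And>y y'. y \<in> Y \<Longrightarrow> y' \<in> Y' \<Longrightarrow> y \<cdot>\<^bsub>A\<^esub> y' \<in> W'"
    and b: "brd A ` tprods A [Y, X'] \<subseteq> tprods A [X', Y]" and z: "z \<in> tprods A [X, Y, X', Y']"
  shows "braided_mul2 A z \<in> tprods A [W, W']"
proof -
  have al: "algebra A" and c: "linear_map (tpow A 2) pscale (tpow A 2) pscale (brd A)"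
    using A by (auto simp: braided_algebra_def braided_space_def)
  have V: "vector_space (scl A)" using algebra_vspace[OF al] by (rule vspaceD)
  note m = linear_map_mulT[OF al]
  have 1: "linear_map (tpow A 3) pscale (tpow A 3) pscale (on_right A 1 2 (brd A))"
    by (rule linear_map_on_right[OF V c]) auto
  have "on_right A 1 2 (brd A) t \<in> tprods A ([X] @ [X', Y])" if "t \<in> tprods A [X, Y, X']" for t
    by (rule on_right_tprods[OF V c _ _ _ b]) (use sub that in auto)
  then have 2: "on_right A 1 2 (brd A) ` tprods A [X, Y, X'] \<subseteq> tprods A [X, X', Y]" by auto
  have "on_left A 3 1 (on_right A 1 2 (brd A)) z \<in> tprods A ([X, X', Y] @ [Y'])"
    by (rule on_left_tprods[OF V 1 _ _ _ 2]) (use sub z in auto)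
  then have "braided_mul2 A z \<in> tprods A ([W] @ [W'])"
    unfolding braided_mul2_def
    by (intro tmap_tprods[OF V m m _ _ _ mulT_tprods[OF al _ _ W(1)] mulT_tprods[OF al _ _ W(2)]]) (use sub in auto)
  then show ?thesis by simp
qed

lemma linear_map_comulT:
  "coalgebra C \<Longrightarrow> linear_map (tpow C 1) pscale (tpow C 2) pscale (comulT C)"
  unfolding comulT_def[abs_def] by (rule linear_map_comp[OF linear_map_proj]) (auto simp: coalgebra_def)

lemma comulT_pure: "vspace C \<Longrightarrow> x \<in> carr C \<Longrightarrow> comulT C (pure C [x]) = comul C x"
  by (simp add: comulT_def proj_incl)

text \<open>P(B) is the kernel of the reduced coproduct \<open>D\<close>. For primitive
  \<open>x\<close>, compatibility of c with \<Delta> gives (Id \<otimes> D) c(x \<otimes> y) = 0,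
  and the kernel lemma puts c(x \<otimes> y) into \<open>X \<otimes> ker D\<close>. The subspace
  \<open>Y\<close> carries prior knowledge about that slot, later a homogeneous component, so that
  degree and primitivity hold for the same tensor factor. The other side is symmetric.\<close>

lemma
  assumes B: "braided_bialgebra B" and X: "X \<subseteq> carr B" and Y: "module.subspace (scl B) Y" "Y \<subseteq> carr B"
  shows brd_primitives_left: "x \<in> primitives B \<Longrightarrow> y \<in> carr B \<Longrightarrow> brd B (pure B [x, y]) \<in> tprods B [X, Y] \<Longrightarrow>
      brd B (pure B [x, y]) \<in> tprods B [X, Y \<inter> primitives B]"
    and brd_primitives_right: "y \<in> primitives B \<Longrightarrow> x \<in> carr B \<Longrightarrow> brd B (pure B [x, y]) \<in> tprods B [Y, X] \<Longrightarrow>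
      brd B (pure B [x, y]) \<in> tprods B [Y \<inter> primitives B, X]"
proof -
  have A: "braided_algebra B" and C: "braided_coalgebra B" using B by (auto simp: braided_bialgebra_def)
  have al: "algebra B" and c: "linear_map (tpow B 2) pscale (tpow B 2) pscale (brd B)" and C': "coalgebra B"
    using A C by (auto simp: braided_algebra_def braided_space_def braided_coalgebra_def)
  have V: "vspace B" using algebra_vspace[OF al] .
  note vs = vspaceD(1)[OF V] and u = unit_closed[OF al] and com = linear_map_comulT[OF C']
  let ?u = "pure B [un B]"
  define D where "D = (\<lambda>t. comulT B t - t \<otimes>\<^bsub>B\<^esub> ?u - ?u \<otimes>\<^bsub>B\<^esub> t)"
  have u1: "?u \<in> tpow B 1" using u by (auto intro!: pure_in_tpow)
  have p1: "pure B [x] \<in> tpow B 1" if "x \<in> carr B" for x by (rule pure_in_tpow) (use that in auto)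
  have p2: "pure B [x, y] \<in> tpow B 2" if "x \<in> carr B" "y \<in> carr B" for x y by (rule pure_in_tpow) (use that in auto)
  have p3: "pure B [x, y, z] \<in> tpow B 3" if "x \<in> carr B" "y \<in> carr B" "z \<in> carr B" for x y z
    by (rule pure_in_tpow) (use that in auto)
  have ul: "linear_map (tpow B n) pscale (tpow B m) pscale (\<lambda>t. ?u \<otimes>\<^bsub>B\<^esub> t)"
    and ur: "linear_map (tpow B n) pscale (tpow B m) pscale (\<lambda>t. t \<otimes>\<^bsub>B\<^esub> ?u)" if "m = Suc n" for m n
  proof -
    have "?u \<otimes>\<^bsub>B\<^esub> t \<in> tpow B m" "t \<otimes>\<^bsub>B\<^esub> ?u \<in> tpow B m" if t: "t \<in> tpow B n" for t
      using tpow_add[OF vs, of 1 n] tpow_add[OF vs, of n 1] u1 t \<open>m = Suc n\<close>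
      by (auto simp: tprod_def intro!: tens.span_base)
    moreover have "?u \<in> tensor_algebra B" using u1 tpow_subset by blast
    ultimately show "linear_map (tpow B n) pscale (tpow B m) pscale (\<lambda>t. ?u \<otimes>\<^bsub>B\<^esub> t)"
      "linear_map (tpow B n) pscale (tpow B m) pscale (\<lambda>t. t \<otimes>\<^bsub>B\<^esub> ?u)"
      using linear_map_mono[OF tmul_linear_right[OF vs, of ?u] tpow_subset[of B n] order_refl]
        tmul_linear_left[of "tpow B n" B ?u]
      by (auto simp: linear_map_def simp del: plus_fun_apply)
  qed
  have D: "linear_map (tpow B 1) pscale (tpow B 2) pscale D"
  proof -
    have "linear_map (tpow B 1) pscale UNIV pscale D"
      unfolding D_def
      by (intro linear_map_minus[OF tens_vector_space] linear_map_mono[OF com order_refl subset_UNIV]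
          linear_map_mono[OF ur order_refl subset_UNIV] linear_map_mono[OF ul order_refl subset_UNIV]) auto
    moreover have "D t \<in> tpow B 2" if "t \<in> tpow B 1" for t
      unfolding D_def by (intro tens.subspace_diff[OF tpow_subspace])
        (use that linear_map_in[OF com] linear_map_in[OF ul, of 2 1] linear_map_in[OF ur, of 2 1] in auto)
    ultimately show ?thesis by (simp add: linear_map_def)
  qed
  have DP: "{y \<in> Y. D (pure B [y]) = 0} = Y \<inter> primitives B"
  proof -
    have "D (pure B [y]) = comul B y - (pure B [y, un B] + pure B [un B, y])" if "y \<in> Y" for y
      using that Y comulT_pure[OF V, of y] by (auto simp: D_def tmul_pure)
    then show ?thesis using Y(2) unfolding primitives_def by (auto simp only: right_minus_eq)
  qed
  have uc: "brd B (pure B [un B, x]) = pure B [x, un B]" "brd B (pure B [x, un B]) = pure B [un B, x]" if "x \<in> carr B" for x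
    using A that by (auto simp: braided_algebra_def)
  have cl: "linear_map (tpow B 3) pscale (tpow B 3) pscale (on_left B 2 1 (brd B))"
    by (rule linear_map_on_left[OF vs c]) auto
  have cr: "linear_map (tpow B 3) pscale (tpow B 3) pscale (on_right B 1 2 (brd B))"
    by (rule linear_map_on_right[OF vs c]) auto
  have comr: "linear_map (tpow B 2) pscale (tpow B 3) pscale (on_right B 1 1 (comulT B))"
    by (rule linear_map_on_right[OF vs com]) auto
  have coml: "linear_map (tpow B 2) pscale (tpow B 3) pscale (on_left B 1 1 (comulT B))"
    by (rule linear_map_on_left[OF vs com]) auto
  have Dr: "linear_map (tpow B 2) pscale UNIV pscale (on_right B 1 1 D)"
    by (rule linear_map_mono[OF linear_map_on_right[OF vs D refl refl, of 1] _ subset_UNIV]) (auto simp: numeral_2_eq_2)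
  have Dl: "linear_map (tpow B 2) pscale UNIV pscale (on_left B 1 1 D)"
    by (rule linear_map_mono[OF linear_map_on_left[OF vs D refl refl, of 1] _ subset_UNIV]) (auto simp: numeral_2_eq_2)
  have cl': "on_left B 2 1 (brd B) (t \<otimes>\<^bsub>B\<^esub> pure B [z]) = brd B t \<otimes>\<^bsub>B\<^esub> pure B [z]" if "t \<in> tpow B 2" "z \<in> carr B" for t z
    using on_left_tmul[OF vs c that(1) p1[OF that(2)]] .
  have cr': "on_right B 1 2 (brd B) (pure B [z] \<otimes>\<^bsub>B\<^esub> t) = pure B [z] \<otimes>\<^bsub>B\<^esub> brd B t" if "t \<in> tpow B 2" "z \<in> carr B" for t z
    using on_right_tmul[OF vs c p1[OF that(2)] that(1)] .
  have T1: "pure B [x] \<in> tensor_algebra B" if "x \<in> carr B" for x using p1[OF that] tpow_subset by blast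
  have T2: "pure B [x, y] \<in> tensor_algebra B" if "x \<in> carr B" "y \<in> carr B" for x y using p2[OF that] tpow_subset by blast
  have tm: "x \<otimes>\<^bsub>B\<^esub> (y - y') = x \<otimes>\<^bsub>B\<^esub> y - x \<otimes>\<^bsub>B\<^esub> y'"
    if "x \<in> tensor_algebra B" "y \<in> tensor_algebra B" "y' \<in> tensor_algebra B" for x y y'
    by (rule linear_map_diff[OF tmul_linear_right[OF vs that(1)]])
      (use that tens.subspace_diff[OF tensor_algebra_subspace] in auto)
  have tm': "(y - y') \<otimes>\<^bsub>B\<^esub> x = y \<otimes>\<^bsub>B\<^esub> x - y' \<otimes>\<^bsub>B\<^esub> x" for x y y'
    by (rule linear_map_diff[OF tmul_linear_left[of UNIV]]) auto
  have comT: "comul B x \<in> tensor_algebra B" if "x \<in> carr B" for x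
    using linear_map_in[OF com p1[OF that]] comulT_pure[OF V that] tpow_subset by auto
  {
    assume x: "x \<in> primitives B" and y: "y \<in> carr B" and t: "brd B (pure B [x, y]) \<in> tprods B [X, Y]"
    let ?t = "brd B (pure B [x, y])"
    have xc: "x \<in> carr B" using x by (auto simp: primitives_def)
    note t2 = linear_map_in[OF c p2[OF xc y]]
    \<comment> \<open>A unit in the middle slot is a unit put in front and braided past the first
      factor. This rewrites \<open>Id \<otimes> D\<close> through maps that the braided coalgebra
      axioms can evaluate at c(x \<otimes> y), which need not be a pure tensor.\<close>
    have eq: "on_right B 1 1 D t = on_right B 1 1 (comulT B) t - t \<otimes>\<^bsub>B\<^esub> ?u - on_left B 2 1 (brd B) (?u \<otimes>\<^bsub>B\<^esub> t)"
      if "t \<in> tpow B 2" for t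
    proof (rule tprods_eqI[of t B "[carr B, carr B]"])
      show "t \<in> tprods B [carr B, carr B]" using that by (simp add: tpow_2)
      show "linear_map (tprods B [carr B, carr B]) pscale UNIV pscale (on_right B 1 1 D)"
        using Dr by (simp add: tpow_2)
      show "linear_map (tprods B [carr B, carr B]) pscale UNIV pscale
          (\<lambda>t. on_right B 1 1 (comulT B) t - t \<otimes>\<^bsub>B\<^esub> ?u - on_left B 2 1 (brd B) (?u \<otimes>\<^bsub>B\<^esub> t))"
        unfolding tpow_2[symmetric]
        by (intro linear_map_minus[OF tens_vector_space] tmul_linear_left linear_map_mono[OF comr order_refl subset_UNIV]
          linear_map_mono[OF linear_map_comp[OF ul cl] order_refl subset_UNIV]) auto
      fix w assume "list_all2 (\<in>) w [carr B, carr B]"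
      then obtain a b where w: "w = [a, b]" and ab: "a \<in> carr B" "b \<in> carr B" by (auto simp: list_all2_Cons2)
      have "on_right B 1 1 D (pure B w) = pure B [a] \<otimes>\<^bsub>B\<^esub> (comul B b - pure B [b, un B] - pure B [un B, b])"
        using on_right_tmul[OF vs D p1 p1, of a b] ab comulT_pure[OF V, of b] by (simp add: w D_def tmul_pure)
      also have "\<dots> = pure B [a] \<otimes>\<^bsub>B\<^esub> comul B b - pure B [a, b, un B] - pure B [a, un B, b]"
        using ab u T1 T2 comT by (simp add: tm tens.subspace_diff[OF tensor_algebra_subspace] tmul_pure)
      also have "pure B [a] \<otimes>\<^bsub>B\<^esub> comul B b = on_right B 1 1 (comulT B) (pure B w)"
        using on_right_tmul[OF vs com p1 p1, of a b] ab comulT_pure[OF V, of b] by (simp add: w tmul_pure)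
      also have "pure B [a, un B, b] = on_left B 2 1 (brd B) (?u \<otimes>\<^bsub>B\<^esub> pure B w)"
        using cl'[OF p2[OF u ab(1)] ab(2)] uc(1)[OF ab(1)] by (simp add: w tmul_pure)
      finally show "on_right B 1 1 D (pure B w) = on_right B 1 1 (comulT B) (pure B w) - pure B w \<otimes>\<^bsub>B\<^esub> ?u -
          on_left B 2 1 (brd B) (?u \<otimes>\<^bsub>B\<^esub> pure B w)" by (simp only: w tmul_pure append.simps)
    qed
    have "on_left B 1 1 (comulT B) (pure B [x, y]) = pure B [x, un B, y] + pure B [un B, x, y]"
      using on_left_tmul[OF vs com p1[OF xc] p1[OF y]] comulT_pure[OF V xc] x
      by (simp add: tmul_pure primitives_def tmul_add_left)
    then have "on_right B 1 2 (brd B) (on_left B 1 1 (comulT B) (pure B [x, y])) = pure B [x, y, un B] + ?u \<otimes>\<^bsub>B\<^esub> ?t"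
      using linear_map_add[OF cr p3[OF xc u y] p3[OF u xc y]] cr'[OF p2[OF u y] xc] cr'[OF p2[OF xc y] u] uc(1)[OF y]
      by (simp add: tmul_pure)
    moreover have "on_left B 2 1 (brd B) (pure B [x, y, un B] + ?u \<otimes>\<^bsub>B\<^esub> ?t) = ?t \<otimes>\<^bsub>B\<^esub> ?u + on_left B 2 1 (brd B) (?u \<otimes>\<^bsub>B\<^esub> ?t)"
      using linear_map_add[OF cl p3[OF xc y u] linear_map_in[OF ul t2]] cl'[OF p2[OF xc y] u] by (simp add: tmul_pure)
    moreover have "on_right B 1 1 (comulT B) ?t = on_left B 2 1 (brd B) (on_right B 1 2 (brd B) (on_left B 1 1 (comulT B) (pure B [x, y])))"
      using C p2[OF xc y] by (auto simp: braided_coalgebra_def)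
    ultimately have "on_right B 1 1 D ?t = 0" using eq[OF t2] by simp
    then show "?t \<in> tprods B [X, Y \<inter> primitives B]"
      using kernel_on_right[OF V D X Y t] unfolding DP by blast
  next
    assume y: "y \<in> primitives B" and x: "x \<in> carr B" and t: "brd B (pure B [x, y]) \<in> tprods B [Y, X]"
    let ?t = "brd B (pure B [x, y])"
    have yc: "y \<in> carr B" using y by (auto simp: primitives_def)
    note t2 = linear_map_in[OF c p2[OF x yc]]
    \<comment> \<open>The mirror image: a unit in the middle is a unit put at the end and braided
      past the last factor.\<close>
    have eq: "on_left B 1 1 D t = on_left B 1 1 (comulT B) t - on_right B 1 2 (brd B) (t \<otimes>\<^bsub>B\<^esub> ?u) - ?u \<otimes>\<^bsub>B\<^esub> t"
      if "t \<in> tpow B 2" for t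
    proof (rule tprods_eqI[of t B "[carr B, carr B]"])
      show "t \<in> tprods B [carr B, carr B]" using that by (simp add: tpow_2)
      show "linear_map (tprods B [carr B, carr B]) pscale UNIV pscale (on_left B 1 1 D)"
        using Dl by (simp add: tpow_2)
      show "linear_map (tprods B [carr B, carr B]) pscale UNIV pscale
          (\<lambda>t. on_left B 1 1 (comulT B) t - on_right B 1 2 (brd B) (t \<otimes>\<^bsub>B\<^esub> ?u) - ?u \<otimes>\<^bsub>B\<^esub> t)"
        unfolding tpow_2[symmetric]
        by (intro linear_map_minus[OF tens_vector_space] linear_map_mono[OF coml order_refl subset_UNIV]
          linear_map_mono[OF ul[OF refl] order_refl subset_UNIV]
          linear_map_mono[OF linear_map_comp[OF ur cr] order_refl subset_UNIV]) auto
      fix w assume "list_all2 (\<in>) w [carr B, carr B]"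
      then obtain a b where w: "w = [a, b]" and ab: "a \<in> carr B" "b \<in> carr B" by (auto simp: list_all2_Cons2)
      have "on_left B 1 1 D (pure B w) = (comul B a - pure B [a, un B] - pure B [un B, a]) \<otimes>\<^bsub>B\<^esub> pure B [b]"
        using on_left_tmul[OF vs D p1 p1, of a b] ab comulT_pure[OF V, of a] by (simp add: w D_def tmul_pure)
      also have "\<dots> = comul B a \<otimes>\<^bsub>B\<^esub> pure B [b] - pure B [a, un B, b] - pure B [un B, a, b]"
        by (simp add: tm' tmul_pure)
      also have "comul B a \<otimes>\<^bsub>B\<^esub> pure B [b] = on_left B 1 1 (comulT B) (pure B w)"
        using on_left_tmul[OF vs com p1 p1, of a b] ab comulT_pure[OF V, of a] by (simp add: w tmul_pure)
      also have "pure B [a, un B, b] = on_right B 1 2 (brd B) (pure B w \<otimes>\<^bsub>B\<^esub> ?u)"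
        using cr'[OF p2[OF ab(2) u] ab(1)] uc(2)[OF ab(2)] by (simp add: w tmul_pure)
      finally show "on_left B 1 1 D (pure B w) = on_left B 1 1 (comulT B) (pure B w) -
          on_right B 1 2 (brd B) (pure B w \<otimes>\<^bsub>B\<^esub> ?u) - ?u \<otimes>\<^bsub>B\<^esub> pure B w" by (simp only: w tmul_pure append.simps)
    qed
    have "on_right B 1 1 (comulT B) (pure B [x, y]) = pure B [x, y, un B] + pure B [x, un B, y]"
      using on_right_tmul[OF vs com p1[OF x] p1[OF yc]] comulT_pure[OF V yc] y
        tmul_add_right[OF vs T1[OF x] T2[OF yc u] T2[OF u yc]]
      by (simp add: tmul_pure primitives_def)
    then have "on_left B 2 1 (brd B) (on_right B 1 1 (comulT B) (pure B [x, y])) = ?t \<otimes>\<^bsub>B\<^esub> ?u + pure B [un B, x, y]"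
      using linear_map_add[OF cl p3[OF x yc u] p3[OF x u yc]] cl'[OF p2[OF x yc] u] cl'[OF p2[OF x u] yc] uc(2)[OF x]
      by (simp add: tmul_pure)
    moreover have "on_right B 1 2 (brd B) (?t \<otimes>\<^bsub>B\<^esub> ?u + pure B [un B, x, y]) = on_right B 1 2 (brd B) (?t \<otimes>\<^bsub>B\<^esub> ?u) + ?u \<otimes>\<^bsub>B\<^esub> ?t"
      using linear_map_add[OF cr linear_map_in[OF ur t2] p3[OF u x yc]] cr'[OF p2[OF x yc] u] by (simp add: tmul_pure)
    moreover have "on_left B 1 1 (comulT B) ?t = on_right B 1 2 (brd B) (on_left B 2 1 (brd B) (on_right B 1 1 (comulT B) (pure B [x, y])))"
      using C p2[OF x yc] by (auto simp: braided_coalgebra_def)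
    ultimately have "on_left B 1 1 D ?t = 0" using eq[OF t2] by simp
    then show "?t \<in> tprods B [Y \<inter> primitives B, X]"
      using kernel_on_left[OF V D X Y t] unfolding DP by blast
  }
qed

section \<open>The braided tensor algebra\<close>

text \<open>The projection onto degree \<open>n\<close>. Tensors are functionals on forms, so it is
  the transpose of cutting a form down to lists of length \<open>n\<close>; in this shape it is
  linear on all functionals, without a domain condition.\<close>

definition hpart :: "('k::field, 'a::ab_group_add, 'z) vsp_scheme \<Rightarrow> nat \<Rightarrow> ('k, 'a) tens \<Rightarrow> ('k, 'a) tens" where
  "hpart A n t = (\<lambda>\<phi>. if multilinear A \<phi> then t (\<lambda>w. if length w = n then \<phi> w else 0) else 0)"

text \<open>The bound is strict so that \<open>tlow A 0\<close> is zero and descents along the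
  filtration end trivially; elements of degree at most \<open>n\<close> form
  \<open>tlow A (Suc n)\<close>.\<close>

definition tlow :: "('k::field, 'a::ab_group_add, 'z) vsp_scheme \<Rightarrow> nat \<Rightarrow> ('k, 'a) tens set" where
  "tlow A n = tens.span {pure A w | w. length w < n \<and> set w \<subseteq> carr A}"

lemma linear_map_hpart: "linear_map X pscale UNIV pscale (hpart A n)"
  by (auto simp: linear_map_def hpart_def pscale_def fun_eq_iff)

lemma hpart_pure:
  assumes "vector_space (scl A)"
  shows "hpart A n (pure A w) = (if length w = n then pure A w else 0)"
proof
  fix \<phi>
  have "multilinear A (\<lambda>w. if length w = n then \<phi> w else 0)" if "multilinear A \<phi>"
    using that by (auto simp: multilinear_iff[OF assms])
  then show "hpart A n (pure A w) \<phi> = (if length w = n then pure A w else 0) \<phi>"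
    by (simp add: hpart_def pure_def)
qed

lemma tlow_subspace: "tens.subspace (tlow A n)"
  unfolding tlow_def by (rule tens.subspace_span)

lemma tlow_subset: "tlow A n \<subseteq> tensor_algebra A"
  unfolding tlow_def tensor_algebra_def by (rule tens.span_mono) auto

lemma tlow_mono: "m \<le> n \<Longrightarrow> tlow A m \<subseteq> tlow A n"
  unfolding tlow_def by (rule tens.span_mono) auto

lemma tpow_subset_tlow: "m < n \<Longrightarrow> tpow A m \<subseteq> tlow A n"
  unfolding tlow_def tpow_def by (rule tens.span_mono) auto

lemma tlow_0: "tlow A 0 = {0}"
  by (simp add: tlow_def)

lemma tensor_algebra_tlow: assumes "x \<in> tensor_algebra A" obtains n where "x \<in> tlow A n"
proof -
  have "\<exists>n. x \<in> tlow A n"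
    using assms unfolding tensor_algebra_def
  proof (induction rule: tens.span_induct_alt)
    case base
    then show ?case using tens.subspace_0[OF tlow_subspace] by blast
  next
    case (step a x y)
    then obtain w n where w: "x = pure A w" "set w \<subseteq> carr A" "y \<in> tlow A n" by blast
    let ?m = "max n (Suc (length w))"
    have "x \<in> tlow A ?m" unfolding tlow_def w(1) by (rule tens.span_base) (use w(2) in auto)
    moreover have "y \<in> tlow A ?m" using w(3) tlow_mono[of n ?m A] by auto
    ultimately show ?case by (metis tens.subspace_add[OF tlow_subspace] tens.subspace_scale[OF tlow_subspace])
  qed
  then show ?thesis using that by blast
qed

context
  fixes A :: "('k::field, 'a::ab_group_add, 'z) vsp_scheme"
  assumes A: "vector_space (scl A)"
begin

lemma hpart_tpow: "x \<in> tpow A m \<Longrightarrow> hpart A n x = (if m = n then x else 0)"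
proof -
  assume x: "x \<in> tpow A m"
  have "linear_map (tpow A m) pscale UNIV pscale (\<lambda>x. if m = n then x else 0)"
    by (auto simp: linear_map_def pscale_def fun_eq_iff)
  then show ?thesis
    by (rule linear_map_eq_on_span[OF linear_map_hpart _ _ x[unfolded tpow_def], folded tpow_def])
      (use hpart_pure[OF A] in auto)
qed

lemma hpart_in_tpow: "x \<in> tensor_algebra A \<Longrightarrow> hpart A n x \<in> tpow A n"
  unfolding tensor_algebra_def
  by (rule linear_map_span_into[OF linear_map_hpart tpow_subspace tens_vector_space])
    (auto simp: hpart_pure[OF A] intro: pure_in_tpow tens.subspace_0[OF tpow_subspace])

lemma hpart_tlow: "x \<in> tlow A m \<Longrightarrow> m \<le> n \<Longrightarrow> hpart A n x = 0"
proof -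
  assume x: "x \<in> tlow A m" and n: "m \<le> n"
  have "linear_map (tlow A m) pscale UNIV pscale (\<lambda>x. 0 :: ('k, 'a) tens)"
    by (auto simp: linear_map_def pscale_def fun_eq_iff)
  then show ?thesis
    by (rule linear_map_eq_on_span[OF linear_map_hpart _ _ x[unfolded tlow_def], folded tlow_def])
      (use hpart_pure[OF A] n in auto)
qed

lemma diff_hpart_tlow:
  assumes "x \<in> tlow A (Suc n)" shows "x - hpart A n x \<in> tlow A n"
proof -
  have L: "linear_map (tlow A (Suc n)) pscale UNIV pscale (\<lambda>x. x - hpart A n x)"
    by (rule linear_map_minus[OF tens_vector_space linear_map_mono[OF linear_map_id(1) order_refl subset_UNIV] linear_map_hpart])
  have "pure A w - hpart A n (pure A w) \<in> tlow A n" if "length w < Suc n" "set w \<subseteq> carr A" for w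
  proof (cases "length w = n")
    case True
    then show ?thesis using tens.subspace_0[OF tlow_subspace] by (simp add: hpart_pure[OF A] del: minus_apply)
  next
    case False
    then have "pure A w \<in> tlow A n" unfolding tlow_def by (intro tens.span_base) (use that in auto)
    then show ?thesis using False by (simp only: hpart_pure[OF A] if_False diff_zero)
  qed
  then show ?thesis
    using linear_map_span_into[OF L[unfolded tlow_def[of A "Suc n"]] tlow_subspace tens_vector_space _ assms[unfolded tlow_def]] by blast
qed

lemma tlow_Suc_cases:
  assumes "x \<in> tlow A (Suc n)" obtains y z where "x = y + z" "y \<in> tpow A n" "z \<in> tlow A n"
proof (rule that)
  show "x = hpart A n x + (x - hpart A n x)" by simp
  show "hpart A n x \<in> tpow A n" using hpart_in_tpow assms tlow_subset by blast
qed (rule diff_hpart_tlow[OF assms])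

lemma sum_hpart: "x \<in> tlow A n \<Longrightarrow> x = (\<Sum>m<n. hpart A m x)"
proof (induction n arbitrary: x)
  case 0 then show ?case by (simp add: tlow_0)
next
  case (Suc n)
  from Suc.prems obtain y z where yz: "x = y + z" "y \<in> tpow A n" "z \<in> tlow A n" by (rule tlow_Suc_cases)
  have h: "hpart A m x = hpart A m y + hpart A m z" for m
    unfolding yz(1) by (rule linear_map_add[OF linear_map_hpart[of UNIV]]) auto
  have "(\<Sum>m<n. hpart A m x) = (\<Sum>m<n. hpart A m z)"
    by (rule sum.cong) (auto simp: h hpart_tpow[OF yz(2)])
  then have "(\<Sum>m<Suc n. hpart A m x) = z + y"
    using Suc.IH[OF yz(3)] hpart_tlow[OF yz(3) order_refl] by (simp add: h hpart_tpow[OF yz(2)] del: plus_fun_apply)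
  then show ?case using yz(1) by (simp add: add.commute del: plus_fun_apply)
qed

end

section \<open>Degrees in T(V, c): product, braiding, coproduct and counit\<close>

lemma tmul_tpow:
  assumes "vector_space (scl A)" "x \<in> tpow A m" "y \<in> tpow A n" shows "x \<otimes>\<^bsub>A\<^esub> y \<in> tpow A (m + n)"
  unfolding tpow_add[OF assms(1), symmetric] tprod_def by (rule tens.span_base) (use assms in blast)

lemma linear_map_pure2:
  assumes "vector_space (scl A)"
  shows "linear_map X (scl A) UNIV pscale (\<lambda>x. pure A [x, y])" "linear_map X (scl A) UNIV pscale (\<lambda>y. pure A [x, y])"
  using pure_add[OF assms, of "[]" _ _ "[y]"] pure_scale[OF assms, of "[]" _ _ "[y]"]
    pure_add[OF assms, of "[x]" _ _ "[]"] pure_scale[OF assms, of "[x]" _ _ "[]"]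
  by (simp_all add: linear_map_def)

text \<open>\<open>braided_tensor_algebra\<close> only says that \<Delta> and \<epsilon> are algebra
  maps with given values on V. The assumption \<open>bialgebra_T\<close> adds the coalgebra laws and
  the compatibility of the braiding with \<Delta> and \<epsilon>; a bracket provides it as its stage
  0.\<close>

locale tensor_bialgebra =
  fixes V :: "('k::field, 'v::ab_group_add) vsp" and c :: "('k, 'v) tens \<Rightarrow> ('k, 'v) tens"
    and T :: "('k, ('k, 'v) tens) bialg"
  assumes braided_V: "braided_space V c" and tensor_T: "braided_tensor_algebra V c T"
    and bialgebra_T: "braided_bialgebra T"
begin

abbreviation H where "H \<equiv> tpow V"

lemma vspace_V: "vspace V" and linear_map_c: "linear_map (H 2) pscale (H 2) pscale c"
  using braided_V by (auto simp: braided_space_def)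

lemmas vs_V = vspaceD(1)[OF vspace_V]

lemma carr_T: "carr T = tensor_algebra V" and scl_T: "scl T = pscale" and un_T: "un T = pure V []"
  and mult_T: "x \<in> carr T \<Longrightarrow> y \<in> carr T \<Longrightarrow> x \<cdot>\<^bsub>T\<^esub> y = x \<otimes>\<^bsub>V\<^esub> y"
  using tensor_T by (auto simp: braided_tensor_algebra_def)

lemma algebra_T: "algebra T" and braided_algebra_T: "braided_algebra T"
  and coalgebra_T: "coalgebra T" and vspace_T: "vspace T"
  and linear_map_brd: "linear_map (tpow T 2) pscale (tpow T 2) pscale (brd T)"
  and linear_map_comul: "linear_map (carr T) pscale (tpow T 2) pscale (comul T)"
  and linear_map_counit: "linear_map (carr T) pscale UNIV (*) (counit T)"
  using bialgebra_T
  by (auto simp: braided_bialgebra_def braided_algebra_def braided_space_def braided_coalgebra_def coalgebra_def scl_T)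

lemmas vs_T = vspaceD(1)[OF vspace_T]

lemma H_subset: "H n \<subseteq> carr T" unfolding carr_T by (rule tpow_subset)

lemma H_in: "x \<in> H n \<Longrightarrow> x \<in> carr T" using H_subset by blast

lemma subspace_T: "tens.subspace (carr T)" unfolding carr_T by (rule tensor_algebra_subspace)

lemma mult_H: "x \<in> H m \<Longrightarrow> y \<in> H n \<Longrightarrow> x \<cdot>\<^bsub>T\<^esub> y \<in> H (m + n)"
  by (simp add: mult_T H_in tmul_tpow[OF vs_V])

lemma H_0: "H 0 = tens.span {un T}"
  unfolding tpow_def un_T by (rule arg_cong[where f = tens.span]) auto

text \<open>Inductions on the degree use this to split off one factor of degree one on the
  left.\<close>

lemma H_Suc: "H (Suc n) = tens.span {x \<cdot>\<^bsub>T\<^esub> y | x y. x \<in> H 1 \<and> y \<in> H n}"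
proof -
  have *: "x \<cdot>\<^bsub>T\<^esub> y = x \<otimes>\<^bsub>V\<^esub> y" if "x \<in> H 1" "y \<in> H n" for x y
    by (rule mult_T[OF H_in[OF that(1)] H_in[OF that(2)]])
  have "{x \<cdot>\<^bsub>T\<^esub> y | x y. x \<in> H 1 \<and> y \<in> H n} = {x \<otimes>\<^bsub>V\<^esub> y | x y. x \<in> H 1 \<and> y \<in> H n}"
    by (intro Collect_cong iff_exI) (use * in auto)
  then show ?thesis using tpow_add[OF vs_V, of 1 n] by (simp add: tprod_def)
qed

lemma H_0_into:
  assumes "linear_map (carr T) pscale Y s f" "module.subspace s Z" "vector_space s" "f (un T) \<in> Z" "x \<in> H 0"
  shows "f x \<in> Z"
  by (rule linear_map_span_into[OF linear_map_mono[OF assms(1) H_subset[of 0, unfolded H_0] order_refl] assms(2,3) _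
        assms(5)[unfolded H_0]]) (use assms(4) in simp)

lemma H_Suc_into:
  assumes "linear_map (carr T) pscale Y s f" "module.subspace s Z" "vector_space s"
    "\<And>x y. x \<in> H 1 \<Longrightarrow> y \<in> H n \<Longrightarrow> f (x \<cdot>\<^bsub>T\<^esub> y) \<in> Z" "x \<in> H (Suc n)"
  shows "f x \<in> Z"
  by (rule linear_map_span_into[OF linear_map_mono[OF assms(1) H_subset[of "Suc n", unfolded H_Suc] order_refl] assms(2,3) _
        assms(5)[unfolded H_Suc]]) (use assms(4) in auto)

lemma span_subset_T: "S \<subseteq> carr T \<Longrightarrow> tens.span S \<subseteq> carr T"
  by (rule tens.span_minimal[OF _ subspace_T])

lemma pure2_tpow: "x \<in> carr T \<Longrightarrow> y \<in> carr T \<Longrightarrow> pure T [x, y] \<in> tpow T 2"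
  by (rule pure_in_tpow) auto

text \<open>Braidings are controlled on generators of each factor only. This passes to the spans; it
  is applied to the products that span a homogeneous component and to the homogeneous primitive
  elements that span E.\<close>

lemma tprods_span_into:
  assumes f: "linear_map (tpow T 2) pscale Y s f" and Z: "module.subspace s Z" "vector_space s"
    and S: "S \<subseteq> carr T" "S' \<subseteq> carr T" and fS: "\<And>x y. x \<in> S \<Longrightarrow> y \<in> S' \<Longrightarrow> f (pure T [x, y]) \<in> Z"
  shows "f ` tprods T [tens.span S, tens.span S'] \<subseteq> Z"
proof
  note sT = span_subset_T[OF S(1)] span_subset_T[OF S(2)]
  have f': "linear_map X pscale UNIV s (\<lambda>x. f (pure T [x, y]))" if "X \<subseteq> carr T" "y \<in> carr T" for X y
    by (rule linear_map_mono[OF linear_map_comp[OF _ f] order_refl subset_UNIV])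
      (use linear_map_pure2[OF vs_T, of X, unfolded scl_T] that pure2_tpow in \<open>auto simp: linear_map_def\<close>)
  have f'': "linear_map X pscale UNIV s (\<lambda>y. f (pure T [x, y]))" if "X \<subseteq> carr T" "x \<in> carr T" for X x
    by (rule linear_map_mono[OF linear_map_comp[OF _ f] order_refl subset_UNIV])
      (use linear_map_pure2[OF vs_T, of X, unfolded scl_T] that pure2_tpow in \<open>auto simp: linear_map_def\<close>)
  have 1: "f (pure T [x, y]) \<in> Z" if "x \<in> S" "y \<in> tens.span S'" for x y
    by (rule linear_map_span_into[OF f'' Z _ that(2)]) (use sT S that fS in auto)
  have 2: "f (pure T [x, y]) \<in> Z" if "x \<in> tens.span S" "y \<in> tens.span S'" for x y
    by (rule linear_map_span_into[OF f' Z _ that(1)]) (use sT that 1 in auto)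
  fix t assume "t \<in> f ` tprods T [tens.span S, tens.span S']"
  then obtain z where z: "z \<in> tprods T [tens.span S, tens.span S']" and t: "t = f z" by blast
  show "t \<in> Z" unfolding t
  proof (rule tprods_induct[OF z linear_map_mono[OF f _ order_refl] Z])
    show "tprods T [tens.span S, tens.span S'] \<subseteq> tpow T 2" unfolding tpow_2 by (rule tprods_mono) (use sT in auto)
    show "f (pure T w) \<in> Z" if "list_all2 (\<in>) w [tens.span S, tens.span S']" for w
      using that 2 by (auto simp: list_all2_Cons2)
  qed
qed

lemma span_H: "tens.span (H n) = H n"
  by (rule tens.span_eq_iff[THEN iffD2, OF tpow_subspace])

lemma brd_un: "x \<in> carr T \<Longrightarrow> brd T (pure T [un T, x]) = pure T [x, un T]"
  "x \<in> carr T \<Longrightarrow> brd T (pure T [x, un T]) = pure T [un T, x]"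
  using braided_algebra_T by (auto simp: braided_algebra_def)

lemma linear_on_incl: "linear_on V (carr V) T (incl V)"
  by (rule linear_on_UNIV[OF vspace_V vspace_T])
    (use linear_map_incl[OF vspace_V] H_subset in \<open>auto simp: scl_T intro: linear_map_mono\<close>)

lemma incl_carr: "incl V ` carr V = H 1"
  using tpow_1[OF vspace_V] by simp

lemma brd_incl:
  "z \<in> H 2 \<Longrightarrow> brd T (tmap2 V T (carr V) (carr V) (incl V) (incl V) z) = tmap2 V T (carr V) (carr V) (incl V) (incl V) (c z)"
  using tensor_T by (auto simp: braided_tensor_algebra_def)

text \<open>The braiding is homogeneous because it is determined by c on V \<otimes> V, the unit
  axioms and the compatibility with products. The second degree is built up first, with the first
  degree equal to one; then the first degree is built up against an arbitrary second one.\<close>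

lemma brd_H: "brd T ` tprods T [H m, H n] \<subseteq> tprods T [H n, H m]"
proof -
  have un: "un T \<in> H 0" by (simp add: H_0 tens.span_base)
  have right0: "brd T ` tprods T [H 0, H n] \<subseteq> tprods T [H n, H 0]" for n
  proof -
    have "brd T ` tprods T [tens.span {un T}, tens.span (H n)] \<subseteq> tprods T [H n, H 0]"
    proof (rule tprods_span_into[OF linear_map_brd tprods_subspace tens_vector_space _ H_subset])
      show "{un T} \<subseteq> carr T" using un H_in by blast
      fix x y assume "x \<in> {un T}" "y \<in> H n"
      then show "brd T (pure T [x, y]) \<in> tprods T [H n, H 0]" using un by (simp add: brd_un(1) H_in pure_in_tprods)
    qed
    then show ?thesis unfolding span_H H_0 .
  qed
  have left0: "brd T ` tprods T [H n, H 0] \<subseteq> tprods T [H 0, H n]" for n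
  proof -
    have "brd T ` tprods T [tens.span (H n), tens.span {un T}] \<subseteq> tprods T [H 0, H n]"
    proof (rule tprods_span_into[OF linear_map_brd tprods_subspace tens_vector_space H_subset])
      show "{un T} \<subseteq> carr T" using un H_in by blast
      fix x y assume "x \<in> H n" "y \<in> {un T}"
      then show "brd T (pure T [x, y]) \<in> tprods T [H 0, H n]" using un by (simp add: brd_un(2) H_in pure_in_tprods)
    qed
    then show ?thesis unfolding span_H H_0 .
  qed
  have 11: "brd T ` tprods T [H 1, H 1] \<subseteq> tprods T [H 1, H 1]"
  proof -
    have "brd T (pure T [x, y]) \<in> tprods T [H 1, H 1]" if xy: "x \<in> H 1" "y \<in> H 1" for x y
    proof -
      obtain v w where vw: "v \<in> carr V" "w \<in> carr V" "x = incl V v" "y = incl V w"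
        using xy[folded incl_carr] by blast
      have z: "pure V [v, w] \<in> H 2" by (rule pure_in_tpow) (use vw in auto)
      have "brd T (pure T [x, y]) = tmap2 V T (carr V) (carr V) (incl V) (incl V) (c (pure V [v, w]))"
        using brd_incl[OF z] tmap2_pure[OF linear_on_incl linear_on_incl vw(1,2)] vw by simp
      also have "\<dots> \<in> tprods T [H 1, H 1]"
      proof (rule tmap2_in[OF linear_on_incl linear_on_incl])
        show "c (pure V [v, w]) \<in> tprods V [carr V, carr V]"
          using linear_map_in[OF linear_map_c z] unfolding tpow_2 .
      qed (simp_all only: incl_carr order_refl)
      finally show ?thesis .
    qed
    then have "brd T ` tprods T [tens.span (H 1), tens.span (H 1)] \<subseteq> tprods T [H 1, H 1]"
      by (intro tprods_span_into[OF linear_map_brd tprods_subspace tens_vector_space H_subset H_subset]) blast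
    then show ?thesis unfolding span_H .
  qed
  have 1: "brd T ` tprods T [H 1, H n] \<subseteq> tprods T [H n, H 1]" for n
  proof (induction n)
    case 0 show ?case by (rule left0)
  next
    case (Suc n)
    have *: "x \<cdot>\<^bsub>T\<^esub> y \<in> H (Suc n)" if "x \<in> H 1" "y \<in> H n" for x y using mult_H[OF that] by simp
    have b: "brd T (pure T [z, x \<cdot>\<^bsub>T\<^esub> y]) \<in> tprods T [H (Suc n), H 1]" if "z \<in> H 1" "x \<in> H 1" "y \<in> H n" for x y z
      by (rule brd_mult_right[OF braided_algebra_T H_subset H_subset H_subset H_subset * that(2,3,1) 11 Suc.IH])
    have sub: "{x \<cdot>\<^bsub>T\<^esub> y | x y. x \<in> H 1 \<and> y \<in> H n} \<subseteq> carr T" using * H_in by blast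
    have "brd T ` tprods T [tens.span (H 1), tens.span {x \<cdot>\<^bsub>T\<^esub> y | x y. x \<in> H 1 \<and> y \<in> H n}] \<subseteq> tprods T [H (Suc n), H 1]"
      by (rule tprods_span_into[OF linear_map_brd tprods_subspace tens_vector_space H_subset sub]) (use b in auto)
    then show ?case unfolding H_Suc[symmetric] span_H .
  qed
  show ?thesis
  proof (induction m)
    case 0 show ?case by (rule right0)
  next
    case (Suc m)
    have *: "x \<cdot>\<^bsub>T\<^esub> y \<in> H (Suc m)" if "x \<in> H 1" "y \<in> H m" for x y using mult_H[OF that] by simp
    have b: "brd T (pure T [x \<cdot>\<^bsub>T\<^esub> y, z]) \<in> tprods T [H n, H (Suc m)]" if "z \<in> H n" "x \<in> H 1" "y \<in> H m" for x y z
      by (rule brd_mult_left[OF braided_algebra_T H_subset H_subset H_subset H_subset * that(2,3,1) 1 Suc.IH])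
    have sub: "{x \<cdot>\<^bsub>T\<^esub> y | x y. x \<in> H 1 \<and> y \<in> H m} \<subseteq> carr T" using * H_in by blast
    have "brd T ` tprods T [tens.span {x \<cdot>\<^bsub>T\<^esub> y | x y. x \<in> H 1 \<and> y \<in> H m}, tens.span (H n)] \<subseteq> tprods T [H n, H (Suc m)]"
      by (rule tprods_span_into[OF linear_map_brd tprods_subspace tens_vector_space sub H_subset]) (use b in auto)
    then show ?case unfolding H_Suc[symmetric] span_H .
  qed
qed

text \<open>The total grading of T \<otimes> T, for which \<Delta> is homogeneous.\<close>

definition tpart where "tpart n = tens.span {pure T [x, y] | x y i j. x \<in> H i \<and> y \<in> H j \<and> i + j = n}"

lemma tpart_subspace: "tens.subspace (tpart n)"
  unfolding tpart_def by (rule tens.subspace_span)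

lemma tprods_H_tpart: "tprods T [H i, H j] \<subseteq> tpart (i + j)"
  unfolding tprods_def tpart_def by (rule tens.span_mono) (auto simp: list_all2_Cons2)

lemma
  assumes "v \<in> H 1"
  shows comul_incl: "comul T v = pure T [v, un T] + pure T [un T, v]" and counit_incl: "counit T v = 0"
proof -
  have *: "\<forall>v\<in>carr V. comul T (incl V v) = pure T [incl V v, un T] + pure T [un T, incl V v] \<and> counit T (incl V v) = 0"
    using tensor_T by (simp add: braided_tensor_algebra_def)
  from assms obtain v' where "v' \<in> carr V" "v = incl V v'" unfolding incl_carr[symmetric] by blast
  with * show "comul T v = pure T [v, un T] + pure T [un T, v]" "counit T v = 0" by blast+
qed

lemma comul_algebra_map_T: "comul_algebra_map T"
  using bialgebra_T by (simp add: braided_bialgebra_def)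

lemma comul_un: "comul T (un T) = pure T [un T, un T]"
  using comul_algebra_map_T by (simp add: comul_algebra_map_def)

lemma comul_mult:
  assumes xy: "x \<in> carr T" "y \<in> carr T"
  shows "comul T (x \<cdot>\<^bsub>T\<^esub> y) = braided_mul2 T (comul T x \<otimes>\<^bsub>T\<^esub> comul T y)"
proof -
  have p: "pure T [x] \<in> tpow T 1" "pure T [y] \<in> tpow T 1" using xy by (auto intro!: pure_in_tpow)
  have "comul T (x \<cdot>\<^bsub>T\<^esub> y) = braided_mul2 T (tmap T T (tpow T 1) (tpow T 1) (comulT T) (comulT T) (pure T [x, y]))"
    using comul_algebra_map_T pure2_tpow[OF xy] by (simp add: comul_algebra_map_def mult_def)
  then show ?thesis
    using tmap_tpow_tmul[OF vs_T linear_map_comulT[OF coalgebra_T] linear_map_comulT[OF coalgebra_T] p]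
      xy comulT_pure[OF vspace_T] by (simp add: tmul_pure)
qed

lemma un_H: "un T \<in> H 0" by (simp add: H_0 tens.span_base)

lemma un_in: "un T \<in> carr T" using un_H H_in by blast

text \<open>By induction on the degree: \<Delta> is multiplicative for the twisted product of T
  \<otimes> T, and that product is homogeneous because the braiding is.\<close>

lemma comul_H: "x \<in> H n \<Longrightarrow> comul T x \<in> tpart n"
proof (induction n arbitrary: x)
  case 0
  have "comul T (un T) \<in> tpart 0" unfolding comul_un using tprods_H_tpart[of 0 0] un_H by (auto intro!: pure_in_tprods)
  then show ?case by (rule H_0_into[OF linear_map_comul tpart_subspace tens_vector_space _ 0])
next
  case (Suc n)
  let ?S = "\<lambda>n. {pure T [x, y] | x y i j. x \<in> H i \<and> y \<in> H j \<and> i + j = n}"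
  \<comment> \<open>The four-slot tensors that arise from \<Delta>(x) \<otimes> \<Delta>(y), before
    multiplication. The twisted product sends degrees (i, j, k, l) to (i + k, j + l), which keeps
    the sum.\<close>
  let ?R = "{pure T [a, b, c, d] | a b c d i j k l. a \<in> H i \<and> b \<in> H j \<and> c \<in> H k \<and> d \<in> H l \<and> i + j + k + l = Suc n}"
  have S: "?S m \<subseteq> tensor_algebra T" for m
  proof
    fix t assume "t \<in> ?S m"
    then obtain a b i j where "t = pure T [a, b]" "a \<in> H i" "b \<in> H j" by blast
    then show "t \<in> tensor_algebra T" using H_in[of a i] H_in[of b j] by (simp add: pure_in_tensor_algebra)
  qed
  have R4: "?R \<subseteq> tpow T 4" 
  proof
    fix t assume "t \<in> ?R"
    then obtain a b c d i j k l where "t = pure T [a, b, c, d]" "a \<in> H i" "b \<in> H j" "c \<in> H k" "d \<in> H l" by blast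
    then show "t \<in> tpow T 4" using H_in[of a i] H_in[of b j] H_in[of c k] H_in[of d l] by (simp add: pure_in_tpow)
  qed
  have Rs: "tens.span ?R \<subseteq> tpow T 4" by (rule tens.span_minimal[OF R4 tpow_subspace])
  have "comul T (x \<cdot>\<^bsub>T\<^esub> y) \<in> tpart (Suc n)" if x: "x \<in> H 1" and y: "y \<in> H n" for x y
  proof -
    have "comul T x \<in> tpart (Suc 0)" unfolding comul_incl[OF x]
      using tprods_H_tpart[of 1 0] tprods_H_tpart[of 0 1] x un_H
      by (intro tens.subspace_add[OF tpart_subspace]) (auto intro!: pure_in_tprods)
    then have 1: "comul T x \<in> tens.span (?S 1)" by (simp add: tpart_def)
    have 2: "comul T y \<in> tens.span (?S n)" using Suc.IH[OF y] by (simp add: tpart_def)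
    have "comul T x \<otimes>\<^bsub>T\<^esub> comul T y \<in> tens.span ?R"
    proof (rule tmul_span[OF vs_T S S 1 2 _ tens.subspace_span])
      fix s s' assume s: "s \<in> ?S 1" and s': "s' \<in> ?S n"
      obtain a b i j where 1: "s = pure T [a, b]" "a \<in> H i" "b \<in> H j" "i + j = 1" using s by blast
      obtain c d k l where 2: "s' = pure T [c, d]" "c \<in> H k" "d \<in> H l" "k + l = n" using s' by blast
      note * = 1(1) 2(1) 1(2-4) 2(2-4)
      have "i + j + k + l = Suc n" using *(5,8) by simp
      then have "s \<otimes>\<^bsub>T\<^esub> s' \<in> ?R" unfolding *(1,2) tmul_pure append.simps using *(3,4,6,7) by blast
      then show "s \<otimes>\<^bsub>T\<^esub> s' \<in> tens.span ?R" by (rule tens.span_base)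
    qed
    moreover have g: "braided_mul2 T (pure T [a, b, c, d]) \<in> tpart (Suc n)"
      if "a \<in> H i" "b \<in> H j" "c \<in> H k" "d \<in> H l" "i + j + k + l = Suc n" for a b c d i j k l
    proof -
      have "braided_mul2 T (pure T [a, b, c, d]) \<in> tprods T [H (i + k), H (j + l)]"
        by (rule braided_mul2_tprods[OF braided_algebra_T H_subset[of i] H_subset[of j] H_subset[of k] H_subset[of l] H_subset H_subset
              mult_H mult_H brd_H]) (use that in \<open>auto intro!: pure_in_tprods\<close>)
      then show ?thesis using tprods_H_tpart[of "i + k" "j + l"] that(5) by (auto simp: algebra_simps)
    qed
    have g': "braided_mul2 T t \<in> tpart (Suc n)" if tR: "t \<in> ?R" for t
    proof -
      obtain a b c d i j k l where t: "t = pure T [a, b, c, d]" "a \<in> H i" "b \<in> H j" "c \<in> H k" "d \<in> H l" "i + j + k + l = Suc n"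
        using tR by blast
      show ?thesis unfolding t(1) by (rule g[OF t(2-6)])
    qed
    ultimately have "braided_mul2 T (comul T x \<otimes>\<^bsub>T\<^esub> comul T y) \<in> tpart (Suc n)"
      by (intro linear_map_span_into[OF linear_map_mono[OF linear_map_braided_mul2[OF braided_algebra_T] Rs order_refl] tpart_subspace tens_vector_space g'])
    then show ?thesis unfolding comul_mult[OF H_in[OF x] H_in[OF y]] .
  qed
  then show ?case by (rule H_Suc_into[OF linear_map_comul tpart_subspace tens_vector_space _ Suc.prems])
qed

lemma counit_H: "x \<in> H n \<Longrightarrow> n \<noteq> 0 \<Longrightarrow> counit T x = 0"
proof -
  interpret field: vector_space "(*) :: 'k \<Rightarrow> 'k \<Rightarrow> 'k" by (rule vs_field)
  assume x: "x \<in> H n" and "n \<noteq> 0"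
  then obtain m where n: "n = Suc m" using not0_implies_Suc by blast
  have C: "counit_algebra_map T" using bialgebra_T by (simp add: braided_bialgebra_def)
  have "counit T (x \<cdot>\<^bsub>T\<^esub> y) = 0" if "x \<in> H 1" "y \<in> H m" for x y
    using C that H_in counit_incl[of x] by (auto simp: counit_algebra_map_def)
  then have "counit T x \<in> {0}"
    using H_Suc_into[OF linear_map_counit field.subspace_single_0 vs_field _ x[unfolded n]] by blast
  then show ?thesis by simp
qed

lemma counit_un: "counit T (un T) = 1"
  using bialgebra_T by (simp add: braided_bialgebra_def counit_algebra_map_def)

text \<open>\<epsilon> is multiplicative and vanishes on V, hence on all positive degrees. Combined
  with \<open>counit_primitive\<close> this removes degree zero parts.\<close>

lemma hpart_0: "x \<in> carr T \<Longrightarrow> hpart V 0 x = pscale (counit T x) (un T)"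
proof -
  assume x: "x \<in> carr T"
  have L: "linear_map (carr T) pscale UNIV pscale (\<lambda>x. pscale (counit T x) (un T))"
    by (rule linear_map_comp[OF linear_map_counit]) (simp add: linear_map_def tens.scale_left_distrib del: plus_fun_apply)
  show ?thesis
  proof (rule linear_map_eq_on_span[OF linear_map_hpart L[unfolded carr_T tensor_algebra_def] _ x[unfolded carr_T tensor_algebra_def]])
    fix t assume "t \<in> {pure V w |w. set w \<subseteq> carr V}"
    then obtain w where w: "t = pure V w" "set w \<subseteq> carr V" by blast
    show "hpart V 0 t = pscale (counit T t) (un T)"
    proof (cases "w = []")
      case True
      then show ?thesis using counit_un by (simp add: w(1) hpart_pure[OF vs_V] un_T)
    next
      case False
      then have "counit T t = 0" using counit_H[of t "length w"] w by (auto intro: pure_in_tpow)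
      then show ?thesis using False by (simp add: w(1) hpart_pure[OF vs_V])
    qed
  qed
qed

end

section \<open>Counits and primitive elements of a bialgebra\<close>

lemma linear_map_counitT:
  assumes C: "coalgebra C" shows "linear_map (tpow C 1) pscale (tpow C 0) pscale (counitT C)"
proof -
  have V: "vspace C" and e: "linear_map (carr C) (scl C) UNIV (*) (counit C)" using C by (auto simp: coalgebra_def)
  have "pure C [] \<in> tpow C 0" by (rule pure_in_tpow) auto
  then have "linear_map UNIV (*) (tpow C 0) pscale (\<lambda>a. pscale a (pure C []))"
    using tens.subspace_scale[OF tpow_subspace, of "pure C []" C 0]
    by (simp add: linear_map_def tens.scale_left_distrib del: plus_fun_apply)
  from linear_map_comp[OF linear_map_comp[OF linear_map_proj[OF V] e] this] show ?thesis
    unfolding counitT_def[abs_def] .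
qed

lemma
  assumes C: "coalgebra C" and xy: "x \<in> carr C" "y \<in> carr C"
  shows on_left_counit: "on_left C 1 1 (counitT C) (pure C [x, y]) = pure C [scl C (counit C x) y]"
    and on_right_counit: "on_right C 1 1 (counitT C) (pure C [x, y]) = pure C [scl C (counit C y) x]"
proof -
  have V: "vspace C" using C by (simp add: coalgebra_def)
  note vs = vspaceD(1)[OF V] and cl = linear_map_counitT[OF C]
  have p: "pure C [x] \<in> tpow C 1" "pure C [y] \<in> tpow C 1" using xy by (simp_all add: pure_in_tpow)
  have s: "pure C [scl C a z] = pscale a (pure C [z])" for a z using pure_scale[OF vs, of "[]" _ _ "[]"] by simp
  have c: "counitT C (pure C [z]) = pscale (counit C z) (pure C [])" if "z \<in> carr C" for z
    using proj_incl[OF V that] by (simp add: counitT_def)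
  show "on_left C 1 1 (counitT C) (pure C [x, y]) = pure C [scl C (counit C x) y]"
    using on_left_tmul[OF vs cl p(1) p(2)] c[OF xy(1)] by (simp add: s tmul_pure tmul_scale_left)
  have "pure C [] \<in> tensor_algebra C" "pure C [x] \<in> tensor_algebra C" using xy by (auto intro!: pure_in_tensor_algebra)
  then show "on_right C 1 1 (counitT C) (pure C [x, y]) = pure C [scl C (counit C y) x]"
    using on_right_tmul[OF vs cl p(1) p(2)] c[OF xy(2)] tmul_scale_right[OF vs] by (simp add: s tmul_pure)
qed

text \<open>The counit law applied to \<Delta>(x) = x \<otimes> 1 + 1 \<otimes> x gives x =
  \<epsilon>(x) 1 + x. So \<epsilon>(x) 1 = 0, and applying \<epsilon> once more gives the
  claim.\<close>

lemma counit_primitive: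
  assumes B: "braided_bialgebra B" and x: "x \<in> primitives B"
  shows "counit B x = 0"
proof -
  have A: "algebra B" and C: "coalgebra B" and e: "counit B (un B) = 1"
    and el: "linear_map (carr B) (scl B) UNIV (*) (counit B)"
    using B by (auto simp: braided_bialgebra_def braided_algebra_def braided_coalgebra_def counit_algebra_map_def)
  have V: "vspace B" using algebra_vspace[OF A] .
  have xc: "x \<in> carr B" using x by (simp add: primitives_def)
  note u = unit_closed[OF A] and vs = vspaceD(1)[OF V]
  interpret vector_space "scl B" by (rule vs)
  have cl: "linear_map (tpow B 1) pscale (tpow B 0) pscale (counitT B)"
    by (rule linear_map_counitT[OF C])
  have *: "on_left B 1 1 (counitT B) (pure B [y, z]) = pure B [scl B (counit B y) z]" if "y \<in> carr B" "z \<in> carr B" for y z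
    by (rule on_left_counit[OF C that])
  have "on_left B 1 1 (counitT B) (comul B x) = incl B x" using C xc by (simp add: coalgebra_def)
  moreover have "on_left B 1 1 (counitT B) (comul B x) = pure B [scl B (counit B x) (un B)] + pure B [x]"
  proof -
    have "on_left B 1 1 (counitT B) (pure B [x, un B] + pure B [un B, x]) =
      on_left B 1 1 (counitT B) (pure B [x, un B]) + on_left B 1 1 (counitT B) (pure B [un B, x])"
      by (rule linear_map_add[OF linear_map_on_left[OF vs cl refl refl]]) (use xc u in \<open>simp_all add: pure_in_tpow\<close>)
    then show ?thesis using x *[OF xc u] *[OF u xc] e by (simp add: primitives_def scale_one del: plus_fun_apply)
  qed
  ultimately have "pure B [scl B (counit B x) (un B)] = 0" by (simp add: incl_def del: plus_fun_apply)
  also have "0 = pure B [scl B 0 (un B)]" using pure_scale[OF vs, of "[]" 0 _ "[]"] by (simp add: tens.scale_zero_left)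
  finally have "scl B (counit B x) (un B) = scl B 0 (un B)"
    using proj_incl[OF V] subspace_scale[OF vspaceD(2)[OF V] u] by metis
  then have "counit B (scl B (counit B x) (un B)) = counit B (scl B 0 (un B))" by (rule arg_cong)
  then show ?thesis unfolding linear_map_scale[OF el u] e mult_1_right .
qed

lemma primitives_subspace:
  assumes B: "braided_bialgebra B" shows "module.subspace (scl B) (primitives B)"
proof -
  have "coalgebra B" and com: "linear_map (carr B) (scl B) (tpow B 2) pscale (comul B)"
    using B by (auto simp: braided_bialgebra_def braided_coalgebra_def coalgebra_def)
  then have V: "vspace B" by (simp add: coalgebra_def)
  note vs = vspaceD(1)[OF V] and sub = vspaceD(2)[OF V]
  interpret vector_space "scl B" by (rule vs)
  have L: "linear_map (carr B) (scl B) UNIV pscale (\<lambda>x. pure B [x, un B] + pure B [un B, x])"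
    by (rule linear_map_plus[OF tens_vector_space linear_map_pure2[OF vs]])
  note c0 = linear_map_0[OF com subspace_0[OF sub]] and l0 = linear_map_0[OF L subspace_0[OF sub]]
  show ?thesis
  proof (rule subspaceI)
    show "0 \<in> primitives B" using subspace_0[OF sub] c0 l0 by (simp only: primitives_def mem_Collect_eq simp_thms)
    show "x + y \<in> primitives B" if "x \<in> primitives B" "y \<in> primitives B" for x y
      using that linear_map_add[OF com, of x y] linear_map_add[OF L, of x y] subspace_add[OF sub, of x y]
      by (simp only: primitives_def mem_Collect_eq simp_thms)
    show "scl B a x \<in> primitives B" if "x \<in> primitives B" for a x
      using that linear_map_scale[OF com, of x a] linear_map_scale[OF L, of x a] subspace_scale[OF sub, of x a]
      by (simp only: primitives_def mem_Collect_eq simp_thms)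
  qed
qed

section \<open>Homogeneous components of primitive elements, and the space E(V, c)\<close>

context tensor_bialgebra
begin

lemma linear_on_hpart: "linear_on T (carr T) T (hpart V n)"
proof (rule linear_on_UNIV[OF vspace_T vspace_T])
  show "linear_map (carr T) (scl T) (carr T) (scl T) (hpart V n)"
    using linear_map_hpart[of "carr T" V n] hpart_in_tpow[OF vs_V, of _ n] H_in[of _ n]
    unfolding linear_map_def scl_T carr_T by blast
qed

lemma hpart_carr: "x \<in> carr T \<Longrightarrow> hpart V n x \<in> H n"
  unfolding carr_T by (rule hpart_in_tpow[OF vs_V])

definition hpart2 where "hpart2 i j = tmap2 T T (carr T) (carr T) (hpart V i) (hpart V j)"

lemma linear_map_hpart2: "linear_map (tpow T 2) pscale (tpow T 2) pscale (hpart2 i j)"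
  using linear_map_tmap2[OF linear_on_hpart[of i] linear_on_hpart[of j]]
    tmap2_in[OF linear_on_hpart[of i] linear_on_hpart[of j], of "carr T" "carr T"] H_in[OF hpart_carr]
  unfolding linear_map_def tpow_2 hpart2_def by blast

lemma hpart2_pure: "x \<in> carr T \<Longrightarrow> y \<in> carr T \<Longrightarrow> hpart2 i j (pure T [x, y]) = pure T [hpart V i x, hpart V j y]"
  unfolding hpart2_def by (rule tmap2_pure[OF linear_on_hpart linear_on_hpart])

lemma pure2_0: "pure T [0, x] = 0" "pure T [x, 0] = 0"
  using linear_map_0[OF linear_map_pure2(1)[OF vs_T, of UNIV]] linear_map_0[OF linear_map_pure2(2)[OF vs_T, of UNIV]] by blast+

lemma pure2_scale: "pure T [pscale a x, y] = pscale a (pure T [x, y])" "pure T [x, pscale a y] = pscale a (pure T [x, y])"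
  using linear_map_scale[OF linear_map_pure2(1)[OF vs_T, of UNIV]] linear_map_scale[OF linear_map_pure2(2)[OF vs_T, of UNIV]]
  unfolding scl_T by blast+

lemma hpart_un: "hpart V n (un T) = (if n = 0 then un T else 0)"
  using hpart_tpow[OF vs_V un_H, of n] by auto

lemma linear_map_proj_T: "linear_map (tpow T 1) pscale (carr T) pscale (proj T)"
  using linear_map_proj[OF vspace_T] unfolding scl_T .

text \<open>The projection onto degree zero is \<epsilon> followed by the unit, so the outermost
  components of \<Delta>(x) are given by the counit laws.\<close>

lemma
  assumes x: "x \<in> carr T"
  shows hpart2_comul_0_left: "hpart2 0 n (comul T x) = pure T [un T, hpart V n x]"
    and hpart2_comul_0_right: "hpart2 n 0 (comul T x) = pure T [hpart V n x, un T]"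
proof -
  note cl = linear_map_counitT[OF coalgebra_T]
  have px: "proj T (incl T x) = x" using proj_incl[OF vspace_T x] by (simp add: incl_def)
  have sc: "pscale a y \<in> carr T" if "y \<in> carr T" for a y using tens.subspace_scale[OF subspace_T that] .
  have com: "comul T x \<in> tprods T [carr T, carr T]" using linear_map_in[OF linear_map_comul x] unfolding tpow_2 .
  have L: "linear_map (tpow T 2) pscale (tpow T 1) pscale (on_left T 1 1 (counitT T))"
    by (rule linear_map_on_left[OF vs_T cl]) auto
  have "hpart2 0 n (comul T x) = pure T [un T, hpart V n (proj T (on_left T 1 1 (counitT T) (comul T x)))]"
  proof (rule tprods_eqI[OF com linear_map_hpart2[unfolded tpow_2]])
    have L3: "linear_map UNIV pscale UNIV pscale (\<lambda>y. pure T [un T, y])"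
      using linear_map_pure2(2)[OF vs_T, unfolded scl_T] .
    show "linear_map (tprods T [carr T, carr T]) pscale UNIV pscale
      (\<lambda>t. pure T [un T, hpart V n (proj T (on_left T 1 1 (counitT T) t))])"
      unfolding tpow_2[symmetric]
      by (rule linear_map_comp[OF linear_map_comp[OF linear_map_comp[OF L linear_map_proj_T] linear_map_hpart] L3])
    fix w assume "list_all2 (\<in>) w [carr T, carr T]"
    then obtain a b where w: "w = [a, b]" "a \<in> carr T" "b \<in> carr T" by (auto simp: list_all2_Cons2)
    have "proj T (on_left T 1 1 (counitT T) (pure T w)) = pscale (counit T a) b"
      using on_left_counit[OF coalgebra_T w(2,3)] proj_incl[OF vspace_T sc[OF w(3)]] by (simp add: w(1) scl_T)
    then show "hpart2 0 n (pure T w) = pure T [un T, hpart V n (proj T (on_left T 1 1 (counitT T) (pure T w)))]"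
      unfolding w(1) hpart2_pure[OF w(2,3)]
      by (simp only: hpart_0[OF w(2)] linear_map_scale[OF linear_map_hpart[of UNIV] UNIV_I] pure2_scale)
  qed
  moreover have "on_left T 1 1 (counitT T) (comul T x) = incl T x" using coalgebra_T x by (simp add: coalgebra_def)
  ultimately show "hpart2 0 n (comul T x) = pure T [un T, hpart V n x]" using px by simp
  have L: "linear_map (tpow T 2) pscale (tpow T 1) pscale (on_right T 1 1 (counitT T))"
    by (rule linear_map_on_right[OF vs_T cl]) auto
  have "hpart2 n 0 (comul T x) = pure T [hpart V n (proj T (on_right T 1 1 (counitT T) (comul T x))), un T]"
  proof (rule tprods_eqI[OF com linear_map_hpart2[unfolded tpow_2]])
    have L3: "linear_map UNIV pscale UNIV pscale (\<lambda>y. pure T [y, un T])"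
      using linear_map_pure2(1)[OF vs_T, unfolded scl_T] .
    show "linear_map (tprods T [carr T, carr T]) pscale UNIV pscale
      (\<lambda>t. pure T [hpart V n (proj T (on_right T 1 1 (counitT T) t)), un T])"
      unfolding tpow_2[symmetric]
      by (rule linear_map_comp[OF linear_map_comp[OF linear_map_comp[OF L linear_map_proj_T] linear_map_hpart] L3])
    fix w assume "list_all2 (\<in>) w [carr T, carr T]"
    then obtain a b where w: "w = [a, b]" "a \<in> carr T" "b \<in> carr T" by (auto simp: list_all2_Cons2)
    have "proj T (on_right T 1 1 (counitT T) (pure T w)) = pscale (counit T b) a"
      using on_right_counit[OF coalgebra_T w(2,3)] proj_incl[OF vspace_T sc[OF w(2)]] by (simp add: w(1) scl_T)
    then show "hpart2 n 0 (pure T w) = pure T [hpart V n (proj T (on_right T 1 1 (counitT T) (pure T w))), un T]"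
      unfolding w(1) hpart2_pure[OF w(2,3)]
      by (simp only: hpart_0[OF w(3)] linear_map_scale[OF linear_map_hpart[of UNIV] UNIV_I] pure2_scale)
  qed
  moreover have "on_right T 1 1 (counitT T) (comul T x) = incl T x" using coalgebra_T x by (simp add: coalgebra_def)
  ultimately show "hpart2 n 0 (comul T x) = pure T [hpart V n x, un T]" using px by simp
qed

lemma tpart_subset: "tpart n \<subseteq> tpow T 2"
  unfolding tpart_def
proof (rule tens.span_minimal[OF _ tpow_subspace], rule subsetI)
  fix t assume "t \<in> {pure T [x, y] | x y i j. x \<in> H i \<and> y \<in> H j \<and> i + j = n}"
  then obtain x y i j where "t = pure T [x, y]" "x \<in> H i" "y \<in> H j" by blast
  then show "t \<in> tpow T 2" using pure2_tpow H_in by metis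
qed

lemma sum_hpart2:
  assumes "z \<in> tpart m" shows "(\<Sum>i\<le>n. hpart2 i (n - i) z) = (if m = n then z else 0)"
proof -
  have L: "linear_map (tpart m) pscale UNIV pscale (\<lambda>z. \<Sum>i\<le>n. hpart2 i (n - i) z)"
    by (rule linear_map_sum[OF tens_vector_space linear_map_mono[OF linear_map_hpart2 tpart_subset subset_UNIV]])
  have R: "linear_map (tpart m) pscale UNIV pscale (\<lambda>z. if m = n then z else 0)"
    by (simp add: linear_map_def tens.scale_zero_right del: plus_fun_apply)
  show ?thesis
  proof (rule linear_map_eq_on_span[OF L[unfolded tpart_def] R[unfolded tpart_def] _ assms[unfolded tpart_def]])
    fix t assume "t \<in> {pure T [x, y] | x y i j. x \<in> H i \<and> y \<in> H j \<and> i + j = m}"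
    then obtain x y i' j' where t: "t = pure T [x, y]" "x \<in> H i'" "y \<in> H j'" "i' + j' = m" by blast
    have "hpart2 i (n - i) t = (if i' = i then (if j' = n - i then t else 0) else 0)" for i
      unfolding t(1) hpart2_pure[OF H_in[OF t(2)] H_in[OF t(3)]] hpart_tpow[OF vs_V t(2)] hpart_tpow[OF vs_V t(3)]
      by (simp add: pure2_0)
    then have "(\<Sum>i\<le>n. hpart2 i (n - i) t) = (if i' \<le> n then (if j' = n - i' then t else 0) else 0)"
      by (simp add: sum.delta)
    then show "(\<Sum>i\<le>n. hpart2 i (n - i) t) = (if m = n then t else 0)" using t(4) by auto
  qed
qed

text \<open>Homogeneity of \<Delta> in terms of projections: the bidegrees (i, n - i) together make
  up total degree n.\<close>

lemma comul_hpart: assumes x: "x \<in> carr T" shows "comul T (hpart V n x) = (\<Sum>i\<le>n. hpart2 i (n - i) (comul T x))"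
proof -
  have L: "linear_map (carr T) pscale UNIV pscale (\<lambda>x. comul T (hpart V n x))"
    by (rule linear_map_mono[OF linear_map_comp[OF _ linear_map_comul] order_refl subset_UNIV])
      (use linear_on_hpart[of n] in \<open>simp add: linear_on_def scl_T\<close>)
  have R: "linear_map (carr T) pscale UNIV pscale (\<lambda>x. \<Sum>i\<le>n. hpart2 i (n - i) (comul T x))"
    by (rule linear_map_sum[OF tens_vector_space linear_map_mono[OF linear_map_comp[OF linear_map_comul linear_map_hpart2] order_refl subset_UNIV]])
  show ?thesis
  proof (rule linear_map_eq_on_span[OF L[unfolded carr_T tensor_algebra_def] R[unfolded carr_T tensor_algebra_def] _ x[unfolded carr_T tensor_algebra_def]])
    fix t assume "t \<in> {pure V w |w. set w \<subseteq> carr V}"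
    then obtain w where w: "t = pure V w" "set w \<subseteq> carr V" by blast
    have t: "t \<in> H (length w)" using w by (simp add: pure_in_tpow)
    have "comul T 0 = 0" using linear_map_0[OF linear_map_comul tens.subspace_0[OF subspace_T]] .
    then show "comul T (hpart V n t) = (\<Sum>i\<le>n. hpart2 i (n - i) (comul T t))"
      unfolding hpart_tpow[OF vs_V t] sum_hpart2[OF comul_H[OF t]] by simp
  qed
qed

text \<open>The unit has degree zero, so x \<otimes> 1 + 1 \<otimes> x has components only in the
  bidegrees (n, 0) and (0, n).\<close>

lemma hpart_primitive: assumes x: "x \<in> primitives T" shows "hpart V n x \<in> primitives T"
proof -
  have xc: "x \<in> carr T" and cx: "comul T x = pure T [x, un T] + pure T [un T, x]" using x by (auto simp: primitives_def)
  \<comment> \<open>The two ends are added instead of being separate cases, which also covers n = 0,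
    where they coincide.\<close>
  have "hpart2 i (n - i) (comul T x) = (if i = n then pure T [hpart V n x, un T] else 0) + (if i = 0 then pure T [un T, hpart V n x] else 0)"
    if "i \<le> n" for i
    unfolding cx linear_map_add[OF linear_map_hpart2 pure2_tpow[OF xc un_in] pure2_tpow[OF un_in xc]]
      hpart2_pure[OF xc un_in] hpart2_pure[OF un_in xc] hpart_un
    using that by (simp add: pure2_0 del: plus_fun_apply)
  then have "comul T (hpart V n x) = (\<Sum>i\<le>n. (if i = n then pure T [hpart V n x, un T] else 0) + (if i = 0 then pure T [un T, hpart V n x] else 0))"
    unfolding comul_hpart[OF xc] by (intro sum.cong) auto
  also have "\<dots> = pure T [hpart V n x, un T] + pure T [un T, hpart V n x]"
    by (simp add: sum.distrib del: plus_fun_apply)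
  finally show ?thesis using H_in[OF hpart_carr[OF xc]] by (simp add: primitives_def del: plus_fun_apply)
qed

abbreviation E where "E \<equiv> E_space V T"

lemma E_subspace: "tens.subspace E" unfolding E_space_def by (rule tens.subspace_span)

lemma primitives_T_subspace: "tens.subspace (primitives T)"
  using primitives_subspace[OF bialgebra_T] unfolding scl_T .

lemma E_subset: "E \<subseteq> primitives T"
  unfolding E_space_def by (rule tens.span_minimal[OF _ primitives_T_subspace]) auto

lemma E_base: "x \<in> primitives T \<Longrightarrow> x \<in> H n \<Longrightarrow> 2 \<le> n \<Longrightarrow> x \<in> E"
  unfolding E_space_def by (rule tens.span_base) blast

lemma H1_primitive: "H 1 \<subseteq> primitives T"
  using comul_incl H_in by (auto simp: primitives_def)

lemma primitives_carr: "primitives T \<subseteq> carr T" by (auto simp: primitives_def)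

text \<open>After removal of the degree one part, the component in degree zero vanishes by the
  counit, and those in degree at least two are primitive and homogeneous.\<close>

lemma primitive_decomp: assumes x: "x \<in> primitives T" obtains v e where "x = v + e" "v \<in> H 1" "e \<in> E"
proof -
  have xc: "x \<in> carr T" using x primitives_carr by blast
  let ?e = "x - hpart V 1 x"
  note h1 = hpart_carr[OF xc, of 1]
  have ec: "?e \<in> carr T" by (rule tens.subspace_diff[OF subspace_T xc H_in[OF h1]])
  have hp: "hpart V m ?e \<in> E" for m
  proof -
    have d: "hpart V m ?e = hpart V m x - hpart V m (hpart V 1 x)"
      by (rule linear_map_diff[OF linear_map_hpart[of UNIV]]) auto
    consider "m = 0" | "m = 1" | "2 \<le> m" by linarith
    then show ?thesis
    proof cases
      case 1
      have "hpart V m x = 0" unfolding 1 hpart_0[OF xc] counit_primitive[OF bialgebra_T x] by (rule tens.scale_zero_left)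
      then show ?thesis unfolding d hpart_tpow[OF vs_V h1] using tens.subspace_0[OF E_subspace] 1 by (simp del: minus_apply)
    next
      case 2
      then show ?thesis unfolding d hpart_tpow[OF vs_V h1] using tens.subspace_0[OF E_subspace] by (simp del: minus_apply)
    next
      case 3
      then have "hpart V m ?e = hpart V m x" unfolding d hpart_tpow[OF vs_V h1] by (simp del: minus_apply)
      then show ?thesis using E_base[OF hpart_primitive[OF x] hpart_carr[OF xc] 3] by simp
    qed
  qed
  obtain n where "?e \<in> tlow V n" using ec unfolding carr_T by (rule tensor_algebra_tlow)
  then have "?e = (\<Sum>m<n. hpart V m ?e)" by (rule sum_hpart[OF vs_V])
  also have "\<dots> \<in> E" by (rule tens.subspace_sum[OF E_subspace]) (rule hp)
  finally show ?thesis using that[of "hpart V 1 x" ?e] h1 by simp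
qed

text \<open>For a homogeneous primitive generator of E of degree n, \<open>brd_H\<close> first
  places the relevant slot in \<open>H n\<close>, and \<open>brd_primitives_left\<close> or
  \<open>brd_primitives_right\<close> with \<open>Y = H n\<close> then refines it to
  \<open>H n \<inter> primitives T\<close>, which lies in E since n is at least two.\<close>

lemma
  shows brd_E_left: "brd T ` tprods T [E, H 1] \<subseteq> tprods T [H 1, E]"
    and brd_E_right: "brd T ` tprods T [H 1, E] \<subseteq> tprods T [E, H 1]"
proof -
  let ?S = "{x \<in> primitives T. \<exists>n\<ge>2. x \<in> H n}"
  have S: "?S \<subseteq> carr T" using primitives_carr by blast
  have Hs: "module.subspace (scl T) (H n)" for n unfolding scl_T by (rule tpow_subspace)
  have "brd T (pure T [x, y]) \<in> tprods T [H 1, E]" if x: "x \<in> ?S" and y: "y \<in> H 1" for x y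
  proof -
    obtain n where n: "2 \<le> n" "x \<in> H n" using x by blast
    have "brd T (pure T [x, y]) \<in> tprods T [H 1, H n]"
      using brd_H[of n 1] pure_in_tprods[of "[x, y]" "[H n, H 1]" T] n y by auto
    then have "brd T (pure T [x, y]) \<in> tprods T [H 1, H n \<inter> primitives T]"
      using brd_primitives_left[OF bialgebra_T H_subset Hs H_subset _ H_in[OF y]] x by blast
    then show ?thesis using tprods_mono[of "[H 1, H n \<inter> primitives T]" "[H 1, E]" T] E_base n by auto
  qed
  then have "brd T ` tprods T [tens.span ?S, tens.span (H 1)] \<subseteq> tprods T [H 1, E]"
    by (intro tprods_span_into[OF linear_map_brd tprods_subspace tens_vector_space S H_subset])
  then show "brd T ` tprods T [E, H 1] \<subseteq> tprods T [H 1, E]" unfolding span_H E_space_def .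
  have "brd T (pure T [y, x]) \<in> tprods T [E, H 1]" if x: "x \<in> ?S" and y: "y \<in> H 1" for x y
  proof -
    obtain n where n: "2 \<le> n" "x \<in> H n" using x by blast
    have "brd T (pure T [y, x]) \<in> tprods T [H n, H 1]"
      using brd_H[of 1 n] pure_in_tprods[of "[y, x]" "[H 1, H n]" T] n y by auto
    then have "brd T (pure T [y, x]) \<in> tprods T [H n \<inter> primitives T, H 1]"
      using brd_primitives_right[OF bialgebra_T H_subset Hs H_subset _ H_in[OF y]] x by blast
    then show ?thesis using tprods_mono[of "[H n \<inter> primitives T, H 1]" "[E, H 1]" T] E_base n by auto
  qed
  then have "brd T ` tprods T [tens.span (H 1), tens.span ?S] \<subseteq> tprods T [E, H 1]"
    by (intro tprods_span_into[OF linear_map_brd tprods_subspace tens_vector_space H_subset S])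
  then show "brd T ` tprods T [H 1, E] \<subseteq> tprods T [E, H 1]" unfolding span_H E_space_def .
qed

end

section \<open>Quotients\<close>

lemma bialgebra_quotient_algebra_quotient:
  "bialgebra_quotient A J Q p \<Longrightarrow> algebra_quotient A J Q p"
  by (auto simp: bialgebra_quotient_def algebra_quotient_def braided_bialgebra_def braided_algebra_def bialgebra_hom_def)

lemma algebra_quotient_eq_iff:
  assumes A: "vspace A" and Q: "algebra_quotient A J Q p" and xy: "x \<in> carr A" "y \<in> carr A"
  shows "p x = p y \<longleftrightarrow> x - y \<in> J"
proof -
  interpret vector_space "scl A" by (rule vspaceD(1)[OF A])
  have d: "x - y \<in> carr A" using subspace_diff[OF vspaceD(2)[OF A] xy] .
  have "linear_map (carr A) (scl A) (carr Q) (scl Q) p" "kern A p = J"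
    using Q by (auto simp: algebra_quotient_def algebra_hom_def)
  with linear_map_diff[OF this(1) d xy(2)] d show ?thesis by (auto simp: kern_def)
qed

lemma algebra_quotient_unique:
  assumes A: "algebra A" and Q: "algebra_quotient A J Q p" and Q': "algebra_quotient A J Q' p'"
  obtains \<phi> where "algebra_iso Q Q' \<phi>" "\<And>x. x \<in> carr A \<Longrightarrow> \<phi> (p x) = p' x"
proof -
  have V: "vspace A" using algebra_vspace[OF A] .
  interpret vector_space "scl A" by (rule vspaceD(1)[OF V])
  note sub = vspaceD(2)[OF V]
  have p: "linear_map (carr A) (scl A) (carr Q) (scl Q) p" "p (un A) = un Q" "carr Q = p ` carr A"
    "\<And>x y. x \<in> carr A \<Longrightarrow> y \<in> carr A \<Longrightarrow> p (x \<cdot>\<^bsub>A\<^esub> y) = p x \<cdot>\<^bsub>Q\<^esub> p y"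
    using Q by (auto simp: algebra_quotient_def algebra_hom_def)
  have p': "linear_map (carr A) (scl A) (carr Q') (scl Q') p'" "p' (un A) = un Q'" "carr Q' = p' ` carr A"
    "\<And>x y. x \<in> carr A \<Longrightarrow> y \<in> carr A \<Longrightarrow> p' (x \<cdot>\<^bsub>A\<^esub> y) = p' x \<cdot>\<^bsub>Q'\<^esub> p' y"
    using Q' by (auto simp: algebra_quotient_def algebra_hom_def)
  \<comment> \<open>Equality of kernels serves twice: one direction makes \<open>\<phi>\<close> well
    defined, the other makes it injective.\<close>
  have eq: "p x = p y \<longleftrightarrow> p' x = p' y" if "x \<in> carr A" "y \<in> carr A" for x y
    using algebra_quotient_eq_iff[OF V Q that] algebra_quotient_eq_iff[OF V Q' that] by simp
  define \<phi> where "\<phi> = (\<lambda>y. p' (inv_into (carr A) p y))"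
  have \<phi>: "\<phi> (p x) = p' x" if "x \<in> carr A" for x
    unfolding \<phi>_def using eq[of "inv_into (carr A) p (p x)" x] that by (simp add: inv_into_into f_inv_into_f)
  have "linear_map (carr Q) (scl Q) (carr Q') (scl Q') \<phi>"
    unfolding linear_map_def
  proof (intro conjI ballI allI)
    fix y z a assume "y \<in> carr Q" "z \<in> carr Q"
    then obtain u v where uv: "u \<in> carr A" "y = p u" "v \<in> carr A" "z = p v" unfolding p(3) by blast
    show "\<phi> (y + z) = \<phi> y + \<phi> z"
      using \<phi>[OF subspace_add[OF sub uv(1,3)]] linear_map_add[OF p(1) uv(1,3)] linear_map_add[OF p'(1) uv(1,3)] \<phi> uv by simp
  next
    fix y a assume "y \<in> carr Q"
    then obtain u where u: "u \<in> carr A" "y = p u" unfolding p(3) by blast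
    show "\<phi> y \<in> carr Q'" unfolding p'(3) using u \<phi> by blast
    show "\<phi> (scl Q a y) = scl Q' a (\<phi> y)"
      using \<phi>[OF subspace_scale[OF sub u(1)], of a] linear_map_scale[OF p(1) u(1)] linear_map_scale[OF p'(1) u(1)] \<phi> u by simp
  qed
  moreover have "\<phi> (un Q) = un Q'" using \<phi>[OF unit_closed[OF A]] p(2) p'(2) by simp
  moreover have "\<phi> (y \<cdot>\<^bsub>Q\<^esub> z) = \<phi> y \<cdot>\<^bsub>Q'\<^esub> \<phi> z" if yz: "y \<in> carr Q" "z \<in> carr Q" for y z
  proof -
    obtain u v where uv: "u \<in> carr A" "y = p u" "v \<in> carr A" "z = p v" using yz unfolding p(3) by blast
    show ?thesis using \<phi>[OF mult_closed[OF A uv(1,3)]] p(4)[OF uv(1,3)] p'(4)[OF uv(1,3)] \<phi> uv by simp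
  qed
  moreover have "bij_betw \<phi> (carr Q) (carr Q')"
    unfolding bij_betw_def
  proof
    show "inj_on \<phi> (carr Q)" unfolding p(3) using \<phi> eq by (auto simp: inj_on_def)
    show "\<phi> ` carr Q = carr Q'" unfolding p(3) p'(3) using \<phi> by (auto simp: image_image)
  qed
  ultimately have "algebra_iso Q Q' \<phi>" by (simp add: algebra_iso_def algebra_hom_def)
  then show ?thesis using that \<phi> by blast
qed

text \<open>Over a field an injective linear map has a linear left inverse \<open>g\<close>, and
  \<open>g \<otimes> g\<close> is then a left inverse of \<open>f \<otimes> f\<close>.\<close>

lemma inj_on_tmap2:
  assumes f: "linear_on A (carr A) B f" and inj: "inj_on f (carr A)"
  shows "inj_on (tmap2 A B (carr A) (carr A) f f) (tpow A 2)"
proof -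
  have A: "vspace A" and B: "vspace B" and fl: "linear_map (carr A) (scl A) (carr B) (scl B) f"
    using f by (auto simp: linear_on_def)
  obtain g where g: "linear_map UNIV (scl B) (carr A) (scl A) g" "\<And>y. y \<in> f ` carr A \<Longrightarrow> f (g y) = y"
    using linear_section_exists[OF vspaceD(1)[OF A] vspaceD(1)[OF B] vspaceD(2)[OF A] fl] by blast
  have gf: "g (f x) = x" if "x \<in> carr A" for x
    using inj_onD[OF inj g(2)[OF imageI[OF that]] linear_map_in[OF g(1) UNIV_I] that] .
  have gl: "linear_on B (carr B) A g"
    by (rule linear_on_UNIV[OF B A linear_map_mono[OF g(1) subset_UNIV order_refl]])
  have im: "f ` carr A \<subseteq> carr B" using linear_map_in[OF fl] by blast
  have inv: "tmap2 B A (carr B) (carr B) g g (tmap2 A B (carr A) (carr A) f f z) = z" if z: "z \<in> tpow A 2" for z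
  proof -
    note z' = z[unfolded tpow_2]
    show ?thesis
      unfolding tmap2_comp[OF f f gl gl im im z']
      by (rule tmap2_id[OF linear_on_comp[OF f gl im] linear_on_comp[OF f gl im] gf gf z'])
  qed
  show ?thesis by (rule inj_on_inverseI) (rule inv)
qed

text \<open>As \<open>f \<otimes> f\<close> is injective, \<Delta>(x) can be read off from
  \<Delta>(f x). No bialgebra structure on the inverse of \<open>f\<close> has to be
  established.\<close>

lemma primitives_bij:
  assumes A: "braided_bialgebra A" and B: "braided_bialgebra B" and f: "bialgebra_hom A B f"
    and bij: "bij_betw f (carr A) (carr B)"
  shows "primitives B \<subseteq> f ` primitives A"
proof
  fix y assume y: "y \<in> primitives B"
  then obtain x where x: "x \<in> carr A" "y = f x" using bij by (auto simp: primitives_def bij_betw_def)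
  have al: "algebra A" and com: "linear_map (carr A) (scl A) (tpow A 2) pscale (comul A)"
    using A by (auto simp: braided_bialgebra_def braided_algebra_def braided_coalgebra_def coalgebra_def)
  have V: "vspace A" "vspace B"
    using A B by (auto simp: braided_bialgebra_def braided_coalgebra_def coalgebra_def)
  have fl: "linear_on A (carr A) B f"
    using f by (intro linear_on_UNIV[OF V]) (auto simp: bialgebra_hom_def algebra_hom_def)
  note u = unit_closed[OF al]
  let ?F = "tmap2 A B (carr A) (carr A) f f"
  have p: "pure A [x, un A] \<in> tpow A 2" "pure A [un A, x] \<in> tpow A 2" using x u by (simp_all add: pure_in_tpow)
  have "?F (pure A [x, un A] + pure A [un A, x]) = pure B [f x, f (un A)] + pure B [f (un A), f x]"
    using linear_map_add[OF linear_map_tmap2[OF fl fl], folded tpow_2, OF p] tmap2_pure[OF fl fl] x(1) u by simp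
  also have "\<dots> = comul B (f x)" using y x f by (simp add: primitives_def bialgebra_hom_def algebra_hom_def)
  also have "\<dots> = ?F (comul A x)" using f x by (simp add: bialgebra_hom_def)
  finally have "comul A x = pure A [x, un A] + pure A [un A, x]"
    using inj_onD[OF inj_on_tmap2[OF fl]] bij linear_map_in[OF com x(1)] tens.subspace_add[OF tpow_subspace p]
    by (metis bij_betw_def)
  then show "y \<in> f ` primitives A" using x by (simp add: primitives_def)
qed

lemma linear_map_sum_apply:
  assumes f: "linear_map X s Y s' f" and X: "module.subspace s X" "vector_space s" and g: "\<And>j. g j \<in> X"
  shows "f (\<Sum>j\<in>J. g j) = (\<Sum>j\<in>J. f (g j))"
proof -
  interpret vector_space s by fact
  show ?thesis
  proof (induction J rule: infinite_finite_induct)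
    case (insert j J)
    have "sum g J \<in> X" by (rule subspace_sum[OF X(1) g])
    with insert show ?case using linear_map_add[OF f g[of j]] by simp
  qed (use linear_map_0[OF f subspace_0[OF X(1)]] in simp_all)
qed

section \<open>Leading terms and the primitive elements of quotients of T(V, c)\<close>

context tensor_bialgebra
begin

lemma carr_T_induct:
  assumes "x \<in> carr T" "linear_map (carr T) pscale Y s f" "module.subspace s Z" "vector_space s"
    "\<And>n t. t \<in> H n \<Longrightarrow> f t \<in> Z"
  shows "f x \<in> Z"
proof (rule linear_map_span_into[OF assms(2)[unfolded carr_T tensor_algebra_def] assms(3,4) _ assms(1)[unfolded carr_T tensor_algebra_def]])
  fix t assume "t \<in> {pure V w |w. set w \<subseteq> carr V}"
  then obtain w where "t = pure V w" "set w \<subseteq> carr V" by blast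
  then show "f t \<in> Z" using assms(5)[of t "length w"] by (simp add: pure_in_tpow)
qed

lemma carr_T_eqI:
  assumes "x \<in> carr T" "linear_map (carr T) pscale Y pscale f" "linear_map (carr T) pscale Y' pscale g"
    "\<And>n t. t \<in> H n \<Longrightarrow> f t = g t"
  shows "f x = g x"
proof -
  have "f x - g x \<in> {0}"
    by (rule carr_T_induct[OF assms(1) linear_map_minus[OF tens_vector_space linear_map_mono[OF assms(2) order_refl subset_UNIV]
          linear_map_mono[OF assms(3) order_refl subset_UNIV]] tens.subspace_single_0 tens_vector_space])
      (simp only: assms(4) cancel_comm_monoid_add_class.diff_cancel singleton_iff)
  then show ?thesis by simp
qed

lemma linear_map_mult_T:
  "a \<in> carr T \<Longrightarrow> linear_map (carr T) pscale (carr T) pscale (\<lambda>x. a \<cdot>\<^bsub>T\<^esub> x)"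
  "a \<in> carr T \<Longrightarrow> linear_map (carr T) pscale (carr T) pscale (\<lambda>x. x \<cdot>\<^bsub>T\<^esub> a)"
  using linear_map_mult_left[OF algebra_T] linear_map_mult_right[OF algebra_T] unfolding scl_T by blast+

lemma linear_map_hpart_T: "linear_map (carr T) pscale (carr T) pscale (hpart V n)"
  using linear_on_hpart[of n] by (simp add: linear_on_def scl_T)

lemma
  assumes a: "a \<in> H k" and x: "x \<in> carr T"
  shows hpart_mult_left: "hpart V n (a \<cdot>\<^bsub>T\<^esub> x) = (if k \<le> n then a \<cdot>\<^bsub>T\<^esub> hpart V (n - k) x else 0)"
    and hpart_mult_right: "hpart V n (x \<cdot>\<^bsub>T\<^esub> a) = (if k \<le> n then hpart V (n - k) x \<cdot>\<^bsub>T\<^esub> a else 0)"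
proof -
  note m = linear_map_mult_T[OF H_in[OF a]]
  note m0 = linear_map_0[OF m(1) tens.subspace_0[OF subspace_T]] linear_map_0[OF m(2) tens.subspace_0[OF subspace_T]]
  have z: "linear_map (carr T) pscale UNIV pscale (\<lambda>x. if k \<le> n then f x else 0)"
    if "linear_map (carr T) pscale (carr T) pscale f" for f
    using that by (simp add: linear_map_def tens.scale_zero_right del: plus_fun_apply)
  show "hpart V n (a \<cdot>\<^bsub>T\<^esub> x) = (if k \<le> n then a \<cdot>\<^bsub>T\<^esub> hpart V (n - k) x else 0)"
  proof (rule carr_T_eqI[OF x linear_map_comp[OF m(1) linear_map_hpart_T] z[OF linear_map_comp[OF linear_map_hpart_T m(1)]]])
    fix l t assume t: "t \<in> H l"
    show "hpart V n (a \<cdot>\<^bsub>T\<^esub> t) = (if k \<le> n then a \<cdot>\<^bsub>T\<^esub> hpart V (n - k) t else 0)"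
      unfolding hpart_tpow[OF vs_V mult_H[OF a t]] hpart_tpow[OF vs_V t] using m0 by auto
  qed
  show "hpart V n (x \<cdot>\<^bsub>T\<^esub> a) = (if k \<le> n then hpart V (n - k) x \<cdot>\<^bsub>T\<^esub> a else 0)"
  proof (rule carr_T_eqI[OF x linear_map_comp[OF m(2) linear_map_hpart_T] z[OF linear_map_comp[OF linear_map_hpart_T m(2)]]])
    fix l t assume t: "t \<in> H l"
    show "hpart V n (t \<cdot>\<^bsub>T\<^esub> a) = (if k \<le> n then hpart V (n - k) t \<cdot>\<^bsub>T\<^esub> a else 0)"
      unfolding hpart_tpow[OF vs_V mult_H[OF t a]] hpart_tpow[OF vs_V t] using m0 by auto
  qed
qed

lemma tlow_carr: "tlow V n \<subseteq> carr T" unfolding carr_T by (rule tlow_subset)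

lemma tlow_induct:
  assumes "x \<in> tlow V n" "linear_map (carr T) pscale Y s f" "module.subspace s Z" "vector_space s"
    "\<And>m t. m < n \<Longrightarrow> t \<in> H m \<Longrightarrow> f t \<in> Z"
  shows "f x \<in> Z"
proof (rule linear_map_span_into[OF linear_map_mono[OF assms(2) tlow_carr order_refl, unfolded tlow_def] assms(3,4) _ assms(1)[unfolded tlow_def]])
  fix t assume "t \<in> {pure V w |w. length w < n \<and> set w \<subseteq> carr V}"
  then obtain w where "t = pure V w" "length w < n" "set w \<subseteq> carr V" by blast
  then show "f t \<in> Z" using assms(5)[of "length w" t] by (simp add: pure_in_tpow)
qed

lemma
  assumes a: "a \<in> H k" and x: "x \<in> tlow V n"
  shows tlow_mult_left: "a \<cdot>\<^bsub>T\<^esub> x \<in> tlow V (k + n)" and tlow_mult_right: "x \<cdot>\<^bsub>T\<^esub> a \<in> tlow V (k + n)"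
proof -
  have "t \<in> tlow V (k + n)" if "t \<in> H (k + m) \<or> t \<in> H (m + k)" "m < n" for t m
    using that tpow_subset_tlow[of "k + m" "k + n" V] by (auto simp: add.commute)
  then show "a \<cdot>\<^bsub>T\<^esub> x \<in> tlow V (k + n)" "x \<cdot>\<^bsub>T\<^esub> a \<in> tlow V (k + n)"
    using tlow_induct[OF x linear_map_mult_T(1)[OF H_in[OF a]] tlow_subspace tens_vector_space]
      tlow_induct[OF x linear_map_mult_T(2)[OF H_in[OF a]] tlow_subspace tens_vector_space] mult_H[OF a] mult_H[OF _ a]
    by blast+
qed

text \<open>
  The elements \<open>x - \<beta> x\<close> have leading term \<open>x\<close>, so the ideal generated by \<open>E(V, c)\<close> consists of leading
  terms of elements of \<open>I\<close>.
\<close>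

lemma leading_terms:
  assumes I: "ideal T I" and \<beta>: "\<And>e. e \<in> E \<Longrightarrow> g e \<in> H 1 \<and> e - g e \<in> I"
    and x: "x \<in> ideal_generated T E" and xn: "x \<in> H n"
  obtains y where "y \<in> I" "x - y \<in> tlow V n"
proof -
  have Is: "tens.subspace I" and Ic: "I \<subseteq> carr T" and Im: "\<And>a x. a \<in> carr T \<Longrightarrow> x \<in> I \<Longrightarrow> a \<cdot>\<^bsub>T\<^esub> x \<in> I \<and> x \<cdot>\<^bsub>T\<^esub> a \<in> I"
    using I by (auto simp: ideal_def scl_T)
  \<comment> \<open>A homogeneous \<open>x\<close> of degree \<open>n\<close> lies in
    \<open>L n\<close> exactly if it agrees with an element of \<open>I\<close> up to terms of lower
    degree.\<close>
  define L where "L n = {x + y | x y. x \<in> I \<and> y \<in> tlow V n}" for n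
  have Ls: "tens.subspace (L n)" for n unfolding L_def by (rule tens.subspace_sums[OF Is tlow_subspace])
  \<comment> \<open>\<open>M\<close> asks this of every component. It is an ideal that contains
    \<open>E\<close>, hence contains the ideal generated by \<open>E\<close>; elements of that ideal
    need not be written as sums of products.\<close>
  define M where "M = {x \<in> carr T. \<forall>n. hpart V n x \<in> L n}"
  note hl = linear_map_hpart[of UNIV V]
  have Ms: "tens.subspace M"
  proof (rule tens.subspaceI)
    show "0 \<in> M"
      unfolding M_def using tens.subspace_0[OF subspace_T] tens.subspace_0[OF Ls] linear_map_0[OF hl UNIV_I]
      by (simp only: mem_Collect_eq) blast
    show "x + y \<in> M" if "x \<in> M" "y \<in> M" for x y
      using that tens.subspace_add[OF subspace_T] tens.subspace_add[OF Ls] linear_map_add[OF hl UNIV_I UNIV_I]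
      unfolding M_def by (simp only: mem_Collect_eq) blast
    show "pscale a x \<in> M" if "x \<in> M" for a x
      using that tens.subspace_scale[OF subspace_T] tens.subspace_scale[OF Ls] linear_map_scale[OF hl UNIV_I]
      unfolding M_def by (simp only: mem_Collect_eq) blast
  qed
  have L0: "0 \<in> L n" for n by (rule tens.subspace_0[OF Ls])
  have HM: "a \<cdot>\<^bsub>T\<^esub> x \<in> M \<and> x \<cdot>\<^bsub>T\<^esub> a \<in> M" if a: "a \<in> H k" and x: "x \<in> M" for a k x
  proof -
    have xc: "x \<in> carr T" and xh: "\<And>n. hpart V n x \<in> L n" using x by (auto simp: M_def)
    note ac = H_in[OF a]
    have "hpart V n (a \<cdot>\<^bsub>T\<^esub> x) \<in> L n \<and> hpart V n (x \<cdot>\<^bsub>T\<^esub> a) \<in> L n" for n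
    proof (cases "k \<le> n")
      case True
      obtain y t where yt: "hpart V (n - k) x = y + t" "y \<in> I" "t \<in> tlow V (n - k)" using xh[of "n - k"] by (auto simp: L_def)
      have yc: "y \<in> carr T" "t \<in> carr T" using yt Ic tlow_carr by auto
      have "a \<cdot>\<^bsub>T\<^esub> t \<in> tlow V n" "t \<cdot>\<^bsub>T\<^esub> a \<in> tlow V n"
        using tlow_mult_left[OF a yt(3)] tlow_mult_right[OF a yt(3)] True by auto
      then show ?thesis
        unfolding hpart_mult_left[OF a xc] hpart_mult_right[OF a xc] yt(1)
        using linear_map_add[OF linear_map_mult_T(1)[OF ac] yc] linear_map_add[OF linear_map_mult_T(2)[OF ac] yc] Im[OF ac yt(2)] True
        unfolding L_def by auto
    next
      case False
      then show ?thesis unfolding hpart_mult_left[OF a xc] hpart_mult_right[OF a xc] using L0 by simp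
    qed
    then show ?thesis using mult_closed[OF algebra_T] ac xc by (simp add: M_def)
  qed
  have "ideal T M"
    unfolding ideal_def scl_T
  proof (intro conjI ballI)
    show "tens.subspace M" by (rule Ms)
    show "M \<subseteq> carr T" by (auto simp: M_def)
    fix a x assume a: "a \<in> carr T" and x: "x \<in> M"
    have xc: "x \<in> carr T" using x by (simp add: M_def)
    show "a \<cdot>\<^bsub>T\<^esub> x \<in> M" by (rule carr_T_induct[OF a linear_map_mult_T(2)[OF xc] Ms tens_vector_space]) (use HM x in blast)
    show "x \<cdot>\<^bsub>T\<^esub> a \<in> M" by (rule carr_T_induct[OF a linear_map_mult_T(1)[OF xc] Ms tens_vector_space]) (use HM x in blast)
  qed
  moreover have "E \<subseteq> M"
    unfolding E_space_def
  proof (rule tens.span_minimal[OF _ Ms], rule subsetI)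
    fix e assume e: "e \<in> {x \<in> primitives T. \<exists>n\<ge>2. x \<in> H n}"
    then obtain m where m: "2 \<le> m" "e \<in> H m" by blast
    have eE: "e \<in> E" using E_base[OF _ m(2,1)] e by blast
    \<comment> \<open>Since \<open>e\<close> has degree at least two, \<open>g e\<close>, of degree
      one, counts as a lower term.\<close>
    have "g e \<in> tlow V m" using tpow_subset_tlow[of 1 m V] \<beta>[OF eE] m(1) by auto
    then have "(e - g e) + g e \<in> L m" unfolding L_def using \<beta>[OF eE] by blast
    then have "e \<in> L m" by (simp only: diff_add_cancel)
    then have "hpart V n e \<in> L n" for n unfolding hpart_tpow[OF vs_V m(2)] using L0 by (cases "m = n") auto
    then show "e \<in> M" using H_in[OF m(2)] by (simp add: M_def)
  qed
  ultimately have "x \<in> M" using x unfolding ideal_generated_def by blast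
  then have "hpart V n x \<in> L n" by (simp add: M_def)
  then have "x \<in> L n" unfolding hpart_tpow[OF vs_V xn] by simp
  then obtain y t where "x = y + t" "y \<in> I" "t \<in> tlow V n" by (auto simp: L_def)
  then show ?thesis using that[of y] by (simp add: algebra_simps)
qed

text \<open>
  Passing to leading terms: if \<open>f x\<close> is primitive and \<open>x\<close> has degree \<open>n \<ge> 2\<close>, then the maps \<open>\<sigma>\<close> taking
  the class of \<open>x \<in> T\<^sub>\<le>\<^sub>i\<close> to the class of its \<open>i\<close>-th component in \<open>N\<close> show that the mixed components
  of \<open>\<Delta>\<close> of the leading term of \<open>x\<close> vanish in \<open>N \<otimes> N\<close>. So the leading term is primitive in \<open>N\<close>.
\<close>

lemma primitive_leading_term:
  assumes Q: "bialgebra_quotient T I Q f" and inj: "\<And>x. x \<in> H 1 \<Longrightarrow> f x = 0 \<Longrightarrow> x = 0"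
    and N: "bialgebra_quotient T J N \<pi>" and J: "J = tens.span (\<Union>n\<in>{2..}. J \<inter> H n)" "primitives N = \<pi> ` H 1"
    and x: "x \<in> tlow V (Suc n)" and fx: "f x = 0 \<or> 2 \<le> n \<and> f x \<in> primitives Q"
  shows "hpart V n x \<in> J"
  using x fx
proof (induction n arbitrary: x rule: less_induct)
  case (less n)
  note aN = bialgebra_quotient_algebra_quotient[OF N]
  note Jeq = algebra_quotient_eq_iff[OF vspace_T aN]
  have BQ: "braided_bialgebra Q" and BN: "braided_bialgebra N" and hf: "bialgebra_hom T Q f" and h\<pi>: "bialgebra_hom T N \<pi>"
    and cQ: "carr Q = f ` carr T"
    using Q N by (auto simp: bialgebra_quotient_def)
  have vQ: "vspace Q" and vN: "vspace N"
    using BQ BN by (auto simp: braided_bialgebra_def braided_coalgebra_def coalgebra_def)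
  have fl: "linear_map (carr T) pscale (carr Q) (scl Q) f" and \<pi>l: "linear_map (carr T) pscale (carr N) (scl N) \<pi>"
    using hf h\<pi> by (auto simp: bialgebra_hom_def algebra_hom_def scl_T)
  have fo: "linear_on T (carr T) Q f" and \<pi>o: "linear_on T (carr T) N \<pi>"
    using linear_on_UNIV[OF vspace_T vQ] linear_on_UNIV[OF vspace_T vN] fl \<pi>l by (simp_all add: scl_T)
  have fu: "f (un T) = un Q" and \<pi>u: "\<pi> (un T) = un N" using hf h\<pi> by (auto simp: bialgebra_hom_def algebra_hom_def)
  note z = tens.subspace_0[OF subspace_T]
  note \<pi>0 = linear_map_0[OF \<pi>l z]
  have Js: "tens.subspace J" by (subst J(1)) (rule tens.subspace_span)
  have xc: "x \<in> carr T" using less.prems(1) tlow_carr by blast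
  note hx = hpart_carr[OF xc]
  interpret N: vector_space "scl N" by (rule vspaceD(1)[OF vN])
  interpret Q: vector_space "scl Q" by (rule vspaceD(1)[OF vQ])
  have fP: "f x \<in> primitives Q"
    using less.prems(2) Q.subspace_0[OF primitives_subspace[OF BQ]] by auto
  \<comment> \<open>\<open>f\<close> preserves counits and the counit kills the primitive element
    \<open>f x\<close>, so \<open>x\<close> has no part in degree zero.\<close>
  have "counit T x = counit Q (f x)" using hf xc by (simp add: bialgebra_hom_def)
  then have "hpart V 0 x = 0" unfolding hpart_0[OF xc] counit_primitive[OF BQ fP] by (simp add: tens.scale_zero_left)
  then have h0: "hpart V 0 x \<in> J" using tens.subspace_0[OF Js] by simp
  have N0: "pure N [0, y] = 0" "pure N [y, 0] = 0" for y
    using linear_map_0[OF linear_map_pure2(1)[OF N.vector_space_axioms, of UNIV]]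
      linear_map_0[OF linear_map_pure2(2)[OF N.vector_space_axioms, of UNIV]] by blast+
  \<comment> \<open>Degree one is reached with \<open>f x = 0\<close> only, and there injectivity of
    \<open>f\<close> on V is used: a primitive \<open>f x\<close> in degree one would allow any
    element of V.\<close>
  consider "n = 0" | "n = 1" "f x = 0" | "2 \<le> n" using less.prems(2) by linarith
  then show ?case
  proof cases
    case 1
    then show ?thesis using h0 by simp
  next
    case 2
    have "x = (\<Sum>m<Suc 1. hpart V m x)" using sum_hpart[OF vs_V] less.prems(1) 2(1) by blast
    then have "x = hpart V 1 x" using \<open>hpart V 0 x = 0\<close> by (simp del: plus_fun_apply)
    then have "x = 0" using inj[of x] hx[of 1] 2(2) by simp
    then have "hpart V n x = 0" using linear_map_0[OF linear_map_hpart[of UNIV V n] UNIV_I] by blast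
    then show ?thesis using tens.subspace_0[OF Js] by (simp only:)
  next
    case 3
    have sig: "\<exists>\<sigma>. linear_on Q (carr Q) N \<sigma> \<and> (\<forall>x\<in>tlow V (Suc i). \<sigma> (f x) = \<pi> (hpart V i x))" if i: "i < n" for i
    proof -
      \<comment> \<open>Linear representatives in \<open>tlow V (Suc i)\<close> extend
        \<open>\<sigma>\<close> to all of \<open>Q\<close>; its values are meaningful only on the
        image of \<open>tlow V (Suc i)\<close>.\<close>
      obtain \<tau> where \<tau>: "linear_map UNIV (scl Q) (tlow V (Suc i)) pscale \<tau>"
        "\<And>y. y \<in> f ` tlow V (Suc i) \<Longrightarrow> f (\<tau> y) = y"
        using linear_section_exists[OF tens_vector_space Q.vector_space_axioms tlow_subspace
            linear_map_mono[OF fl tlow_carr order_refl]] by blast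
      have "linear_on Q (carr Q) N (\<lambda>y. \<pi> (hpart V i (\<tau> y)))"
        by (rule linear_on_UNIV[OF vQ vN linear_map_comp[OF linear_map_comp[OF linear_map_mono[OF \<tau>(1) subset_UNIV tlow_carr]
                linear_map_hpart_T] \<pi>l]])
      moreover have "\<pi> (hpart V i (\<tau> (f y))) = \<pi> (hpart V i y)" if y: "y \<in> tlow V (Suc i)" for y
      proof -
        have ty: "\<tau> (f y) \<in> tlow V (Suc i)" by (rule linear_map_in[OF \<tau>(1) UNIV_I])
        have d: "\<tau> (f y) - y \<in> tlow V (Suc i)" by (rule tens.subspace_diff[OF tlow_subspace ty y])
        have "f (\<tau> (f y) - y) = f (\<tau> (f y)) - f y"
          by (rule linear_map_diff[OF fl]) (use d y tlow_carr in blast)+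
        then have "f (\<tau> (f y) - y) = 0" using \<tau>(2) y by simp
        \<comment> \<open>This is why the claim includes the case \<open>f x = 0\<close>: two
          representatives of one class differ by a relation, whose component in degree i < n lies in
          \<open>J\<close> by induction, so \<open>\<sigma>\<close> does not depend on the
          representative.\<close>
        then have "hpart V i (\<tau> (f y) - y) \<in> J" using less.IH[OF i d] by blast
        then have "hpart V i (\<tau> (f y)) - hpart V i y \<in> J"
          using linear_map_diff[OF linear_map_hpart[of UNIV], of "\<tau> (f y)" y V i] by simp
        then show ?thesis using Jeq H_in[OF hpart_carr] ty y tlow_carr by blast
      qed
      ultimately show ?thesis by blast
    qed
    let ?P = "tmap2 T N (carr T) (carr T) \<pi> \<pi>"
    have Pl: "linear_map (tpow T 2) pscale UNIV pscale ?P" using linear_map_tmap2[OF \<pi>o \<pi>o] by (simp add: tpow_2)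
    have com: "comul T x \<in> tprods T [carr T, carr T]" using linear_map_in[OF linear_map_comul xc] by (simp add: tpow_2)
    have imh: "hpart V k ` carr T \<subseteq> carr T" for k using H_in[OF hpart_carr] by blast
    have imf: "f ` carr T \<subseteq> carr Q" using cQ by simp
    have mid: "?P (hpart2 i (n - i) (comul T x)) = 0" if i: "0 < i" "i < n" for i
    proof -
      define j where "j = n - i"
      have j: "0 < j" "j < n" "i + j = n" using i by (auto simp: j_def)
      obtain \<sigma> where \<sigma>: "linear_on Q (carr Q) N \<sigma>" "\<And>x. x \<in> tlow V (Suc i) \<Longrightarrow> \<sigma> (f x) = \<pi> (hpart V i x)"
        using sig[OF i(2)] by blast
      obtain \<sigma>' where \<sigma>': "linear_on Q (carr Q) N \<sigma>'" "\<And>x. x \<in> tlow V (Suc j) \<Longrightarrow> \<sigma>' (f x) = \<pi> (hpart V j x)"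
        using sig[OF j(2)] by blast
      note ph = linear_on_comp[OF linear_on_hpart \<pi>o imh]
      note sf = linear_on_comp[OF fo \<sigma>(1) imf] and sf' = linear_on_comp[OF fo \<sigma>'(1) imf]
      let ?F = "tmap2 T N (carr T) (carr T) (\<lambda>x. \<pi> (hpart V i x)) (\<lambda>x. \<pi> (hpart V j x))"
      let ?S = "tmap2 T N (carr T) (carr T) (\<lambda>x. \<sigma> (f x)) (\<lambda>x. \<sigma>' (f x))"
      have Fl: "linear_map (tpow T 2) pscale UNIV pscale ?F" and Sl: "linear_map (tpow T 2) pscale UNIV pscale ?S"
        using linear_map_tmap2[OF ph ph] linear_map_tmap2[OF sf sf'] by (simp_all add: tpow_2)
      have low: "t \<in> tlow V (Suc k)" if "t \<in> H l" "l \<le> k" for t l k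
        using tpow_subset_tlow[of l "Suc k" V] that by auto
      have FS: "?F t = ?S t" if t: "t \<in> tpart m" and m: "m < Suc n" for t m
      proof (rule linear_map_eq_on_span[OF linear_map_mono[OF Fl tpart_subset order_refl, unfolded tpart_def]
            linear_map_mono[OF Sl tpart_subset order_refl, unfolded tpart_def] _ t[unfolded tpart_def]])
        fix u assume "u \<in> {pure T [x, y] | x y i j. x \<in> H i \<and> y \<in> H j \<and> i + j = m}"
        then obtain a b i' j' where u: "u = pure T [a, b]" "a \<in> H i'" "b \<in> H j'" "i' + j' = m" by blast
        note ab = H_in[OF u(2)] H_in[OF u(3)]
        have zr: "\<pi> (hpart V j b) = 0 \<and> \<sigma>' (f b) = 0" if "j' < j"
          using \<sigma>'(2)[OF low[OF u(3)]] that \<pi>0 hpart_tpow[OF vs_V u(3), of j] by simp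
        have zl: "\<pi> (hpart V i a) = 0 \<and> \<sigma> (f a) = 0" if "i' < i"
          using \<sigma>(2)[OF low[OF u(2)]] that \<pi>0 hpart_tpow[OF vs_V u(2), of i] by simp
        \<comment> \<open>Because i' + j' \<le> i + j, a degree that exceeds its bound forces the
          other one below its bound. There the other factor vanishes on both sides, so the arbitrary
          values of \<open>\<sigma>\<close> and \<open>\<sigma>'\<close> do not enter.\<close>
        consider "i' \<le> i" "j' \<le> j" | "j' < j" | "i' < i" using u(4) m j(3) by linarith
        then have "pure N [\<pi> (hpart V i a), \<pi> (hpart V j b)] = pure N [\<sigma> (f a), \<sigma>' (f b)]"
        proof cases
          case 1
          then show ?thesis using \<sigma>(2)[OF low[OF u(2)]] \<sigma>'(2)[OF low[OF u(3)]] by simp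
        qed (use zl zr in \<open>simp_all add: N0\<close>)
        then show "?F u = ?S u" unfolding u(1) tmap2_pure[OF ph ph ab] tmap2_pure[OF sf sf' ab] .
      qed
      have "?F (comul T t) - ?S (comul T t) \<in> {0}" if "m < Suc n" "t \<in> H m" for t m
        unfolding FS[OF comul_H[OF that(2)] that(1)] by (simp only: cancel_comm_monoid_add_class.diff_cancel singleton_iff)
      then have "?F (comul T x) - ?S (comul T x) \<in> {0}"
        by (rule tlow_induct[OF less.prems(1) linear_map_minus[OF tens_vector_space linear_map_comp[OF linear_map_comul Fl]
                linear_map_comp[OF linear_map_comul Sl]] tens.subspace_single_0 tens_vector_space])
      then have eq: "?F (comul T x) = ?S (comul T x)" by simp
      \<comment> \<open>The unit has degree zero while i and j are positive, so
        \<open>\<sigma> \<otimes> \<sigma>'\<close> kills both summands of f x \<otimes> 1 + 1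
        \<otimes> f x.\<close>
      have "hpart V i (un T) = 0" "hpart V j (un T) = 0" using i(1) j(1) by (simp_all add: hpart_un)
      then have s0: "\<sigma> (un Q) = 0" "\<sigma>' (un Q) = 0"
        using \<sigma>(2)[OF low[OF un_H le0]] \<sigma>'(2)[OF low[OF un_H le0]] unfolding fu by (simp_all only: \<pi>0)
      have uQ: "un Q \<in> carr Q" unfolding cQ fu[symmetric] by (rule imageI[OF un_in])
      have fxc: "f x \<in> carr Q" unfolding cQ by (rule imageI[OF xc])
      have pQ: "pure Q [f x, un Q] \<in> tpow Q 2" "pure Q [un Q, f x] \<in> tpow Q 2" using uQ fxc by (simp_all add: pure_in_tpow)
      have "?P (hpart2 i j (comul T x)) = ?F (comul T x)"
        unfolding hpart2_def by (rule tmap2_comp[OF linear_on_hpart linear_on_hpart \<pi>o \<pi>o imh imh com])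
      also have "\<dots> = tmap2 Q N (carr Q) (carr Q) \<sigma> \<sigma>' (tmap2 T Q (carr T) (carr T) f f (comul T x))"
        unfolding eq by (rule tmap2_comp[OF fo fo \<sigma>(1) \<sigma>'(1) imf imf com, symmetric])
      also have "tmap2 T Q (carr T) (carr T) f f (comul T x) = pure Q [f x, un Q] + pure Q [un Q, f x]"
        using hf xc fP by (simp add: bialgebra_hom_def primitives_def)
      also have "tmap2 Q N (carr Q) (carr Q) \<sigma> \<sigma>' (pure Q [f x, un Q] + pure Q [un Q, f x]) =
          pure N [\<sigma> (f x), \<sigma>' (un Q)] + pure N [\<sigma> (un Q), \<sigma>' (f x)]"
        using linear_map_add[OF linear_map_tmap2[OF \<sigma>(1) \<sigma>'(1), folded tpow_2] pQ] tmap2_pure[OF \<sigma>(1) \<sigma>'(1)] uQ fxc by simp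
      also have "\<dots> = 0" unfolding s0 N0 by simp
      finally show ?thesis by (simp add: j_def)
    qed
    have hc: "hpart2 i k (comul T x) \<in> tpow T 2" for i k
      by (rule linear_map_in[OF linear_map_hpart2 linear_map_in[OF linear_map_comul xc]])
    have xn: "hpart V n x \<in> carr T" by (rule H_in[OF hx])
    have "comul N (\<pi> (hpart V n x)) = ?P (comul T (hpart V n x))"
      using h\<pi> xn by (simp add: bialgebra_hom_def)
    also have "\<dots> = (\<Sum>i\<le>n. ?P (hpart2 i (n - i) (comul T x)))"
      unfolding comul_hpart[OF xc] by (rule linear_map_sum_apply[OF Pl tpow_subspace tens_vector_space hc])
    also have "\<dots> = (\<Sum>i\<le>n. (if i = n then pure N [\<pi> (hpart V n x), un N] else 0) + (if i = 0 then pure N [un N, \<pi> (hpart V n x)] else 0))"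
    proof (rule sum.cong[OF refl])
      fix i assume "i \<in> {..n}"
      then consider "i = 0" | "i = n" | "0 < i" "i < n" by fastforce
      then show "?P (hpart2 i (n - i) (comul T x)) = (if i = n then pure N [\<pi> (hpart V n x), un N] else 0) + (if i = 0 then pure N [un N, \<pi> (hpart V n x)] else 0)"
      proof cases
        case 1
        then show ?thesis using 3 tmap2_pure[OF \<pi>o \<pi>o un_in xn] by (simp add: hpart2_comul_0_left[OF xc] \<pi>u)
      next
        case 2
        then show ?thesis using 3 tmap2_pure[OF \<pi>o \<pi>o xn un_in] by (simp add: hpart2_comul_0_right[OF xc] \<pi>u)
      next
        case 3
        then show ?thesis using mid[OF 3] by simp
      qed
    qed
    also have "\<dots> = pure N [\<pi> (hpart V n x), un N] + pure N [un N, \<pi> (hpart V n x)]"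
      by (simp add: sum.distrib del: plus_fun_apply)
    finally have "\<pi> (hpart V n x) \<in> primitives N" using linear_map_in[OF \<pi>l xn] by (simp add: primitives_def)
    then obtain v where v: "v \<in> H 1" "\<pi> (hpart V n x) = \<pi> v" unfolding J(2) by blast
    then have "hpart V n x - v \<in> J" using Jeq[OF xn H_in[OF v(1)]] by simp
    \<comment> \<open>\<open>J\<close> is homogeneous, so the degree n component of
      \<open>hpart V n x - v\<close> stays in \<open>J\<close>; as n is at least two, that component
      is \<open>hpart V n x\<close>.\<close>
    moreover have "hpart V n t \<in> J" if "t \<in> J" for t
    proof -
      let ?S = "\<Union>n\<in>{2..}. J \<inter> H n"
      have t: "t \<in> tens.span ?S" using that J(1) by simp
      show ?thesis
      proof (rule linear_map_span_into[OF linear_map_hpart Js tens_vector_space _ t])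
        fix u assume "u \<in> ?S"
        then obtain m where u: "u \<in> J" "u \<in> H m" by blast
        show "hpart V n u \<in> J" unfolding hpart_tpow[OF vs_V u(2)] using u(1) tens.subspace_0[OF Js] by simp
      qed
    qed
    ultimately have "hpart V n (hpart V n x - v) \<in> J" by blast
    moreover have "hpart V n (hpart V n x - v) = hpart V n (hpart V n x) - hpart V n v"
      by (rule linear_map_diff[OF linear_map_hpart[of UNIV]]) auto
    ultimately show ?thesis
      using hpart_tpow[OF vs_V hx[of n], of n] hpart_tpow[OF vs_V v(1), of n] 3 by simp
  qed
qed

text \<open>\<open>lead\<close> is the counterpart of \<open>primitive_leading_term\<close>: every
  homogeneous element of \<open>J\<close> is a leading term of \<open>I\<close>. With it a leading
  term in \<open>J\<close> can be removed by subtracting an element of \<open>I\<close>.\<close>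

lemma primitives_quotient:
  assumes Q: "bialgebra_quotient T I Q f" and inj: "\<And>x. x \<in> H 1 \<Longrightarrow> f x = 0 \<Longrightarrow> x = 0"
    and N: "bialgebra_quotient T J N \<pi>" and J: "J = tens.span (\<Union>n\<in>{2..}. J \<inter> H n)" "primitives N = \<pi> ` H 1"
    and lead: "\<And>n x. x \<in> J \<Longrightarrow> x \<in> H n \<Longrightarrow> \<exists>y\<in>I. x - y \<in> tlow V n"
  shows "primitives Q \<subseteq> f ` H 1"
proof
  have BQ: "braided_bialgebra Q" and hf: "bialgebra_hom T Q f" and cQ: "carr Q = f ` carr T" and kI: "kern T f = I"
    using Q by (auto simp: bialgebra_quotient_def)
  have fl: "linear_map (carr T) pscale (carr Q) (scl Q) f" using hf by (auto simp: bialgebra_hom_def algebra_hom_def scl_T)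
  have main: "f x \<in> f ` H 1" if "x \<in> tlow V k" "f x \<in> primitives Q" for k x
    using that
  proof (induction k arbitrary: x)
    case 0
    then have "x = 0" by (simp add: tlow_0)
    then show ?case using tens.subspace_0[OF tpow_subspace] by blast
  next
    case (Suc n)
    have xc: "x \<in> carr T" using Suc.prems(1) tlow_carr by blast
    have "counit T x = counit Q (f x)" using hf xc by (simp add: bialgebra_hom_def)
    then have h0: "hpart V 0 x = 0"
      unfolding hpart_0[OF xc] counit_primitive[OF BQ Suc.prems(2)] by (simp add: tens.scale_zero_left)
    show ?case
    proof (cases "2 \<le> n")
      case True
      let ?h = "hpart V n x"
      have "?h \<in> J" by (rule primitive_leading_term[OF Q inj N J Suc.prems(1)]) (use True Suc.prems(2) in auto)
      then obtain y where y: "y \<in> I" "?h - y \<in> tlow V n" using lead hpart_carr[OF xc] by blast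
      have yc: "y \<in> carr T" "f y = 0" using y(1) kI by (auto simp: kern_def)
      have "(x - ?h) + (?h - y) \<in> tlow V n"
        by (rule tens.subspace_add[OF tlow_subspace diff_hpart_tlow[OF vs_V Suc.prems(1)] y(2)])
      \<comment> \<open>The top component has been traded for lower terms, while the class in
        \<open>Q\<close> is unchanged.\<close>
      then have t: "x - y \<in> tlow V n" by simp
      have eq: "f (x - y) = f x" using linear_map_diff[OF fl _ yc(1)] t tlow_carr yc(2) by force
      show ?thesis using Suc.IH[OF t] Suc.prems(2) unfolding eq by blast
    next
      case False
      have "x \<in> tlow V (Suc 1)" using Suc.prems(1) tlow_mono[of "Suc n" "Suc 1" V] False by auto
      then have "x = (\<Sum>m<Suc 1. hpart V m x)" by (rule sum_hpart[OF vs_V])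
      then have "x = hpart V 1 x" using h0 by (simp del: plus_fun_apply)
      then show ?thesis using hpart_carr[OF xc, of 1] by auto
    qed
  qed
  fix y assume y: "y \<in> primitives Q"
  then obtain x where x: "x \<in> carr T" "y = f x" using cQ by (auto simp: primitives_def)
  obtain k where "x \<in> tlow V k" using x(1) unfolding carr_T by (rule tensor_algebra_tlow)
  then show "y \<in> f ` H 1" using main y x(2) by blast
qed

end

section \<open>Restriction of the bracket to E(V, c)\<close>

context tensor_bialgebra
begin

lemma subspaces_T: "module.subspace (scl T) (H n)" "module.subspace (scl T) E" "module.subspace (scl T) (primitives T)"
  unfolding scl_T by (rule tpow_subspace E_subspace primitives_T_subspace)+

lemma linear_on_proj: "linear_on T (H 1) V (proj V)"
  by (rule linear_onI[OF vspace_T vspace_V subspaces_T(1) H_subset]) (use linear_map_proj[OF vspace_V] in \<open>simp add: scl_T\<close>)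

lemma incl_proj: "x \<in> H 1 \<Longrightarrow> incl V (proj V x) = x"
proof -
  assume "x \<in> H 1"
  then obtain v where v: "v \<in> carr V" "x = incl V v" unfolding incl_carr[symmetric] by blast
  show ?thesis unfolding v(2) using proj_incl[OF vspace_V v(1)] by (simp add: incl_def)
qed

text \<open>The bracket axioms are equations in T \<otimes> T, the claims are equations in V
  \<otimes> V. The map \<open>incl V \<otimes> incl V\<close> is injective and intertwines c with
  c_T, so the axioms, restricted from P(T) to E, can be pulled back along it.\<close>

lemma bracket_restricts:
  assumes b: "linear_map (primitives T) pscale (carr V) (scl V) b" and \<beta>: "\<And>x. x \<in> E \<Longrightarrow> \<beta> x = b x"
    and ib: "\<And>x. x \<in> primitives T \<Longrightarrow> ib x = incl V (b x)"
  shows "\<lbrakk>\<forall>z\<in>tprods T [primitives T, H 1]. brd T (tmap2 T T (primitives T) (H 1) ib id z) = tmap2 T T (H 1) (primitives T) id ib (brd T z);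
      z \<in> tprods T [E, H 1]\<rbrakk> \<Longrightarrow> c (tmap2 T V E (H 1) \<beta> (proj V) z) = tmap2 T V (H 1) E (proj V) \<beta> (brd T z)" (is "\<lbrakk>?A; ?zA\<rbrakk> \<Longrightarrow> ?C")
    and "\<lbrakk>\<forall>z\<in>tprods T [H 1, primitives T]. brd T (tmap2 T T (H 1) (primitives T) id ib z) = tmap2 T T (primitives T) (H 1) ib id (brd T z);
      z \<in> tprods T [H 1, E]\<rbrakk> \<Longrightarrow> c (tmap2 T V (H 1) E (proj V) \<beta> z) = tmap2 T V E (H 1) \<beta> (proj V) (brd T z)" (is "\<lbrakk>?B; ?zB\<rbrakk> \<Longrightarrow> ?D")
proof -
  let ?J = "tmap2 V T (carr V) (carr V) (incl V) (incl V)"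
  have Jinj: "inj_on ?J (H 2)"
    by (rule inj_on_tmap2[OF linear_on_incl]) (use bij_betw_incl[OF vspace_V] in \<open>simp add: bij_betw_def\<close>)
  have bo: "linear_on T (primitives T) V b"
    by (rule linear_onI[OF vspace_T vspace_V subspaces_T(3) primitives_carr]) (use b in \<open>simp add: scl_T\<close>)
  have "linear_map E pscale (carr V) (scl V) \<beta>"
    using linear_map_mono[OF b E_subset order_refl] \<beta> tens.subspace_add[OF E_subspace] tens.subspace_scale[OF E_subspace]
    by (simp add: linear_map_def del: plus_fun_apply)
  then have \<beta>o: "linear_on T E V \<beta>"
    by (intro linear_onI[OF vspace_T vspace_V subspaces_T(2) order_trans[OF E_subset primitives_carr]]) (simp add: scl_T)
  note im\<beta> = linear_map_in[OF \<open>linear_map E pscale (carr V) (scl V) \<beta>\<close>]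
  note bi = linear_on_comp[OF bo linear_on_incl] and \<beta>i = linear_on_comp[OF \<beta>o linear_on_incl] and pi = linear_on_comp[OF linear_on_proj linear_on_incl]
  have ims: "b ` primitives T \<subseteq> carr V" "\<beta> ` E \<subseteq> carr V" "proj V ` H 1 \<subseteq> carr V"
    using linear_map_in[OF b] im\<beta> linear_map_in[OF linear_map_proj[OF vspace_V]] by auto
  have ibo: "linear_on T (primitives T) T ib"
  proof (rule linear_onI[OF vspace_T vspace_T subspaces_T(3) primitives_carr])
    show "linear_map (primitives T) (scl T) (carr T) (scl T) ib"
      using bi[OF ims(1)] ib tens.subspace_add[OF primitives_T_subspace] tens.subspace_scale[OF primitives_T_subspace]
      by (simp add: linear_on_def linear_map_def scl_T del: plus_fun_apply)
  qed
  have ido: "linear_on T (H 1) T id"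
    by (rule linear_onI[OF vspace_T vspace_T subspaces_T(1) H_subset])
      (rule linear_map_mono[OF linear_map_id(2) order_refl H_subset])
  note \<beta>i' = \<beta>i[OF ims(2)] and pi' = pi[OF ims(3)]
  have e1: "tmap2 T T (primitives T) (H 1) ib id z = ?J (tmap2 T V E (H 1) \<beta> (proj V) z)" if "z \<in> tprods T [E, H 1]" for z
    unfolding tmap2_comp[OF \<beta>o linear_on_proj linear_on_incl linear_on_incl ims(2,3) that]
    by (rule tmap2_cong[OF ibo ido \<beta>i' pi' E_subset order_refl _ _ that]) (use ib \<beta> E_subset incl_proj in auto)
  have e2: "tmap2 T T (H 1) (primitives T) id ib z = ?J (tmap2 T V (H 1) E (proj V) \<beta> z)" if "z \<in> tprods T [H 1, E]" for z
    unfolding tmap2_comp[OF linear_on_proj \<beta>o linear_on_incl linear_on_incl ims(3,2) that]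
    by (rule tmap2_cong[OF ido ibo pi' \<beta>i' order_refl E_subset _ _ that]) (use ib \<beta> E_subset incl_proj in auto)
  have t1: "tmap2 T V E (H 1) \<beta> (proj V) z \<in> H 2" if "z \<in> tprods T [E, H 1]" for z
    unfolding tpow_2 by (rule tmap2_in[OF \<beta>o linear_on_proj ims(2,3) that])
  have t2: "tmap2 T V (H 1) E (proj V) \<beta> z \<in> H 2" if "z \<in> tprods T [H 1, E]" for z
    unfolding tpow_2 by (rule tmap2_in[OF linear_on_proj \<beta>o ims(3,2) that])
  have mono: "tprods T [E, H 1] \<subseteq> tprods T [primitives T, H 1]" "tprods T [H 1, E] \<subseteq> tprods T [H 1, primitives T]"
    using E_subset by (auto intro!: tprods_mono)
  {
    assume A: ?A and z: ?zA
    have bz: "brd T z \<in> tprods T [H 1, E]" using brd_E_left z by blast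
    have "?J (c (tmap2 T V E (H 1) \<beta> (proj V) z)) = brd T (tmap2 T T (primitives T) (H 1) ib id z)"
      unfolding e1[OF z] brd_incl[OF t1[OF z]] ..
    also have "\<dots> = ?J (tmap2 T V (H 1) E (proj V) \<beta> (brd T z))"
      using A mono(1) z unfolding e2[OF bz, symmetric] by blast
    finally show ?C by (rule inj_onD[OF Jinj _ linear_map_in[OF linear_map_c t1[OF z]] t2[OF bz]])
  next
    assume B: ?B and z: ?zB
    have bz: "brd T z \<in> tprods T [E, H 1]" using brd_E_right z by blast
    have "?J (c (tmap2 T V (H 1) E (proj V) \<beta> z)) = brd T (tmap2 T T (H 1) (primitives T) id ib z)"
      unfolding e2[OF z] brd_incl[OF t2[OF z]] ..
    also have "\<dots> = ?J (tmap2 T V E (H 1) \<beta> (proj V) (brd T z))"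
      using B mono(2) z unfolding e1[OF bz, symmetric] by blast
    finally show ?D by (rule inj_onD[OF Jinj _ linear_map_in[OF linear_map_c t2[OF z]] t1[OF bz]])
  }
qed

end

section \<open>The universal enveloping algebra\<close>

lemma ideal_generated_ideal:
  assumes A: "algebra A" and S: "S \<subseteq> carr A"
  shows "ideal A (ideal_generated A S)" and "S \<subseteq> ideal_generated A S"
proof -
  have V: "vspace A" using algebra_vspace[OF A] .
  interpret vector_space "scl A" by (rule vspaceD(1)[OF V])
  have top: "ideal A (carr A)" using vspaceD(2)[OF V] mult_closed[OF A] by (simp add: ideal_def)
  show "S \<subseteq> ideal_generated A S" by (auto simp: ideal_generated_def)
  have "subspace (ideal_generated A S)"
    unfolding ideal_generated_def by (rule subspace_Inter) (auto simp: ideal_def)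
  then show "ideal A (ideal_generated A S)"
    unfolding ideal_def using S top by (auto simp: ideal_generated_def ideal_def)
qed

lemma ideal_generated_zero:
  assumes A: "algebra A" and S: "S \<subseteq> {0}" shows "ideal_generated A S \<subseteq> {0}"
proof -
  have V: "vspace A" using algebra_vspace[OF A] .
  interpret vector_space "scl A" by (rule vspaceD(1)[OF V])
  have "0 \<in> carr A" using subspace_0[OF vspaceD(2)[OF V]] .
  then have "ideal A {0}"
    using linear_map_0[OF linear_map_mult_left[OF A]] linear_map_0[OF linear_map_mult_right[OF A]] by (simp add: ideal_def)
  then show ?thesis using S by (auto simp: ideal_generated_def)
qed

section \<open>The tower of a bracket and its direct limit\<close>

locale braided_Lie =
  fixes V :: "('k::field, 'v::ab_group_add) vsp" and c :: "('k, 'v) tens \<Rightarrow> ('k, 'v) tens"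
    and T :: "('k, ('k, 'v) tens) bialg" and U :: "nat \<Rightarrow> ('k, ('k, 'v) tens) bialg"
    and p :: "nat \<Rightarrow> ('k, 'v) tens \<Rightarrow> ('k, 'v) tens" and i :: "nat \<Rightarrow> 'v \<Rightarrow> ('k, 'v) tens"
    and b :: "nat \<Rightarrow> ('k, 'v) tens \<Rightarrow> 'v" and L :: "('k, 'l::ab_group_add) bialg"
    and q :: "nat \<Rightarrow> ('k, 'v) tens \<Rightarrow> 'l"
  assumes Lie: "braided_Lie_algebra V c T U p i b L q"
begin

lemma bracket_V: "bracket V c T U p i b" and limit: "direct_limit U p L q"
  and inj_iU: "inj_on (q 0 \<circ> i 0) (carr V)" and VT: "braided_space V c" "braided_tensor_algebra V c T"
  using Lie by (auto simp: braided_Lie_algebra_def)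

abbreviation I where "I n \<equiv> ideal_generated (U n) ((\<lambda>x. x - i n (b n x)) ` primitives (U n))"

lemma U_0: "U 0 = T" and i_0: "v \<in> carr V \<Longrightarrow> i 0 v = incl V v"
  and bialgebra_U: "braided_bialgebra (U n)" and i_primitive: "i n ` carr V \<subseteq> primitives (U n)"
  and b_linear: "linear_map (primitives (U n)) (scl (U n)) (carr V) (scl V) (b n)"
  and quotient_U: "bialgebra_quotient (U n) (I n) (U (Suc n)) (p n)"
  and i_Suc: "v \<in> carr V \<Longrightarrow> i (Suc n) v = p n (i n v)"
  using bracket_V unfolding bracket_def Let_def by blast+

lemma algebra_U: "algebra (U n)" and vspace_U: "vspace (U n)"
  using bialgebra_U[of n] by (auto simp: braided_bialgebra_def braided_algebra_def algebra_def)

lemma p_hom: "bialgebra_hom (U n) (U (Suc n)) (p n)" and p_surj: "p n ` carr (U n) = carr (U (Suc n))"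
  using quotient_U[of n] by (auto simp: bialgebra_quotient_def)

lemma p_linear: "linear_map (carr (U n)) (scl (U n)) (carr (U (Suc n))) (scl (U (Suc n))) (p n)"
  using p_hom[of n] by (simp add: bialgebra_hom_def algebra_hom_def)

lemma p_eq_iff: "x \<in> carr (U n) \<Longrightarrow> y \<in> carr (U n) \<Longrightarrow> p n x = p n y \<longleftrightarrow> x - y \<in> I n"
  by (rule algebra_quotient_eq_iff[OF vspace_U bialgebra_quotient_algebra_quotient[OF quotient_U]])

lemma q_eq_iff:
  assumes "x \<in> carr (U m)" "y \<in> carr (U n)"
  shows "q m x = q n y \<longleftrightarrow> (\<exists>k\<ge>max m n. fold p [m..<k] x = fold p [n..<k] y)"
proof -
  have "\<forall>m n. \<forall>x\<in>carr (U m). \<forall>y\<in>carr (U n). q m x = q n y \<longleftrightarrow> (\<exists>k\<ge>max m n. fold p [m..<k] x = fold p [n..<k] y)"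
    using limit unfolding direct_limit_def by (elim conjE)
  from this[rule_format, OF assms] show ?thesis .
qed

lemma q_Suc: "x \<in> carr (U n) \<Longrightarrow> q (Suc n) (p n x) = q n x"
proof -
  assume x: "x \<in> carr (U n)"
  then have px: "p n x \<in> carr (U (Suc n))" using p_surj by blast
  \<comment> \<open>At k = Suc n the first composite is empty and the second one is
    \<open>p n\<close>.\<close>
  have "\<exists>k\<ge>max (Suc n) n. fold p [Suc n..<k] (p n x) = fold p [n..<k] x"
    by (rule exI[of _ "Suc n"]) simp
  then show ?thesis unfolding q_eq_iff[OF px x] .
qed

lemma q_i: "v \<in> carr V \<Longrightarrow> q n (i n v) = q 0 (i 0 v)"
proof (induction n)
  case (Suc n)
  have "i n v \<in> carr (U n)" using i_primitive Suc.prems by (auto simp: primitives_def)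
  then show ?case using q_Suc Suc i_Suc by simp
qed simp

text \<open>\<open>x\<close> and \<open>i (b x)\<close> agree in the limit, so injectivity of the canonical map forces \<open>b (i v) = v\<close>.\<close>

lemma b_i: assumes v: "v \<in> carr V" shows "b n (i n v) = v"
proof -
  let ?x = "i n v" and ?w = "b n (i n v)"
  have x: "?x \<in> primitives (U n)" using i_primitive v by blast
  have w: "?w \<in> carr V" by (rule linear_map_in[OF b_linear x])
  have ic: "i n u \<in> carr (U n)" if "u \<in> carr V" for u
    using i_primitive[of n] that by (auto simp: primitives_def)
  note xc = ic[OF v] ic[OF w]
  have sub: "(\<lambda>x. x - i n (b n x)) ` primitives (U n) \<subseteq> carr (U n)"
  proof (rule image_subsetI)
    interpret vector_space "scl (U n)" by (rule vspaceD(1)[OF vspace_U])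
    fix y assume y: "y \<in> primitives (U n)"
    then have "y \<in> carr (U n)" by (simp add: primitives_def)
    then show "y - i n (b n y) \<in> carr (U n)"
      by (rule subspace_diff[OF vspaceD(2)[OF vspace_U] _ ic[OF linear_map_in[OF b_linear y]]])
  qed
  have "?x - i n ?w \<in> I n" by (rule subsetD[OF ideal_generated_ideal(2)[OF algebra_U sub] imageI[OF x]])
  then have "p n ?x = p n (i n ?w)" using p_eq_iff[OF xc] by simp
  then have "q n ?x = q n (i n ?w)" using q_Suc[OF xc(1)] q_Suc[OF xc(2)] by simp
  then have "(q 0 \<circ> i 0) v = (q 0 \<circ> i 0) ?w" unfolding o_apply q_i[OF v, of n] q_i[OF w, of n] .
  from inj_onD[OF inj_iU this v w] show ?thesis by (rule sym)
qed

text \<open>If every primitive element comes from V, then all relations x - i (b x) vanish by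
  \<open>b_i\<close>, so the quotient divides by zero. The second claim is the same hypothesis one
  stage later, which lets the argument propagate.\<close>

lemma p_bij:
  assumes P: "primitives (U n) \<subseteq> i n ` carr V"
  shows "bij_betw (p n) (carr (U n)) (carr (U (Suc n)))" and "primitives (U (Suc n)) \<subseteq> i (Suc n) ` carr V"
proof -
  have "(\<lambda>x. x - i n (b n x)) ` primitives (U n) \<subseteq> {0}" using P b_i by auto
  then have "I n \<subseteq> {0}" by (rule ideal_generated_zero[OF algebra_U])
  then have "inj_on (p n) (carr (U n))" using p_eq_iff by (auto simp: inj_on_def)
  then show *: "bij_betw (p n) (carr (U n)) (carr (U (Suc n)))" using p_surj by (simp add: bij_betw_def)
  have "primitives (U (Suc n)) \<subseteq> p n ` primitives (U n)"
    by (rule primitives_bij[OF bialgebra_U bialgebra_U p_hom *])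
  then show "primitives (U (Suc n)) \<subseteq> i (Suc n) ` carr V" using P i_Suc by fastforce
qed

text \<open>From stage 1 on all transition maps are bijective. Equality in the limit means equality
  at some later stage, hence already at stage 1. All stages have the same image in the limit because
  the projections are onto.\<close>

lemma q_1_iso:
  assumes P: "primitives (U 1) \<subseteq> i 1 ` carr V"
  shows "bialgebra_iso (U 1) L (q 1)"
proof -
  have Pn: "primitives (U n) \<subseteq> i n ` carr V" if "1 \<le> n" for n
    using that by (induction n rule: dec_induct) (use P p_bij(2) in auto)
  have fold: "inj_on (fold p [1..<k]) (carr (U 1)) \<and> fold p [1..<k] ` carr (U 1) \<subseteq> carr (U k)" if "1 \<le> k" for k
    using that
  proof (induction k rule: dec_induct)
    case base show ?case by simp
  next
    case (step k)
    have pk: "inj_on (p k) (carr (U k))" "p k ` carr (U k) = carr (U (Suc k))"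
      using p_bij(1)[OF Pn[OF step.hyps(1)]] by (auto simp: bij_betw_def)
    have eq: "fold p [1..<Suc k] = p k \<circ> fold p [1..<k]" using step.hyps(1) by (simp add: fold_append)
    show ?case unfolding eq image_comp[symmetric]
      using step.IH pk comp_inj_on[OF _ inj_on_subset[OF pk(1)]] by blast
  qed
  have hom: "bialgebra_hom (U n) L (q n)" and cL: "carr L = (\<Union>n. q n ` carr (U n))" for n
    using limit by (auto simp: direct_limit_def)
  have "x = y" if xy: "x \<in> carr (U 1)" "y \<in> carr (U 1)" "q 1 x = q 1 y" for x y
  proof -
    obtain k where "1 \<le> k" "fold p [1..<k] x = fold p [1..<k] y"
      using xy(3) unfolding q_eq_iff[OF xy(1,2)] by auto
    then show ?thesis using fold[of k] inj_onD[of "fold p [1..<k]" "carr (U 1)" x y] xy(1,2) by simp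
  qed
  then have "inj_on (q 1) (carr (U 1))" by (auto simp: inj_on_def)
  moreover have "q 1 ` carr (U 1) = carr L"
  proof
    have s: "q (Suc n) ` carr (U (Suc n)) = q n ` carr (U n)" for n
      unfolding p_surj[symmetric] image_image by (rule image_cong[OF refl q_Suc])
    have s0: "q n ` carr (U n) = q 0 ` carr (U 0)" for n
      by (induction n) (simp_all only: s)
    have "q n ` carr (U n) \<subseteq> q 1 ` carr (U 1)" for n
      unfolding s0[of n] s0[of 1] by (rule order_refl)
    then show "carr L \<subseteq> q 1 ` carr (U 1)" unfolding cL by blast
    show "q 1 ` carr (U 1) \<subseteq> carr L" unfolding cL by blast
  qed
  ultimately show ?thesis using hom by (simp add: bialgebra_iso_def bij_betw_def)
qed

end

sublocale braided_Lie \<subseteq> tensor_bialgebra V c T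
  using VT bialgebra_U[of 0] unfolding U_0 by unfold_locales

section \<open>The first stage of the tower\<close>

context braided_Lie
begin

lemma i_0_image: "i 0 ` carr V = H 1"
  unfolding incl_carr[symmetric] by (rule image_cong[OF refl i_0])

lemma b_0_linear: "linear_map (primitives T) pscale (carr V) (scl V) (b 0)"
  using b_linear[of 0] by (simp add: U_0 scl_T)

text \<open>Write a primitive element as v + e. Since \<open>b 0\<close> inverts \<open>i 0\<close>
  on V, the contribution of v cancels and only e - \<beta> e remains, so even the sets of generators
  agree.\<close>

lemma relations_E:
  assumes \<beta>: "\<forall>x\<in>E. \<beta> x = b 0 x"
  shows "(\<lambda>x. x - i 0 (b 0 x)) ` primitives T = (\<lambda>x. x - incl V (\<beta> x)) ` E"
proof
  have bc: "b 0 x \<in> carr V" if "x \<in> primitives T" for x by (rule linear_map_in[OF b_0_linear that])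
  note i_b = i_0[OF bc]
  show "(\<lambda>x. x - incl V (\<beta> x)) ` E \<subseteq> (\<lambda>x. x - i 0 (b 0 x)) ` primitives T"
  proof (rule image_subsetI)
    fix x assume x: "x \<in> E"
    then have "x \<in> primitives T" using E_subset by blast
    then show "x - incl V (\<beta> x) \<in> (\<lambda>x. x - i 0 (b 0 x)) ` primitives T"
      using \<beta> x i_b by (intro image_eqI[where x = x]) simp_all
  qed
  show "(\<lambda>x. x - i 0 (b 0 x)) ` primitives T \<subseteq> (\<lambda>x. x - incl V (\<beta> x)) ` E"
  proof (rule image_subsetI)
    fix x assume x: "x \<in> primitives T"
    then obtain v e where ve: "x = v + e" "v \<in> H 1" "e \<in> E" by (rule primitive_decomp)
    have vP: "v \<in> primitives T" and eP: "e \<in> primitives T" using ve H1_primitive E_subset by auto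
    obtain u where u: "u \<in> carr V" "v = i 0 u" using ve(2) unfolding i_0_image[symmetric] by blast
    have "b 0 x = u + b 0 e"
      unfolding ve(1) linear_map_add[OF b_0_linear vP eP] using b_i[OF u(1), of 0] u(2) by simp
    then have "i 0 (b 0 x) = incl V u + incl V (b 0 e)"
      unfolding i_b[OF x] using linear_map_add[OF linear_map_incl[OF vspace_V] u(1) bc[OF eP]] by simp
    also have "incl V u = v" unfolding u(2) i_0[OF u(1)] ..
    finally have ibx: "i 0 (b 0 x) = v + incl V (b 0 e)" .
    have "\<beta> e = b 0 e" using \<beta> ve(3) by blast
    then have "x - i 0 (b 0 x) = e - incl V (\<beta> e)" unfolding ibx by (simp only: ve(1) add_diff_cancel_left)
    then show "x - i 0 (b 0 x) \<in> (\<lambda>x. x - incl V (\<beta> x)) ` E" using ve(3) by blast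
  qed
qed

lemma I_0: "\<forall>x\<in>E. \<beta> x = b 0 x \<Longrightarrow> I 0 = E_ideal V T \<beta>"
  unfolding U_0 E_ideal_def by (simp only: relations_E)

text \<open>The canonical map to the limit factors through \<open>p 0\<close>, so injectivity of V
  into the limit already gives injectivity at stage 1.\<close>

lemma p_0_inj: assumes "x \<in> H 1" "p 0 x = 0" shows "x = 0"
proof -
  interpret vector_space "scl V" by (rule vs_V)
  obtain v where v: "v \<in> carr V" "x = i 0 v" using assms(1) unfolding i_0_image[symmetric] by blast
  have z: "0 \<in> carr V" by (rule subspace_0[OF vspaceD(2)[OF vspace_V]])
  have i0: "i 0 0 = 0" unfolding i_0[OF z] by (rule linear_map_0[OF linear_map_incl[OF vspace_V] z])
  have x0: "x \<in> carr (U 0)" "0 \<in> carr (U 0)" using assms(1) H_in tens.subspace_0[OF subspace_T] by (auto simp: U_0)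
  have "p 0 0 = 0" by (rule linear_map_0[OF p_linear x0(2)])
  then have "q 0 x = q 0 0" using q_Suc[OF x0(1)] q_Suc[OF x0(2)] assms(2) by simp
  then have "(q 0 \<circ> i 0) v = (q 0 \<circ> i 0) 0" unfolding o_apply v(2) i0 .
  from inj_onD[OF inj_iU this v(1) z] show ?thesis unfolding v(2) by (simp only: i0)
qed

lemma E_braided:
  assumes \<beta>: "\<forall>x\<in>E. \<beta> x = b 0 x" and r: "algebra_quotient T (E_ideal V T \<beta>) UU r"
  shows "E_braided_Lie_algebra V c T \<beta> UU r"
proof -
  let ?P = "primitives (U 0)" and ?W = "i 0 ` carr V" and ?ib = "\<lambda>x. i 0 (b 0 x)"
  have com: "\<forall>z\<in>tprod2 (U 0) ?P ?W. brd (U 0) (tmap2 (U 0) (U 0) ?P ?W ?ib id z) = tmap2 (U 0) (U 0) ?W ?P id ?ib (brd (U 0) z)"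
    "\<forall>z\<in>tprod2 (U 0) ?W ?P. brd (U 0) (tmap2 (U 0) (U 0) ?W ?P id ?ib z) = tmap2 (U 0) (U 0) ?P ?W ?ib id (brd (U 0) z)"
    using bracket_V unfolding bracket_def Let_def by blast+
  note com' = com[unfolded U_0 i_0_image tprod2_eq_tprods]
  have ib: "?ib x = incl V (b 0 x)" if "x \<in> primitives T" for x by (rule i_0[OF linear_map_in[OF b_0_linear that]])
  have \<beta>': "\<beta> x = b 0 x" if "x \<in> E" for x using \<beta> that by blast
  have \<beta>l: "linear_map E pscale (carr V) (scl V) \<beta>"
    using linear_map_mono[OF b_0_linear E_subset order_refl] \<beta> tens.subspace_add[OF E_subspace] tens.subspace_scale[OF E_subspace]
    by (simp add: linear_map_def del: plus_fun_apply)
  have inj: "inj_on (\<lambda>v. r (incl V v)) (carr V)"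
  proof (rule inj_onI)
    fix v w assume vw: "v \<in> carr V" "w \<in> carr V" "r (incl V v) = r (incl V w)"
    have iv: "incl V v \<in> carr T" "incl V w \<in> carr T" "incl V v \<in> H 1" "incl V w \<in> H 1"
      using vw incl_carr H_in by blast+
    \<comment> \<open>\<open>r\<close> and \<open>p 0\<close> have the same kernel, so injectivity
      for \<open>UU\<close> is that of \<open>p 0\<close> on V.\<close>
    have "incl V v - incl V w \<in> I 0"
      unfolding I_0[OF \<beta>] using algebra_quotient_eq_iff[OF vspace_T r iv(1,2)] vw(3) by blast
    then have "p 0 (incl V v) = p 0 (incl V w)" using p_eq_iff[of _ 0, unfolded U_0, OF iv(1,2)] unfolding U_0 by blast
    moreover have "p 0 (incl V v - incl V w) = p 0 (incl V v) - p 0 (incl V w)"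
      by (rule linear_map_diff[OF p_linear[of 0, unfolded U_0] tens.subspace_diff[OF subspace_T iv(1,2)] iv(2)])
    ultimately have "p 0 (incl V v - incl V w) = 0" by simp
    then have "incl V v - incl V w = 0" by (rule p_0_inj[OF tens.subspace_diff[OF tpow_subspace iv(3,4)]])
    then have "incl V v = incl V w" by simp
    then show "v = w" using bij_betw_incl[OF vspace_V] vw(1,2) unfolding bij_betw_def by (meson inj_onD)
  qed
  show ?thesis
    unfolding E_braided_Lie_algebra_def Let_def tprod2_eq_tprods
    using VT \<beta>l brd_E_left brd_E_right r inj bracket_restricts(1)[OF b_0_linear \<beta>' ib com'(1)] bracket_restricts(2)[OF b_0_linear \<beta>' ib com'(2)]
    by (intro conjI ballI)
qed

lemma class_S_iso:
  assumes S: "class_S V T"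
  shows "bialgebra_iso (U 1) L (q 1)"
proof (rule q_1_iso)
  obtain N :: "('k, ('k, 'v) tens) bialg" and \<pi> J where J: "J = tens.span (\<Union>n\<in>{2..}. J \<inter> H n)"
    and N: "bialgebra_quotient T J N \<pi>" and PN: "primitives N = \<pi> ` H 1" and k: "kern T \<pi> = ideal_generated T E"
    using S unfolding class_S_def Nichols_algebra_def by blast
  \<comment> \<open>Here class S enters: the Nichols ideal is generated by \<open>E\<close>, which
    is what \<open>leading_terms\<close> needs in order to supply \<open>lead\<close>.\<close>
  have JE: "J = ideal_generated T E" using N k by (simp add: bialgebra_quotient_def)
  have Q: "bialgebra_quotient T (I 0) (U 1) (p 0)" using quotient_U[of 0] by (simp add: U_0)
  let ?g = "\<lambda>e. incl V (b 0 e)"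
  have I: "I 0 = E_ideal V T (b 0)" by (rule I_0) simp
  have g1: "?g e \<in> H 1" if "e \<in> E" for e
    using linear_map_in[OF b_0_linear] that E_subset incl_carr by blast
  have sub: "(\<lambda>x. x - ?g x) ` E \<subseteq> carr T"
    using tens.subspace_diff[OF subspace_T] E_subset primitives_carr g1 H_in by blast
  have id: "ideal T (I 0)" "(\<lambda>x. x - ?g x) ` E \<subseteq> I 0"
    unfolding I E_ideal_def by (rule ideal_generated_ideal[OF algebra_T sub])+
  have g2: "?g e \<in> H 1 \<and> e - ?g e \<in> I 0" if "e \<in> E" for e
    using g1[OF that] subsetD[OF id(2) imageI[OF that]] ..
  have lead: "\<exists>y\<in>I 0. x - y \<in> tlow V n" if "x \<in> J" and xn: "x \<in> H n" for n x
  proof -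
    have x: "x \<in> ideal_generated T E" using that(1) unfolding JE .
    obtain y where "y \<in> I 0" "x - y \<in> tlow V n" using leading_terms[OF id(1) g2 x xn] .
    then show ?thesis by blast
  qed
  have "primitives (U 1) \<subseteq> p 0 ` H 1"
    by (rule primitives_quotient[OF Q p_0_inj N J PN lead])
  also have "\<dots> = i 1 ` carr V"
    unfolding i_0_image[symmetric] image_image using i_Suc[of _ 0] by (intro image_cong) simp_all
  finally show "primitives (U 1) \<subseteq> i 1 ` carr V" .
qed

end

theorem theorem5p10:
  fixes V :: "('k::field, 'v::ab_group_add) vsp"
    and c :: "('k, 'v) tens \<Rightarrow> ('k, 'v) tens"
    and T :: "('k, ('k, 'v) tens) bialg"
    and U :: "nat \<Rightarrow> ('k, ('k, 'v) tens) bialg"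
    and p :: "nat \<Rightarrow> ('k, 'v) tens \<Rightarrow> ('k, 'v) tens"
    and i :: "nat \<Rightarrow> 'v \<Rightarrow> ('k, 'v) tens"
    and b :: "nat \<Rightarrow> ('k, 'v) tens \<Rightarrow> 'v"
    and L :: "('k, 'l::ab_group_add) bialg"
    and q :: "nat \<Rightarrow> ('k, 'v) tens \<Rightarrow> 'l"
    and \<beta> :: "('k, 'v) tens \<Rightarrow> 'v"
    and UU :: "('k, 'w::ab_group_add) alg"
    and r :: "('k, 'v) tens \<Rightarrow> 'w"
  assumes "braided_Lie_algebra V c T U p i b L q"
    and "\<forall>x\<in>E_space V T. \<beta> x = b 0 x"
    and "algebra_quotient T (E_ideal V T \<beta>) UU r"
  shows "E_braided_Lie_algebra V c T \<beta> UU r \<and>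
    bialgebra_quotient T (E_ideal V T \<beta>) (U 1) (p 0) \<and>
    (\<exists>\<phi>. algebra_iso UU (U 1) \<phi> \<and> (\<forall>x\<in>carr T. \<phi> (r x) = p 0 x)) \<and>
    (class_S V T \<longrightarrow> bialgebra_iso (U 1) L (q 1))"
proof -
  interpret braided_Lie V c T U p i b L q by standard (rule assms(1))
  have Q: "bialgebra_quotient T (E_ideal V T \<beta>) (U 1) (p 0)"
    using quotient_U[of 0] unfolding I_0[OF assms(2)] by (simp add: U_0)
  obtain \<phi> where "algebra_iso UU (U 1) \<phi>" "\<And>x. x \<in> carr T \<Longrightarrow> \<phi> (r x) = p 0 x"
    using algebra_quotient_unique[OF algebra_T assms(3) bialgebra_quotient_algebra_quotient[OF Q]] by blast
  then show ?thesis using E_braided[OF assms(2,3)] Q class_S_iso by blast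
qed

end
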